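(* Suppose $R$ is a (unital) ring and $e\in R$ is an idempotent. Let $S:=R/ReR$ and suppose that there exists a unital ring homomorphism $\sigma:S\to R$ such that $\pi\circ\sigma=\operatorname{id}_S$, where $\pi:R\to S$ is the quotient map. Then there is a split short exact sequence of Abelian groups $$0\longrightarrow K_0(eRe)\stackrel{\phi}{\longrightarrow}K_0(R)\stackrel{\psi}{\longrightarrow}K_0(S)\longrightarrow0,$$ where $\phi([P]):=[Re\otimes_{eRe}P]$ and $\psi([Q]):=[S\otimes_RQ]$. Moreover, $R$ is stably finite if and only if both $eRe$ and $S$ are stably finite.
   Context: All rings and modules are unital ($eRe$ has identity element $e$). For a ring $R$, $K_0(R)$ is the split Grothendieck group of the category of finitely generated projective left $R$-modules. A ring $R$ is stably finite if $AB=1\Rightarrow BA=1$ for all matrices $A,B\in M_n(R)$ and all $n\ge1$ (equivalently, $[P]=0$ in $K_0(R)$ implies $P=0$ for every finitely generated projective left $R$-module $P$). $S$ is viewed as an $(S,R)$-bimodule via $\pi$. *)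

theory Defs
  imports "HOL-Algebra.Algebra"
begin

section \<open>Left modules over a possibly noncommutative ring\<close>

text \<open>The locale \<^locale>\<open>module\<close> of the library requires a commutative ring. We reuse its record
  type; as in the library, the multiplicative fields of a module record carry no meaning.\<close>

locale left_module = R?: ring R + M?: abelian_group M
  for R :: "('a, 'c) ring_scheme" (structure) and M :: "('a, 'm, 'd) module_scheme" (structure) +
  assumes smult_closed [simp, intro]:
      "\<lbrakk>a \<in> carrier R; x \<in> carrier M\<rbrakk> \<Longrightarrow> a \<odot>\<^bsub>M\<^esub> x \<in> carrier M"
    and smult_l_distr:
      "\<lbrakk>a \<in> carrier R; b \<in> carrier R; x \<in> carrier M\<rbrakk> \<Longrightarrow>
        (a \<oplus>\<^bsub>R\<^esub> b) \<odot>\<^bsub>M\<^esub> x = a \<odot>\<^bsub>M\<^esub> x \<oplus>\<^bsub>M\<^esub> b \<odot>\<^bsub>M\<^esub> x"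
    and smult_r_distr:
      "\<lbrakk>a \<in> carrier R; x \<in> carrier M; y \<in> carrier M\<rbrakk> \<Longrightarrow>
        a \<odot>\<^bsub>M\<^esub> (x \<oplus>\<^bsub>M\<^esub> y) = a \<odot>\<^bsub>M\<^esub> x \<oplus>\<^bsub>M\<^esub> a \<odot>\<^bsub>M\<^esub> y"
    and smult_assoc:
      "\<lbrakk>a \<in> carrier R; b \<in> carrier R; x \<in> carrier M\<rbrakk> \<Longrightarrow>
        (a \<otimes>\<^bsub>R\<^esub> b) \<odot>\<^bsub>M\<^esub> x = a \<odot>\<^bsub>M\<^esub> (b \<odot>\<^bsub>M\<^esub> x)"
    and smult_one [simp]: "x \<in> carrier M \<Longrightarrow> \<one>\<^bsub>R\<^esub> \<odot>\<^bsub>M\<^esub> x = x"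

definition mod_hom ::
    "('a, 'c) ring_scheme \<Rightarrow> ('a, 'm) module \<Rightarrow> ('a, 'n) module \<Rightarrow> ('m \<Rightarrow> 'n) set"
  where "mod_hom R M N = {h \<in> carrier M \<rightarrow> carrier N.
    (\<forall>x\<in>carrier M. \<forall>y\<in>carrier M. h (x \<oplus>\<^bsub>M\<^esub> y) = h x \<oplus>\<^bsub>N\<^esub> h y) \<and>
    (\<forall>a\<in>carrier R. \<forall>x\<in>carrier M. h (a \<odot>\<^bsub>M\<^esub> x) = a \<odot>\<^bsub>N\<^esub> h x)}"

definition isomorphic_modules ::
    "('a, 'c) ring_scheme \<Rightarrow> ('a, 'm) module \<Rightarrow> ('a, 'n) module \<Rightarrow> bool"
  where "isomorphic_modules R M N \<longleftrightarrow> (\<exists>h\<in>mod_hom R M N. bij_betw h (carrier M) (carrier N))"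

definition direct_sum :: "('a, 'm) module \<Rightarrow> ('a, 'n) module \<Rightarrow> ('a, 'm \<times> 'n) module"
  where "direct_sum M N =
    \<lparr>carrier = carrier M \<times> carrier N, monoid.mult = undefined, one = undefined,
     ring.zero = (\<zero>\<^bsub>M\<^esub>, \<zero>\<^bsub>N\<^esub>), add = (\<lambda>(x, y) (x', y'). (x \<oplus>\<^bsub>M\<^esub> x', y \<oplus>\<^bsub>N\<^esub> y')),
     smult = (\<lambda>a (x, y). (a \<odot>\<^bsub>M\<^esub> x, a \<odot>\<^bsub>N\<^esub> y))\<rparr>"

section \<open>Finitely generated projective modules\<close>

definition fin_gen :: "('a, 'c) ring_scheme \<Rightarrow> ('a, 'm) module \<Rightarrow> bool"
  where "fin_gen R M \<longleftrightarrow> (\<exists>A. finite A \<and> A \<subseteq> carrier M \<and>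
    carrier M = {finsum M (\<lambda>x. c x \<odot>\<^bsub>M\<^esub> x) A |c. c \<in> A \<rightarrow> carrier R})"

text \<open>Projectivity is the usual lifting property. HOL cannot quantify over types inside a definition,
  so the test modules have fixed element types. These are large enough to contain the canonical
  surjection onto the module from the free module on its elements, whence the lifting property for
  test modules with arbitrary element types; see \<open>projective_module_lift\<close> below.\<close>

definition projective_module :: "('a, 'c) ring_scheme \<Rightarrow> ('a, 'm) module \<Rightarrow> bool"
  where "projective_module R P \<longleftrightarrow>
    (\<forall>(N :: ('a, 'm \<Rightarrow> 'a) module) (N' :: ('a, 'm) module).
      left_module R N \<longrightarrow> left_module R N' \<longrightarrow>
      (\<forall>g\<in>mod_hom R N N'. \<forall>f\<in>mod_hom R P N'. g ` carrier N = carrier N' \<longrightarrow>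
        (\<exists>h\<in>mod_hom R P N. \<forall>x\<in>carrier P. g (h x) = f x)))"

definition fgp_module :: "('a, 'c) ring_scheme \<Rightarrow> ('a, 'm) module \<Rightarrow> bool"
  where "fgp_module R P \<longleftrightarrow> left_module R P \<and> fin_gen R P \<and> projective_module R P"

section \<open>The Grothendieck group\<close>

text \<open>Isomorphism classes are formed among modules with elements of type \<^typ>\<open>nat \<Rightarrow> 'a\<close>, where
  \<^typ>\<open>'a\<close> is the element type of the ring. Every finitely generated projective module is isomorphic
  to one of these (a direct summand of some \<open>R\<^sup>n\<close>); see \<open>fgp_module_representative\<close> below. The class
  of a module is defined whatever its element type.\<close>

definition iso_class ::
    "('a, 'c) ring_scheme \<Rightarrow> ('a, 'm) module \<Rightarrow> ('a, nat \<Rightarrow> 'a) module set"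
  where "iso_class R M = {N. fgp_module R N \<and> isomorphic_modules R M N}"

definition fgp_classes :: "('a, 'c) ring_scheme \<Rightarrow> ('a, nat \<Rightarrow> 'a) module set set"
  where "fgp_classes R = {iso_class R P |P :: ('a, nat \<Rightarrow> 'a) module. fgp_module R P}"

definition K0_relations ::
    "('a, 'c) ring_scheme \<Rightarrow> (('a, nat \<Rightarrow> 'a) module set \<Rightarrow>\<^sub>0 int) set"
  where "K0_relations R = generate (free_Abelian_group (fgp_classes R))
    {frag_of (iso_class R (direct_sum P Q)) - frag_of (iso_class R P) - frag_of (iso_class R Q)
      |(P :: ('a, nat \<Rightarrow> 'a) module) (Q :: ('a, nat \<Rightarrow> 'a) module).
        fgp_module R P \<and> fgp_module R Q}"

definition K0 :: "('a, 'c) ring_scheme \<Rightarrow> (('a, nat \<Rightarrow> 'a) module set \<Rightarrow>\<^sub>0 int) set monoid"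
  where "K0 R = free_Abelian_group (fgp_classes R) Mod K0_relations R"

definition K0_class ::
    "('a, 'c) ring_scheme \<Rightarrow> ('a, 'm) module \<Rightarrow> (('a, nat \<Rightarrow> 'a) module set \<Rightarrow>\<^sub>0 int) set"
  where "K0_class R M =
    K0_relations R #>\<^bsub>free_Abelian_group (fgp_classes R)\<^esub> frag_of (iso_class R M)"

section \<open>Bimodules and tensor products\<close>

record ('s, 'r, 'b) bimodule = "('s, 'b) module" +
  rsmult :: "'b \<Rightarrow> 'r \<Rightarrow> 'b"

definition tensor_relations ::
    "('r, 'c) ring_scheme \<Rightarrow> ('s, 'r, 'b) bimodule \<Rightarrow> ('r, 'm) module \<Rightarrow> ('b \<times> 'm \<Rightarrow>\<^sub>0 int) set"
  where "tensor_relations R B M = generate (free_Abelian_group (carrier B \<times> carrier M))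
    ({frag_of (b \<oplus>\<^bsub>B\<^esub> b', m) - frag_of (b, m) - frag_of (b', m)
        |b b' m. b \<in> carrier B \<and> b' \<in> carrier B \<and> m \<in> carrier M} \<union>
     {frag_of (b, m \<oplus>\<^bsub>M\<^esub> m') - frag_of (b, m) - frag_of (b, m')
        |b m m'. b \<in> carrier B \<and> m \<in> carrier M \<and> m' \<in> carrier M} \<union>
     {frag_of (rsmult B b r, m) - frag_of (b, r \<odot>\<^bsub>M\<^esub> m)
        |b r m. b \<in> carrier B \<and> r \<in> carrier R \<and> m \<in> carrier M})"

text \<open>The left module \<open>B \<otimes>\<^sub>R M\<close>. Its elements are cosets of formal \<open>\<int>\<close>-combinations of pairs, and
  a scalar \<open>s\<close> acts by \<open>(b, m) \<mapsto> (s b, m)\<close> on representatives.\<close>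

definition tensor ::
    "('r, 'c) ring_scheme \<Rightarrow> ('s, 'r, 'b) bimodule \<Rightarrow> ('r, 'm) module
      \<Rightarrow> ('s, ('b \<times> 'm \<Rightarrow>\<^sub>0 int) set) module"
  where "tensor R B M =
    (let F = free_Abelian_group (carrier B \<times> carrier M); K = tensor_relations R B M in
      \<lparr>carrier = carrier (F Mod K), monoid.mult = undefined, one = undefined,
       ring.zero = \<one>\<^bsub>F Mod K\<^esub>, add = monoid.mult (F Mod K),
       smult = (\<lambda>s C. \<Union>c\<in>C. K #>\<^bsub>F\<^esub> frag_extend (\<lambda>(b, m). frag_of (s \<odot>\<^bsub>B\<^esub> b, m)) c)\<rparr>)"

section \<open>Corner ring, quotient ring and their bimodules\<close>

definition corner_ring :: "('a, 'c) ring_scheme \<Rightarrow> 'a \<Rightarrow> ('a, 'c) ring_scheme"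
  where "corner_ring R e = R\<lparr>carrier := {e \<otimes>\<^bsub>R\<^esub> r \<otimes>\<^bsub>R\<^esub> e |r. r \<in> carrier R}, one := e\<rparr>"

definition corner_ideal :: "('a, 'c) ring_scheme \<Rightarrow> 'a \<Rightarrow> 'a set"
  where "corner_ideal R e =
    generate (add_monoid R) {r \<otimes>\<^bsub>R\<^esub> e \<otimes>\<^bsub>R\<^esub> s |r s. r \<in> carrier R \<and> s \<in> carrier R}"

text \<open>\<open>Re\<close> as an \<open>(R, eRe)\<close>-bimodule:\<close>

definition corner_bimodule :: "('a, 'c) ring_scheme \<Rightarrow> 'a \<Rightarrow> ('a, 'a, 'a) bimodule"
  where "corner_bimodule R e =
    \<lparr>carrier = {r \<otimes>\<^bsub>R\<^esub> e |r. r \<in> carrier R}, monoid.mult = undefined, one = undefined,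
     ring.zero = \<zero>\<^bsub>R\<^esub>, add = add R, smult = monoid.mult R, rsmult = monoid.mult R\<rparr>"

text \<open>\<open>R/I\<close> as an \<open>(R/I, R)\<close>-bimodule, via the quotient map on the right:\<close>

definition quotient_bimodule :: "('a, 'c) ring_scheme \<Rightarrow> 'a set \<Rightarrow> ('a set, 'a, 'a set) bimodule"
  where "quotient_bimodule R I =
    \<lparr>carrier = carrier (R Quot I), monoid.mult = undefined, one = undefined,
     ring.zero = \<zero>\<^bsub>R Quot I\<^esub>, add = add (R Quot I), smult = monoid.mult (R Quot I),
     rsmult = (\<lambda>x r. x \<otimes>\<^bsub>R Quot I\<^esub> (I +>\<^bsub>R\<^esub> r))\<rparr>"

section \<open>Stable finiteness\<close>

definition matrix_monoid :: "('a, 'c) ring_scheme \<Rightarrow> nat \<Rightarrow> (nat \<times> nat \<Rightarrow> 'a) monoid"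
  where "matrix_monoid R n =
    \<lparr>carrier = {..<n} \<times> {..<n} \<rightarrow>\<^sub>E carrier R,
     monoid.mult = (\<lambda>A B. \<lambda>(i, j)\<in>{..<n} \<times> {..<n}. finsum R (\<lambda>k. A (i, k) \<otimes>\<^bsub>R\<^esub> B (k, j)) {..<n}),
     one = (\<lambda>(i, j)\<in>{..<n} \<times> {..<n}. if i = j then \<one>\<^bsub>R\<^esub> else \<zero>\<^bsub>R\<^esub>)\<rparr>"

definition stably_finite :: "('a, 'c) ring_scheme \<Rightarrow> bool"
  where "stably_finite R \<longleftrightarrow>
    (\<forall>n\<ge>1. \<forall>A\<in>carrier (matrix_monoid R n). \<forall>B\<in>carrier (matrix_monoid R n).
      A \<otimes>\<^bsub>matrix_monoid R n\<^esub> B = \<one>\<^bsub>matrix_monoid R n\<^esub> \<longrightarrow>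
      B \<otimes>\<^bsub>matrix_monoid R n\<^esub> A = \<one>\<^bsub>matrix_monoid R n\<^esub>)"

section \<open>Split short exact sequences\<close>

text \<open>The predicate \<^const>\<open>exact_seq\<close> of the library forces all groups to have the same element type.\<close>

definition split_short_exact ::
    "('a, 'x) monoid_scheme \<Rightarrow> ('b, 'y) monoid_scheme \<Rightarrow> ('c, 'z) monoid_scheme
      \<Rightarrow> ('a \<Rightarrow> 'b) \<Rightarrow> ('b \<Rightarrow> 'c) \<Rightarrow> bool"
  where "split_short_exact A B C f g \<longleftrightarrow>
    comm_group A \<and> comm_group B \<and> comm_group C \<and> f \<in> hom A B \<and> g \<in> hom B C \<and>
    inj_on f (carrier A) \<and> f ` carrier A = kernel B C g \<and> g ` carrier B = carrier C \<and>
    (\<exists>s\<in>hom C B. \<forall>x\<in>carrier C. g (s x) = x)"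

section \<open>The fixed element types lose no generality\<close>

lemma mod_homD:
  assumes "h \<in> mod_hom R M N"
  shows "x \<in> carrier M \<Longrightarrow> h x \<in> carrier N"
    and "x \<in> carrier M \<Longrightarrow> y \<in> carrier M \<Longrightarrow> h (x \<oplus>\<^bsub>M\<^esub> y) = h x \<oplus>\<^bsub>N\<^esub> h y"
    and "a \<in> carrier R \<Longrightarrow> x \<in> carrier M \<Longrightarrow> h (a \<odot>\<^bsub>M\<^esub> x) = a \<odot>\<^bsub>N\<^esub> h x"
  using assms by (auto simp: mod_hom_def)

lemma mod_hom_zero:
  assumes "left_module R M" "left_module R N" "h \<in> mod_hom R M N"
  shows "h \<zero>\<^bsub>M\<^esub> = \<zero>\<^bsub>N\<^esub>"
proof -
  interpret M: left_module R M by fact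
  interpret N: left_module R N by fact
  have "h \<zero>\<^bsub>M\<^esub> \<oplus>\<^bsub>N\<^esub> h \<zero>\<^bsub>M\<^esub> = h \<zero>\<^bsub>M\<^esub>"
    using mod_homD(2)[OF assms(3), of "\<zero>\<^bsub>M\<^esub>" "\<zero>\<^bsub>M\<^esub>"] by simp
  then show ?thesis
    using mod_homD(1)[OF assms(3), of "\<zero>\<^bsub>M\<^esub>"] by (metis M.M.zero_closed N.M.add.l_cancel_one')
qed

lemma mod_hom_finsum:
  assumes "left_module R M" "left_module R N" "h \<in> mod_hom R M N"
    "finite A" "f \<in> A \<rightarrow> carrier M"
  shows "h (finsum M f A) = finsum N (\<lambda>x. h (f x)) A"
proof -
  interpret M: left_module R M by fact
  interpret N: left_module R N by fact
  show ?thesis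
    using assms(4,5)
  proof (induction A rule: finite_induct)
    case empty
    then show ?case by (simp add: mod_hom_zero[OF assms(1-3)])
  next
    case (insert a A)
    have "f \<in> A \<rightarrow> carrier M" "f a \<in> carrier M" using insert by auto
    moreover have "(\<lambda>x. h (f x)) \<in> A \<rightarrow> carrier N" "h (f a) \<in> carrier N"
      using insert mod_homD(1)[OF assms(3)] by auto
    ultimately show ?case
      using insert mod_homD(2)[OF assms(3)] by (simp add: M.M.finsum_closed)
  qed
qed

lemma (in left_module) smult_l_null:
  assumes "x \<in> carrier M" shows "\<zero>\<^bsub>R\<^esub> \<odot>\<^bsub>M\<^esub> x = \<zero>\<^bsub>M\<^esub>"
proof -
  have "\<zero>\<^bsub>R\<^esub> \<odot>\<^bsub>M\<^esub> x \<oplus>\<^bsub>M\<^esub> \<zero>\<^bsub>R\<^esub> \<odot>\<^bsub>M\<^esub> x = \<zero>\<^bsub>R\<^esub> \<odot>\<^bsub>M\<^esub> x"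
    using smult_l_distr[of "\<zero>\<^bsub>R\<^esub>" "\<zero>\<^bsub>R\<^esub>" x] assms by simp
  then show ?thesis using assms by (metis M.add.l_cancel_one' R.zero_closed smult_closed)
qed

lemma (in left_module) smult_r_null:
  assumes "a \<in> carrier R" shows "a \<odot>\<^bsub>M\<^esub> \<zero>\<^bsub>M\<^esub> = \<zero>\<^bsub>M\<^esub>"
proof -
  have "a \<odot>\<^bsub>M\<^esub> \<zero>\<^bsub>M\<^esub> \<oplus>\<^bsub>M\<^esub> a \<odot>\<^bsub>M\<^esub> \<zero>\<^bsub>M\<^esub> = a \<odot>\<^bsub>M\<^esub> \<zero>\<^bsub>M\<^esub>"
    using smult_r_distr[of a "\<zero>\<^bsub>M\<^esub>" "\<zero>\<^bsub>M\<^esub>"] assms by simp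
  then show ?thesis using assms by (metis M.add.l_cancel_one' M.zero_closed smult_closed)
qed

lemma (in left_module) smult_finsum:
  assumes "finite A" "f \<in> A \<rightarrow> carrier M" "a \<in> carrier R"
  shows "a \<odot>\<^bsub>M\<^esub> finsum M f A = finsum M (\<lambda>x. a \<odot>\<^bsub>M\<^esub> f x) A"
  using assms(1,2)
proof (induction A rule: finite_induct)
  case empty
  then show ?case by (simp add: smult_r_null assms)
next
  case (insert x A)
  have "f \<in> A \<rightarrow> carrier M" "f x \<in> carrier M" using insert by auto
  moreover have "(\<lambda>x. a \<odot>\<^bsub>M\<^esub> f x) \<in> A \<rightarrow> carrier M" "a \<odot>\<^bsub>M\<^esub> f x \<in> carrier M"
    using insert assms(3) by auto
  ultimately show ?case
    using insert assms(3) by (simp add: M.finsum_closed smult_r_distr)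
qed

definition free_module :: "('a, 'c) ring_scheme \<Rightarrow> 'i set \<Rightarrow> ('a, 'i \<Rightarrow> 'a) module"
  where "free_module R I =
    \<lparr>carrier = {u. range u \<subseteq> carrier R \<and> finite {i. u i \<noteq> \<zero>\<^bsub>R\<^esub>} \<and> {i. u i \<noteq> \<zero>\<^bsub>R\<^esub>} \<subseteq> I},
     monoid.mult = undefined, one = undefined, ring.zero = (\<lambda>i. \<zero>\<^bsub>R\<^esub>),
     add = (\<lambda>u v i. u i \<oplus>\<^bsub>R\<^esub> v i), smult = (\<lambda>a u i. a \<otimes>\<^bsub>R\<^esub> u i)\<rparr>"

lemma free_module_iff:
  "u \<in> carrier (free_module R I) \<longleftrightarrow>
    (\<forall>i. u i \<in> carrier R) \<and> finite {i. u i \<noteq> \<zero>\<^bsub>R\<^esub>} \<and> (\<forall>i. u i \<noteq> \<zero>\<^bsub>R\<^esub> \<longrightarrow> i \<in> I)"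
  by (auto simp: free_module_def)

lemma free_module_simps [simp]:
  "(u \<oplus>\<^bsub>free_module R I\<^esub> v) = (\<lambda>i. u i \<oplus>\<^bsub>R\<^esub> v i)"
  "(a \<odot>\<^bsub>free_module R I\<^esub> u) = (\<lambda>i. a \<otimes>\<^bsub>R\<^esub> u i)"
  "\<zero>\<^bsub>free_module R I\<^esub> = (\<lambda>i. \<zero>\<^bsub>R\<^esub>)"
  by (simp_all add: free_module_def)

lemma free_module_left_module:
  assumes "ring R" shows "left_module R (free_module R I)"
proof -
  interpret R: ring R by fact
  let ?F = "free_module R I"
  have add: "(\<lambda>i. u i \<oplus>\<^bsub>R\<^esub> v i) \<in> carrier ?F" if "u \<in> carrier ?F" "v \<in> carrier ?F" for u v
  proof -
    have "{i. u i \<oplus>\<^bsub>R\<^esub> v i \<noteq> \<zero>\<^bsub>R\<^esub>} \<subseteq> {i. u i \<noteq> \<zero>\<^bsub>R\<^esub>} \<union> {i. v i \<noteq> \<zero>\<^bsub>R\<^esub>}" by auto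
    moreover have "finite ({i. u i \<noteq> \<zero>\<^bsub>R\<^esub>} \<union> {i. v i \<noteq> \<zero>\<^bsub>R\<^esub>})"
      using that by (simp add: free_module_iff)
    ultimately have "finite {i. u i \<oplus>\<^bsub>R\<^esub> v i \<noteq> \<zero>\<^bsub>R\<^esub>}" by (rule finite_subset)
    then show ?thesis using that unfolding free_module_iff by (metis R.add.m_closed R.add.l_one R.zero_closed)
  qed
  have smult: "(\<lambda>i. a \<otimes>\<^bsub>R\<^esub> u i) \<in> carrier ?F" if "a \<in> carrier R" "u \<in> carrier ?F" for a u
  proof -
    have "{i. a \<otimes>\<^bsub>R\<^esub> u i \<noteq> \<zero>\<^bsub>R\<^esub>} \<subseteq> {i. u i \<noteq> \<zero>\<^bsub>R\<^esub>}" using that by auto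
    then have "finite {i. a \<otimes>\<^bsub>R\<^esub> u i \<noteq> \<zero>\<^bsub>R\<^esub>}" using that finite_subset by (auto simp: free_module_iff)
    then show ?thesis using that unfolding free_module_iff by (metis R.m_closed R.r_null)
  qed
  have ab: "abelian_group ?F"
  proof (rule abelian_groupI)
    fix u assume u: "u \<in> carrier ?F"
    have "(\<lambda>i. \<ominus>\<^bsub>R\<^esub> u i) \<in> carrier ?F"
    proof -
      have "{i. \<ominus>\<^bsub>R\<^esub> u i \<noteq> \<zero>\<^bsub>R\<^esub>} = {i. u i \<noteq> \<zero>\<^bsub>R\<^esub>}"
        using u by (auto simp: free_module_iff)
      then show ?thesis using u unfolding free_module_iff by (metis R.add.inv_closed R.minus_zero)
    qed
    moreover have "(\<lambda>i. \<ominus>\<^bsub>R\<^esub> u i) \<oplus>\<^bsub>?F\<^esub> u = \<zero>\<^bsub>?F\<^esub>"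
      using u by (auto simp: free_module_iff R.l_neg)
    ultimately show "\<exists>v\<in>carrier ?F. v \<oplus>\<^bsub>?F\<^esub> u = \<zero>\<^bsub>?F\<^esub>" by blast
  qed (auto simp: add, auto simp: free_module_iff R.add.m_ac)
  show ?thesis
    using ab by (intro left_module.intro left_module_axioms.intro assms)
      (auto simp: smult, auto simp: free_module_iff R.l_distr R.r_distr R.m_assoc)
qed

definition lincomb :: "('a, 'c) ring_scheme \<Rightarrow> ('a, 'm) module \<Rightarrow> ('i \<Rightarrow> 'm) \<Rightarrow> ('i \<Rightarrow> 'a) \<Rightarrow> 'm"
  where "lincomb R M m u = finsum M (\<lambda>i. u i \<odot>\<^bsub>M\<^esub> m i) {i. u i \<noteq> \<zero>\<^bsub>R\<^esub>}"

context
  fixes R :: "('a, 'c) ring_scheme" and M :: "('a, 'm) module" and m :: "'i \<Rightarrow> 'm" and I :: "'i set"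
  assumes M: "left_module R M" and m: "m \<in> I \<rightarrow> carrier M"
begin

interpretation left_module R M by (fact M)

lemma lincomb_superset:
  assumes "u \<in> carrier (free_module R I)" "finite A" "{i. u i \<noteq> \<zero>\<^bsub>R\<^esub>} \<subseteq> A" "A \<subseteq> I"
  shows "lincomb R M m u = finsum M (\<lambda>i. u i \<odot>\<^bsub>M\<^esub> m i) A"
  unfolding lincomb_def
proof (rule M.add.finprod_mono_neutral_cong_left)
  show "u i \<odot>\<^bsub>M\<^esub> m i = \<zero>\<^bsub>M\<^esub>" if "i \<in> A - {i. u i \<noteq> \<zero>\<^bsub>R\<^esub>}" for i
    using m assms that by (auto simp: smult_l_null Pi_def subset_iff)
  show "(\<lambda>i. u i \<odot>\<^bsub>M\<^esub> m i) \<in> A \<rightarrow> carrier M"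
    using m assms by (auto simp: free_module_iff Pi_def subset_iff)
qed (use assms in auto)

lemma lincomb_hom: "lincomb R M m \<in> mod_hom R (free_module R I) M"
proof -
  interpret F: left_module R "free_module R I" by (rule free_module_left_module) unfold_locales
  let ?s = "\<lambda>u. {i. u i \<noteq> \<zero>\<^bsub>R\<^esub>}"
  have cl: "u i \<odot>\<^bsub>M\<^esub> m i \<in> carrier M" if "u \<in> carrier (free_module R I)" "i \<in> I" for u i
    using that m by (auto simp: free_module_iff)
  have fs: "finite (?s u)" "?s u \<subseteq> I" if "u \<in> carrier (free_module R I)" for u
    using that by (auto simp: free_module_iff)
  show ?thesis
    unfolding mod_hom_def
  proof (intro CollectI conjI ballI Pi_I)
    fix u assume u: "u \<in> carrier (free_module R I)"
    show "lincomb R M m u \<in> carrier M"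
      unfolding lincomb_def using fs[OF u] cl[OF u] by (intro M.finsum_closed) blast
    fix v assume v: "v \<in> carrier (free_module R I)"
    let ?A = "?s u \<union> ?s v"
    have A: "finite ?A" "?A \<subseteq> I" using fs[OF u] fs[OF v] by auto
    have uv: "u \<oplus>\<^bsub>free_module R I\<^esub> v \<in> carrier (free_module R I)" using u v by (rule F.M.add.m_closed)
    have "lincomb R M m (u \<oplus>\<^bsub>free_module R I\<^esub> v)
        = finsum M (\<lambda>i. (u i \<oplus>\<^bsub>R\<^esub> v i) \<odot>\<^bsub>M\<^esub> m i) ?A"
      using lincomb_superset[OF uv, of ?A] A by fastforce
    also have "\<dots> = finsum M (\<lambda>i. u i \<odot>\<^bsub>M\<^esub> m i \<oplus>\<^bsub>M\<^esub> v i \<odot>\<^bsub>M\<^esub> m i) ?A"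
    proof (rule M.finsum_cong')
      show "(u i \<oplus>\<^bsub>R\<^esub> v i) \<odot>\<^bsub>M\<^esub> m i = u i \<odot>\<^bsub>M\<^esub> m i \<oplus>\<^bsub>M\<^esub> v i \<odot>\<^bsub>M\<^esub> m i" if "i \<in> ?A" for i
        using A u v m that by (intro smult_l_distr) (auto simp: free_module_iff)
      show "(\<lambda>i. u i \<odot>\<^bsub>M\<^esub> m i \<oplus>\<^bsub>M\<^esub> v i \<odot>\<^bsub>M\<^esub> m i) \<in> ?A \<rightarrow> carrier M"
        using A cl[OF u] cl[OF v] by blast
    qed simp
    also have "\<dots> = finsum M (\<lambda>i. u i \<odot>\<^bsub>M\<^esub> m i) ?A \<oplus>\<^bsub>M\<^esub> finsum M (\<lambda>i. v i \<odot>\<^bsub>M\<^esub> m i) ?A"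
      using A cl[OF u] cl[OF v] by (intro M.finsum_addf) blast+
    also have "\<dots> = lincomb R M m u \<oplus>\<^bsub>M\<^esub> lincomb R M m v"
      using lincomb_superset[OF u, of ?A] lincomb_superset[OF v, of ?A] A by simp
    finally show "lincomb R M m (u \<oplus>\<^bsub>free_module R I\<^esub> v) = lincomb R M m u \<oplus>\<^bsub>M\<^esub> lincomb R M m v" .
  next
    fix a u assume a: "a \<in> carrier R" and u: "u \<in> carrier (free_module R I)"
    have au: "a \<odot>\<^bsub>free_module R I\<^esub> u \<in> carrier (free_module R I)" using a u by (rule F.smult_closed)
    have "?s (\<lambda>i. a \<otimes>\<^bsub>R\<^esub> u i) \<subseteq> ?s u" using a by auto
    then have "lincomb R M m (a \<odot>\<^bsub>free_module R I\<^esub> u)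
        = finsum M (\<lambda>i. (a \<otimes>\<^bsub>R\<^esub> u i) \<odot>\<^bsub>M\<^esub> m i) (?s u)"
      using lincomb_superset[OF au, of "?s u"] fs[OF u] by simp
    also have "\<dots> = finsum M (\<lambda>i. a \<odot>\<^bsub>M\<^esub> (u i \<odot>\<^bsub>M\<^esub> m i)) (?s u)"
    proof (rule M.finsum_cong')
      show "(a \<otimes>\<^bsub>R\<^esub> u i) \<odot>\<^bsub>M\<^esub> m i = a \<odot>\<^bsub>M\<^esub> (u i \<odot>\<^bsub>M\<^esub> m i)" if "i \<in> ?s u" for i
        using a u m that fs[OF u] by (intro smult_assoc) (auto simp: free_module_iff)
      show "(\<lambda>i. a \<odot>\<^bsub>M\<^esub> (u i \<odot>\<^bsub>M\<^esub> m i)) \<in> ?s u \<rightarrow> carrier M"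
        using a fs[OF u] cl[OF u] by blast
    qed simp
    also have "\<dots> = a \<odot>\<^bsub>M\<^esub> lincomb R M m u"
      unfolding lincomb_def using fs[OF u] cl[OF u] a by (intro smult_finsum[symmetric]) blast+
    finally show "lincomb R M m (a \<odot>\<^bsub>free_module R I\<^esub> u) = a \<odot>\<^bsub>M\<^esub> lincomb R M m u" .
  qed
qed

lemma lincomb_single:
  assumes "i \<in> I"
  shows "(\<lambda>j. if j = i then \<one>\<^bsub>R\<^esub> else \<zero>\<^bsub>R\<^esub>) \<in> carrier (free_module R I)"
    and "lincomb R M m (\<lambda>j. if j = i then \<one>\<^bsub>R\<^esub> else \<zero>\<^bsub>R\<^esub>) = m i"
proof -
  let ?u = "\<lambda>j. if j = i then \<one>\<^bsub>R\<^esub> else \<zero>\<^bsub>R\<^esub>"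
  have "{j. ?u j \<noteq> \<zero>\<^bsub>R\<^esub>} \<subseteq> {i}" by auto
  then have "finite {j. ?u j \<noteq> \<zero>\<^bsub>R\<^esub>}" using finite_subset by blast
  then show u: "?u \<in> carrier (free_module R I)"
    using assms by (auto simp: free_module_iff)
  have mi: "m i \<in> carrier M" using m assms by auto
  have "lincomb R M m ?u = finsum M (\<lambda>j. ?u j \<odot>\<^bsub>M\<^esub> m j) {i}"
    by (rule lincomb_superset[OF u]) (use assms in auto)
  also have "\<dots> = m i" using mi by simp
  finally show "lincomb R M m ?u = m i" .
qed

end

lemma lincomb_mod_hom:
  assumes "left_module R M" "left_module R N" "h \<in> mod_hom R M N" "m \<in> I \<rightarrow> carrier M"
    "u \<in> carrier (free_module R I)"
  shows "h (lincomb R M m u) = lincomb R N (\<lambda>i. h (m i)) u"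
proof -
  interpret N: left_module R N by fact
  interpret M: left_module R M by fact
  have 1: "h (lincomb R M m u) = finsum N (\<lambda>i. h (u i \<odot>\<^bsub>M\<^esub> m i)) {i. u i \<noteq> \<zero>\<^bsub>R\<^esub>}"
    unfolding lincomb_def using assms(4,5)
    by (intro mod_hom_finsum[OF assms(1-3)]) (auto simp: free_module_iff)
  show ?thesis
    unfolding 1 unfolding lincomb_def
  proof (rule N.M.finsum_cong')
    show "(\<lambda>i. u i \<odot>\<^bsub>N\<^esub> h (m i)) \<in> {i. u i \<noteq> \<zero>\<^bsub>R\<^esub>} \<rightarrow> carrier N"
      using assms(4,5) mod_homD(1)[OF assms(3)] by (auto simp: free_module_iff Pi_def)
    show "h (u i \<odot>\<^bsub>M\<^esub> m i) = u i \<odot>\<^bsub>N\<^esub> h (m i)" if "i \<in> {i. u i \<noteq> \<zero>\<^bsub>R\<^esub>}" for i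
      using assms(4,5) that by (intro mod_homD(3)[OF assms(3)]) (auto simp: free_module_iff Pi_def)
  qed simp
qed

lemma mod_hom_comp:
  "f \<in> mod_hom R L M \<Longrightarrow> g \<in> mod_hom R M N \<Longrightarrow> (\<lambda>x. g (f x)) \<in> mod_hom R L N"
  by (auto simp: mod_hom_def Pi_def)

lemma projective_module_lift:
  fixes P :: "('a, 'm) module" and N :: "('a, 'n) module" and N' :: "('a, 'k) module"
  assumes P: "left_module R P" "projective_module R P"
    and N: "left_module R N" "left_module R N'"
    and g: "g \<in> mod_hom R N N'" "g ` carrier N = carrier N'"
    and f: "f \<in> mod_hom R P N'"
  shows "\<exists>h\<in>mod_hom R P N. \<forall>x\<in>carrier P. g (h x) = f x"
proof -
  interpret P: left_module R P by fact
  let ?F = "free_module R (carrier P)" and ?q = "lincomb R P (\<lambda>x. x)"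
  have F: "left_module R ?F" by (rule free_module_left_module) unfold_locales
  have q: "?q \<in> mod_hom R ?F P" by (rule lincomb_hom[OF P(1)]) simp
  have "x \<in> ?q ` carrier ?F" if "x \<in> carrier P" for x
    using lincomb_single[OF P(1), of "\<lambda>x. x" "carrier P" x] that
    by (metis (no_types, lifting) Pi_I image_iff)
  then have surj: "?q ` carrier ?F = carrier P" using mod_homD(1)[OF q] by blast
  have "(\<lambda>x. x) \<in> mod_hom R P P" by (auto simp: mod_hom_def)
  then obtain s where s: "s \<in> mod_hom R P ?F" "\<And>x. x \<in> carrier P \<Longrightarrow> ?q (s x) = x"
    using P(2)[unfolded projective_module_def, rule_format, OF F P(1) q] surj by blast
  have "\<forall>x\<in>carrier P. \<exists>y\<in>carrier N. g y = f x"
    using g(2) mod_homD(1)[OF f] by (metis (no_types, lifting) image_iff)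
  then obtain m where m: "\<And>x. x \<in> carrier P \<Longrightarrow> m x \<in> carrier N \<and> g (m x) = f x" by metis
  then have m': "m \<in> carrier P \<rightarrow> carrier N" by blast
  have "(\<lambda>x. lincomb R N m (s x)) \<in> mod_hom R P N"
    by (rule mod_hom_comp[OF s(1) lincomb_hom[OF N(1) m']])
  moreover have "g (lincomb R N m (s x)) = f x" if x: "x \<in> carrier P" for x
  proof -
    have sx: "s x \<in> carrier ?F" using mod_homD(1)[OF s(1) x] .
    have "g (lincomb R N m (s x)) = lincomb R N' (\<lambda>i. g (m i)) (s x)"
      by (rule lincomb_mod_hom[OF N g(1) m' sx])
    also have "\<dots> = lincomb R N' f (s x)"
    proof -
      interpret N': left_module R N' by fact
      show ?thesis unfolding lincomb_def
        using sx m mod_homD(1)[OF f] by (intro N'.M.finsum_cong') (auto simp: free_module_iff)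
    qed
    also have "\<dots> = f (?q (s x))"
      by (rule lincomb_mod_hom[OF P(1) N(2) f _ sx, symmetric]) simp
    finally show ?thesis using s(2) x by simp
  qed
  ultimately show ?thesis by (intro bexI[of _ "\<lambda>x. lincomb R N m (s x)"]) auto
qed

lemma fgp_module_iso:
  fixes P :: "('a, 'm) module" and Q :: "('a, 'n) module"
  assumes P: "fgp_module R P" and Q: "left_module R Q" and iso: "isomorphic_modules R P Q"
  shows "fgp_module R Q"
proof -
  interpret P: left_module R P using P by (simp add: fgp_module_def)
  interpret Q: left_module R Q by fact
  have lP: "left_module R P" and prP: "projective_module R P" using P by (auto simp: fgp_module_def)
  obtain h where h: "h \<in> mod_hom R P Q" and bij: "bij_betw h (carrier P) (carrier Q)"
    using iso by (auto simp: isomorphic_modules_def)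
  define k where "k = inv_into (carrier P) h"
  have k1: "k y \<in> carrier P" "h (k y) = y" if "y \<in> carrier Q" for y
    using bij that unfolding k_def
    by (metis bij_betw_imp_surj_on inv_into_into, metis bij_betw_imp_surj_on f_inv_into_f)
  have inj: "x = y" if "h x = h y" "x \<in> carrier P" "y \<in> carrier P" for x y
    using bij that by (meson bij_betw_def inj_onD)
  have k: "k \<in> mod_hom R Q P"
    unfolding mod_hom_def
  proof (intro CollectI conjI ballI Pi_I)
    show "k x \<in> carrier P" if "x \<in> carrier Q" for x using k1 that by blast
    show "k (x \<oplus>\<^bsub>Q\<^esub> y) = k x \<oplus>\<^bsub>P\<^esub> k y" if "x \<in> carrier Q" "y \<in> carrier Q" for x y
      by (rule inj) (use that k1 mod_homD(2)[OF h] in simp_all)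
    show "k (a \<odot>\<^bsub>Q\<^esub> x) = a \<odot>\<^bsub>P\<^esub> k x" if "a \<in> carrier R" "x \<in> carrier Q" for a x
      by (rule inj) (use that k1 mod_homD(3)[OF h] in simp_all)
  qed
  have "fin_gen R Q"
  proof -
    obtain A where A: "finite A" "A \<subseteq> carrier P"
      "carrier P = {finsum P (\<lambda>x. c x \<odot>\<^bsub>P\<^esub> x) A |c. c \<in> A \<rightarrow> carrier R}"
      using P by (auto simp: fgp_module_def fin_gen_def)
    have hA: "inj_on h A" using bij A(2) by (meson bij_betw_def inj_on_subset)
    have hAQ: "h ` A \<subseteq> carrier Q" using A(2) mod_homD(1)[OF h] by blast
    have "\<exists>c. y = finsum Q (\<lambda>x. c x \<odot>\<^bsub>Q\<^esub> x) (h ` A) \<and> c \<in> h ` A \<rightarrow> carrier R"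
      if y: "y \<in> carrier Q" for y
    proof -
      obtain c where c: "c \<in> A \<rightarrow> carrier R" "k y = finsum P (\<lambda>x. c x \<odot>\<^bsub>P\<^esub> x) A"
        using equalityD1[OF A(3), THEN subsetD, OF k1(1)[OF y]] by blast
      have kh: "k (h x) = x" if "x \<in> A" for x
        using inj k1 that A(2) hAQ by (metis image_subset_iff subset_iff)
      have "y = h (k y)" using k1 y by simp
      also have "\<dots> = finsum Q (\<lambda>x. h (c x \<odot>\<^bsub>P\<^esub> x)) A"
        unfolding c(2) using c(1) A(1,2) by (intro mod_hom_finsum[OF lP Q h]) auto
      also have "\<dots> = finsum Q (\<lambda>x. c (k (h x)) \<odot>\<^bsub>Q\<^esub> h x) A"
      proof (rule Q.M.finsum_cong')
        show "h (c x \<odot>\<^bsub>P\<^esub> x) = c (k (h x)) \<odot>\<^bsub>Q\<^esub> h x" if "x \<in> A" for x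
          using c(1) A(2) that mod_homD(3)[OF h] kh by (auto simp: Pi_def subset_iff)
        show "(\<lambda>x. c (k (h x)) \<odot>\<^bsub>Q\<^esub> h x) \<in> A \<rightarrow> carrier Q"
          using c(1) hAQ kh by (auto simp: Pi_def)
      qed simp
      also have "\<dots> = finsum Q (\<lambda>x. c (k x) \<odot>\<^bsub>Q\<^esub> x) (h ` A)"
        using hA c(1) hAQ kh by (intro Q.M.add.finprod_reindex[symmetric]) (auto simp: Pi_def)
      finally show ?thesis
        using c(1) kh by (intro exI[of _ "\<lambda>x. c (k x)"]) (auto simp: Pi_def)
    qed
    moreover have "finsum Q (\<lambda>x. c x \<odot>\<^bsub>Q\<^esub> x) (h ` A) \<in> carrier Q" if "c \<in> h ` A \<rightarrow> carrier R" for c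
      using that hAQ by (intro Q.M.finsum_closed) blast
    ultimately have "carrier Q = {finsum Q (\<lambda>x. c x \<odot>\<^bsub>Q\<^esub> x) (h ` A) |c. c \<in> h ` A \<rightarrow> carrier R}"
      by blast
    then show ?thesis unfolding fin_gen_def using A(1) hAQ by (intro exI[of _ "h ` A"]) simp
  qed
  moreover have "projective_module R Q"
    unfolding projective_module_def
  proof (intro allI impI ballI)
    fix N :: "('a, 'n \<Rightarrow> 'a) module" and N' :: "('a, 'n) module" and g f
    assume N: "left_module R N" "left_module R N'" and g: "g \<in> mod_hom R N N'"
      "g ` carrier N = carrier N'" and f: "f \<in> mod_hom R Q N'"
    obtain l where l: "l \<in> mod_hom R P N" "\<And>x. x \<in> carrier P \<Longrightarrow> g (l x) = f (h x)"
      using projective_module_lift[OF lP prP N g mod_hom_comp[OF h f]] by blast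
    show "\<exists>l\<in>mod_hom R Q N. \<forall>x\<in>carrier Q. g (l x) = f x"
      using mod_hom_comp[OF k l(1)] l(2) k1 by (intro bexI[of _ "\<lambda>x. l (k x)"]) auto
  qed
  ultimately show ?thesis using Q by (simp add: fgp_module_def)
qed

lemma fgp_module_representative:
  fixes P :: "('a, 'm) module"
  assumes P: "fgp_module R P"
  shows "\<exists>N :: ('a, nat \<Rightarrow> 'a) module. fgp_module R N \<and> isomorphic_modules R P N"
proof -
  interpret P: left_module R P using P by (simp add: fgp_module_def)
  have lP: "left_module R P" and prP: "projective_module R P" using P by (auto simp: fgp_module_def)
  obtain A where A: "finite A" "A \<subseteq> carrier P"
    "carrier P = {finsum P (\<lambda>x. c x \<odot>\<^bsub>P\<^esub> x) A |c. c \<in> A \<rightarrow> carrier R}"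
    using P by (auto simp: fgp_module_def fin_gen_def)
  obtain m where m: "bij_betw m {..<card A} A"
    using A(1) by (metis atLeast0LessThan ex_bij_betw_nat_finite)
  let ?I = "{..<card A}"
  have m': "m \<in> ?I \<rightarrow> carrier P" using m A(2) by (auto simp: bij_betw_def)
  let ?F = "free_module R ?I" and ?q = "lincomb R P m"
  have F: "left_module R ?F" by (rule free_module_left_module) unfold_locales
  interpret F: left_module R ?F by fact
  have q: "?q \<in> mod_hom R ?F P" by (rule lincomb_hom[OF lP m'])
  have "x \<in> ?q ` carrier ?F" if xP: "x \<in> carrier P" for x
  proof -
    obtain c where c: "c \<in> A \<rightarrow> carrier R" "x = finsum P (\<lambda>x. c x \<odot>\<^bsub>P\<^esub> x) A"
      using equalityD1[OF A(3), THEN subsetD, OF xP] by blast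
    define u where "u = (\<lambda>i. if i \<in> ?I then c (m i) else \<zero>\<^bsub>R\<^esub>)"
    have sub: "{i. u i \<noteq> \<zero>\<^bsub>R\<^esub>} \<subseteq> ?I" by (auto simp: u_def)
    then have "finite {i. u i \<noteq> \<zero>\<^bsub>R\<^esub>}" using finite_subset by blast
    then have u: "u \<in> carrier ?F"
      using sub c(1) m by (auto simp: free_module_iff u_def bij_betw_def)
    have mA: "m ` ?I = A" "inj_on m ?I" using m by (auto simp: bij_betw_def)
    have "?q u = finsum P (\<lambda>i. u i \<odot>\<^bsub>P\<^esub> m i) ?I"
      using lincomb_superset[OF lP m' u] sub by simp
    also have "\<dots> = finsum P (\<lambda>i. c (m i) \<odot>\<^bsub>P\<^esub> m i) ?I"
    proof (rule P.M.finsum_cong')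
      show "(\<lambda>i. c (m i) \<odot>\<^bsub>P\<^esub> m i) \<in> ?I \<rightarrow> carrier P"
        using c(1) m' mA(1) by (blast intro: P.smult_closed)
    qed (auto simp: u_def)
    also have "\<dots> = finsum P (\<lambda>x. c x \<odot>\<^bsub>P\<^esub> x) (m ` ?I)"
      using mA c(1) A(2) by (intro P.M.add.finprod_reindex[symmetric]) (auto simp: Pi_def)
    finally show ?thesis using u c(2) mA(1) by (metis image_eqI)
  qed
  then have surj: "?q ` carrier ?F = carrier P" using mod_homD(1)[OF q] by blast
  have "(\<lambda>x. x) \<in> mod_hom R P P" by (auto simp: mod_hom_def)
  then obtain s where s: "s \<in> mod_hom R P ?F" "\<And>x. x \<in> carrier P \<Longrightarrow> ?q (s x) = x"
    using projective_module_lift[OF lP prP F lP q surj] by blast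
  define N where "N = ?F\<lparr>carrier := s ` carrier P\<rparr>"
  have N_simps: "carrier N = s ` carrier P" "\<zero>\<^bsub>N\<^esub> = \<zero>\<^bsub>?F\<^esub>" "add N = add ?F" "smult N = smult ?F"
    by (simp_all add: N_def)
  have cl: "s x \<in> carrier ?F" if "x \<in> carrier P" for x using mod_homD(1)[OF s(1)] that .
  note sum = mod_homD(2)[OF s(1), symmetric] and sm = mod_homD(3)[OF s(1), symmetric]
  have "abelian_group N"
  proof (rule abelian_groupI, unfold N_simps)
    show "\<zero>\<^bsub>?F\<^esub> \<in> s ` carrier P" using mod_hom_zero[OF lP F s(1)] by (metis P.M.zero_closed imageI)
    fix x assume "x \<in> s ` carrier P"
    then obtain x' where x': "x' \<in> carrier P" "x = s x'" by blast
    show "\<zero>\<^bsub>?F\<^esub> \<oplus>\<^bsub>?F\<^esub> x = x" using cl x' F.M.l_zero by blast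
    have "s (\<ominus>\<^bsub>P\<^esub> x') \<oplus>\<^bsub>?F\<^esub> x = \<zero>\<^bsub>?F\<^esub>"
      using x' sum[of "\<ominus>\<^bsub>P\<^esub> x'" x'] mod_hom_zero[OF lP F s(1)] by (simp only: P.M.a_inv_closed P.M.l_neg)
    then show "\<exists>y\<in>s ` carrier P. y \<oplus>\<^bsub>?F\<^esub> x = \<zero>\<^bsub>?F\<^esub>" using x' by blast
    fix y assume "y \<in> s ` carrier P"
    then obtain y' where y': "y' \<in> carrier P" "y = s y'" by blast
    show "x \<oplus>\<^bsub>?F\<^esub> y \<in> s ` carrier P" using x' y' sum P.M.a_closed by (metis imageI)
    show "x \<oplus>\<^bsub>?F\<^esub> y = y \<oplus>\<^bsub>?F\<^esub> x" using F.M.a_comm cl x' y' by blast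
    fix z assume "z \<in> s ` carrier P"
    then show "x \<oplus>\<^bsub>?F\<^esub> y \<oplus>\<^bsub>?F\<^esub> z = x \<oplus>\<^bsub>?F\<^esub> (y \<oplus>\<^bsub>?F\<^esub> z)"
      using F.M.a_assoc cl x' y' by blast
  qed
  then have N: "left_module R N"
  proof (intro left_module.intro left_module_axioms.intro P.R.ring_axioms, unfold N_simps)
    fix a x assume a: "a \<in> carrier R" and "x \<in> s ` carrier P"
    then obtain x' where "x' \<in> carrier P" "x = s x'" by blast
    then show "a \<odot>\<^bsub>?F\<^esub> x \<in> s ` carrier P"
      using sm[OF a, of x'] P.smult_closed[OF a, of x'] by (simp only: imageI)
  qed (assumption | rule F.smult_l_distr F.smult_r_distr F.smult_assoc F.smult_one | blast intro: cl)+
  have "s \<in> mod_hom R P N" using s(1) by (auto simp: mod_hom_def N_simps)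
  moreover have "bij_betw s (carrier P) (carrier N)"
    unfolding bij_betw_def N_simps using s(2) by (metis inj_onI)
  ultimately have iso: "isomorphic_modules R P N" by (auto simp: isomorphic_modules_def)
  show ?thesis using fgp_module_iso[OF P N iso] iso by blast
qed

end

theory Submission
  imports Defs
begin

text \<open>An \<open>R\<close>-module is of the form \<open>Re \<otimes> P\<close> with \<open>P\<close> finitely generated projective exactly if
  it is a direct summand of a power of \<open>Re\<close>, and every map from a finitely generated projective module into \<open>ReR M\<close> factors through such a
  power. Hence finitely generated projective modules with isomorphic reductions modulo \<open>ReR\<close> become
  isomorphic after adding summands of powers of \<open>Re\<close>. Applied to \<open>M\<close> and \<open>R \<otimes>\<^sub>S (S \<otimes>\<^sub>R M)\<close>, this shows that
  \<open>K\<^sub>0(R)\<close> is generated by the images of \<open>K\<^sub>0(eRe)\<close> and \<open>K\<^sub>0(S)\<close>.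

  For injectivity, an isomorphism \<open>A \<oplus> R\<^sup>n \<cong> B \<oplus> R\<^sup>n\<close> with \<open>A\<close>, \<open>B\<close> summands of powers of \<open>Re\<close> can be
  corrected by an automorphism of \<open>R\<^sup>n\<close>, lifted along \<open>\<sigma>\<close>, so that it is the identity on \<open>R\<^sup>n\<close> modulo \<open>ReR\<close>.
  Its remaining part \<open>u w\<close> factors through a power of \<open>Re\<close>, and exchanging \<open>1 + u w\<close> for
  \<open>1 + w u\<close> replaces \<open>R\<^sup>n\<close> by that power. The same exchange transfers stable finiteness from \<open>eRe\<close> and \<open>S\<close> to \<open>R\<close>.\<close>

section \<open>Modules and retracts of free modules\<close>

text \<open>Equality of classes in \<open>K0 R\<close> only gives an isomorphism after adding some
  finitely generated projective \<open>M\<close>, which can be enlarged to R^n but is unrelated to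
  \<open>Re\<close>. Cutting with \<open>e\<close> brings modules back to eRe, yet it behaves well
  only on summands of powers of \<open>Re\<close>: cutting R^n gives (eR)^n, which need not be
  finitely generated projective over eRe. This is why R^n has to be exchanged for a power of
  \<open>Re\<close>. The exchange in turn needs the block on R^n to be the identity modulo the
  ideal, and an automorphism of S^n need not lift to an automorphism of R^n in general; a section of
  the quotient map lifts it entry by entry.

  Neither \<open>Re\<close> over eRe nor R over S is assumed flat, so tensor functors cannot be
  treated as exact. All arguments are carried by split maps, which every additive functor preserves.
  Likewise the ideal ReR need not be finitely generated as a left ideal; that a single power of
  \<open>Re\<close> suffices in each factorization comes from finite generation of the
  source.\<close>

lemma isomorphic_modulesI:
  assumes "f \<in> mod_hom R M N" "\<And>y. y \<in> carrier N \<Longrightarrow> g y \<in> carrier M"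
    "\<And>x. x \<in> carrier M \<Longrightarrow> g (f x) = x" "\<And>y. y \<in> carrier N \<Longrightarrow> f (g y) = y"
  shows "isomorphic_modules R M N"
  unfolding isomorphic_modules_def
  using assms mod_homD(1)[OF assms(1)] by (intro bexI[of _ f] bij_betwI[of _ _ _ g]) auto

lemma isomorphic_modulesE:
  assumes "isomorphic_modules R M N" "left_module R M" "left_module R N"
  obtains f g where "f \<in> mod_hom R M N" "g \<in> mod_hom R N M"
    "\<forall>x\<in>carrier M. g (f x) = x" "\<forall>y\<in>carrier N. f (g y) = y"
proof -
  interpret M: left_module R M by fact
  interpret N: left_module R N by fact
  obtain f where f: "f \<in> mod_hom R M N" and bij: "bij_betw f (carrier M) (carrier N)"
    using assms by (auto simp: isomorphic_modules_def)
  define g where "g = inv_into (carrier M) f"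
  have gf: "g (f x) = x" if "x \<in> carrier M" for x
    using bij that by (simp add: g_def bij_betw_inv_into_left)
  have fg: "g y \<in> carrier M" "f (g y) = y" if "y \<in> carrier N" for y
    using bij that by (auto simp: g_def bij_betw_inv_into_right bij_betw_def inv_into_into)
  have "g \<in> mod_hom R N M"
    unfolding mod_hom_def
  proof (intro CollectI conjI ballI Pi_I)
    fix x y assume "x \<in> carrier N" "y \<in> carrier N"
    then show "g (x \<oplus>\<^bsub>N\<^esub> y) = g x \<oplus>\<^bsub>M\<^esub> g y"
      using gf[of "g x \<oplus>\<^bsub>M\<^esub> g y"] fg mod_homD(2)[OF f] by simp
  next
    fix a x assume "a \<in> carrier R" "x \<in> carrier N"
    then show "g (a \<odot>\<^bsub>N\<^esub> x) = a \<odot>\<^bsub>M\<^esub> g x"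
      using gf[of "a \<odot>\<^bsub>M\<^esub> g x"] fg mod_homD(3)[OF f] by simp
  qed (use fg in auto)
  then show ?thesis using that f gf fg by blast
qed

lemma mod_hom_id [simp]: "(\<lambda>x. x) \<in> mod_hom R M M"
  by (auto simp: mod_hom_def)

lemma isomorphic_modules_refl [simp]: "isomorphic_modules R M M"
  by (rule isomorphic_modulesI[where g = "\<lambda>x. x"]) auto

lemma isomorphic_modules_sym:
  assumes "isomorphic_modules R M N" "left_module R M" "left_module R N"
  shows "isomorphic_modules R N M"
proof -
  obtain f g where "f \<in> mod_hom R M N" "g \<in> mod_hom R N M"
    "\<forall>x\<in>carrier M. g (f x) = x" "\<forall>y\<in>carrier N. f (g y) = y"
    using isomorphic_modulesE[OF assms] .
  then show ?thesis using mod_homD(1)[of f R M N] by (intro isomorphic_modulesI[of g _ _ _ f]) simp_all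
qed

lemma isomorphic_modules_trans:
  assumes "isomorphic_modules R L M" "isomorphic_modules R M N"
  shows "isomorphic_modules R L N"
proof -
  obtain f g where f: "f \<in> mod_hom R L M" "bij_betw f (carrier L) (carrier M)"
    and g: "g \<in> mod_hom R M N" "bij_betw g (carrier M) (carrier N)"
    using assms by (auto simp: isomorphic_modules_def)
  show ?thesis
    unfolding isomorphic_modules_def
    using mod_hom_comp[OF f(1) g(1)] bij_betw_trans[OF f(2) g(2)]
    by (intro bexI[of _ "\<lambda>x. g (f x)"]) (auto simp: comp_def)
qed

lemma direct_sum_simps [simp]:
  "carrier (direct_sum M N) = carrier M \<times> carrier N"
  "\<zero>\<^bsub>direct_sum M N\<^esub> = (\<zero>\<^bsub>M\<^esub>, \<zero>\<^bsub>N\<^esub>)"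
  "(x, y) \<oplus>\<^bsub>direct_sum M N\<^esub> (x', y') = (x \<oplus>\<^bsub>M\<^esub> x', y \<oplus>\<^bsub>N\<^esub> y')"
  "a \<odot>\<^bsub>direct_sum M N\<^esub> (x, y) = (a \<odot>\<^bsub>M\<^esub> x, a \<odot>\<^bsub>N\<^esub> y)"
  by (simp_all add: direct_sum_def)

lemma left_module_direct_sum:
  assumes "left_module R M" "left_module R N"
  shows "left_module R (direct_sum M N)"
proof -
  interpret M: left_module R M by fact
  interpret N: left_module R N by fact
  have "abelian_group (direct_sum M N)"
  proof (rule abelian_groupI)
    fix z assume "z \<in> carrier (direct_sum M N)"
    then show "\<exists>w\<in>carrier (direct_sum M N). w \<oplus>\<^bsub>direct_sum M N\<^esub> z = \<zero>\<^bsub>direct_sum M N\<^esub>"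
      by (intro bexI[of _ "(\<ominus>\<^bsub>M\<^esub> fst z, \<ominus>\<^bsub>N\<^esub> snd z)"]) (auto simp: M.M.l_neg N.M.l_neg)
  qed (auto simp: M.M.a_ac N.M.a_ac)
  then show ?thesis
    by (intro left_module.intro left_module_axioms.intro M.R.ring_axioms)
      (auto simp: M.smult_l_distr N.smult_l_distr M.smult_r_distr N.smult_r_distr
        M.smult_assoc N.smult_assoc)
qed

lemma isomorphic_direct_sum_cong:
  assumes "isomorphic_modules R M M'" "isomorphic_modules R N N'"
  shows "isomorphic_modules R (direct_sum M N) (direct_sum M' N')"
proof -
  obtain f g where f: "f \<in> mod_hom R M M'" "bij_betw f (carrier M) (carrier M')"
    and g: "g \<in> mod_hom R N N'" "bij_betw g (carrier N) (carrier N')"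
    using assms by (auto simp: isomorphic_modules_def)
  have "map_prod f g \<in> mod_hom R (direct_sum M N) (direct_sum M' N')"
    using f(1) g(1) by (auto simp: mod_hom_def)
  moreover have "bij_betw (map_prod f g) (carrier M \<times> carrier N) (carrier M' \<times> carrier N')"
    using bij_betw_map_prod[OF f(2) g(2)] by (simp add: map_prod_def)
  ultimately show ?thesis by (auto simp: isomorphic_modules_def)
qed

lemma isomorphic_direct_sum_commute:
  "isomorphic_modules R (direct_sum M N) (direct_sum N M)"
  by (rule isomorphic_modulesI[of "\<lambda>(x, y). (y, x)" _ _ _ "\<lambda>(x, y). (y, x)"])
    (auto simp: mod_hom_def)

lemma isomorphic_direct_sum_assoc:
  "isomorphic_modules R (direct_sum (direct_sum L M) N) (direct_sum L (direct_sum M N))"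
  by (rule isomorphic_modulesI[of "\<lambda>((x, y), z). (x, (y, z))" _ _ _ "\<lambda>(x, (y, z)). ((x, y), z)"])
    (auto simp: mod_hom_def)

lemma isomorphic_direct_sum_trivial:
  assumes "left_module R M" "left_module R N" "carrier N = {\<zero>\<^bsub>N\<^esub>}"
  shows "isomorphic_modules R (direct_sum M N) M"
proof -
  interpret M: left_module R M by fact
  interpret N: left_module R N by fact
  show ?thesis
    using assms(3)
    by (intro isomorphic_modulesI[of fst _ _ _ "\<lambda>x. (x, \<zero>\<^bsub>N\<^esub>)"]) (auto simp: mod_hom_def)
qed

lemma left_module_submodule:
  assumes "left_module R M" and H: "H \<subseteq> carrier M" "\<zero>\<^bsub>M\<^esub> \<in> H"
    "\<And>x y. x \<in> H \<Longrightarrow> y \<in> H \<Longrightarrow> x \<oplus>\<^bsub>M\<^esub> y \<in> H" "\<And>a x. a \<in> carrier R \<Longrightarrow> x \<in> H \<Longrightarrow> a \<odot>\<^bsub>M\<^esub> x \<in> H"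
  shows "left_module R (M\<lparr>carrier := H\<rparr>)"
proof -
  interpret M: left_module R M by fact
  \<comment> \<open>The negative of an element of \<open>H\<close> is its multiple by -1, so closure
    under scalars also yields inverses.\<close>
  have neg: "(\<ominus>\<^bsub>R\<^esub> \<one>\<^bsub>R\<^esub>) \<odot>\<^bsub>M\<^esub> x \<oplus>\<^bsub>M\<^esub> x = \<zero>\<^bsub>M\<^esub>" if "x \<in> carrier M" for x
  proof -
    have "(\<ominus>\<^bsub>R\<^esub> \<one>\<^bsub>R\<^esub>) \<odot>\<^bsub>M\<^esub> x \<oplus>\<^bsub>M\<^esub> x = (\<ominus>\<^bsub>R\<^esub> \<one>\<^bsub>R\<^esub> \<oplus>\<^bsub>R\<^esub> \<one>\<^bsub>R\<^esub>) \<odot>\<^bsub>M\<^esub> x"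
      using that by (simp add: M.smult_l_distr)
    then show ?thesis using that by (simp add: M.R.l_neg M.smult_l_null)
  qed
  have HM: "x \<in> H \<Longrightarrow> x \<in> carrier M" for x using H(1) by blast
  have "abelian_group (M\<lparr>carrier := H\<rparr>)"
  proof (rule abelian_groupI)
    fix x assume "x \<in> carrier (M\<lparr>carrier := H\<rparr>)"
    then show "\<exists>y\<in>carrier (M\<lparr>carrier := H\<rparr>). y \<oplus>\<^bsub>M\<lparr>carrier := H\<rparr>\<^esub> x = \<zero>\<^bsub>M\<lparr>carrier := H\<rparr>\<^esub>"
      using neg HM H(4) by (intro bexI[of _ "(\<ominus>\<^bsub>R\<^esub> \<one>\<^bsub>R\<^esub>) \<odot>\<^bsub>M\<^esub> x"]) auto
  qed (auto simp: H HM M.M.a_ac)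
  then show ?thesis
    by (intro left_module.intro left_module_axioms.intro M.R.ring_axioms)
      (auto simp: H HM M.smult_l_distr M.smult_r_distr M.smult_assoc)
qed

abbreviation kernel_module :: "('a, 'm) module \<Rightarrow> ('a, 'n) module \<Rightarrow> ('m \<Rightarrow> 'n) \<Rightarrow> ('a, 'm) module"
  where "kernel_module M N h \<equiv> M\<lparr>carrier := {x \<in> carrier M. h x = \<zero>\<^bsub>N\<^esub>}\<rparr>"

lemma left_module_kernel:
  assumes "left_module R M" "left_module R N" "h \<in> mod_hom R M N"
  shows "left_module R (kernel_module M N h)"
proof -
  interpret M: left_module R M by fact
  interpret N: left_module R N by fact
  show ?thesis
    using mod_homD[OF assms(3)] mod_hom_zero[OF assms] N.smult_r_null
    by (intro left_module_submodule assms(1)) auto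
qed

lemma (in abelian_group) minus_eq_zero_iff:
  "x \<in> carrier G \<Longrightarrow> y \<in> carrier G \<Longrightarrow> x \<ominus> y = \<zero> \<longleftrightarrow> x = y"
  by (metis a_minus_def add.inv_closed add.inv_comm l_zero minus_equality r_neg)

lemma (in abelian_group) add_minus_cancel:
  "x \<in> carrier G \<Longrightarrow> y \<in> carrier G \<Longrightarrow> y \<oplus> (x \<ominus> y) = x"
  by (simp add: a_minus_def add.m_lcomm r_neg)

lemma mod_hom_minus:
  assumes "left_module R M" "left_module R N" "h \<in> mod_hom R M N" "x \<in> carrier M" "y \<in> carrier M"
  shows "h (x \<ominus>\<^bsub>M\<^esub> y) = h x \<ominus>\<^bsub>N\<^esub> h y"
proof -
  interpret M: left_module R M by fact
  interpret N: left_module R N by fact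
  have c: "h x \<in> carrier N" "h y \<in> carrier N" "h (x \<ominus>\<^bsub>M\<^esub> y) \<in> carrier N"
    using assms mod_homD(1)[OF assms(3)] by auto
  have "h y \<oplus>\<^bsub>N\<^esub> h (x \<ominus>\<^bsub>M\<^esub> y) = h x"
    using assms mod_homD(2)[OF assms(3), of y "x \<ominus>\<^bsub>M\<^esub> y"] by (simp add: M.M.add_minus_cancel)
  also have "\<dots> = h y \<oplus>\<^bsub>N\<^esub> (h x \<ominus>\<^bsub>N\<^esub> h y)"
    using c by (simp add: N.M.add_minus_cancel)
  finally show ?thesis using c by simp
qed

text \<open>A split epimorphism splits off its kernel: \<open>x\<close> is \<open>t (h x)\<close>
  plus a remainder, and \<open>h\<close> kills the remainder because \<open>t\<close> is a
  section.\<close>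

lemma retract_direct_sum:
  assumes "left_module R M" "left_module R N" "h \<in> mod_hom R M N" "t \<in> mod_hom R N M"
    "\<And>y. y \<in> carrier N \<Longrightarrow> h (t y) = y"
  shows "isomorphic_modules R (direct_sum N (kernel_module M N h)) M"
proof -
  interpret M: left_module R M by fact
  interpret N: left_module R N by fact
  note h = mod_homD[OF assms(3)] and t = mod_homD[OF assms(4)]
  show ?thesis
  proof (rule isomorphic_modulesI[of "\<lambda>(y, k). t y \<oplus>\<^bsub>M\<^esub> k" _ _ _ "\<lambda>x. (h x, x \<ominus>\<^bsub>M\<^esub> t (h x))"])
    show "(\<lambda>(y, k). t y \<oplus>\<^bsub>M\<^esub> k) \<in> mod_hom R (direct_sum N (kernel_module M N h)) M"
      using t by (auto simp: mod_hom_def M.M.a_ac M.smult_r_distr)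
    fix x assume x: "x \<in> carrier M"
    have "h (x \<ominus>\<^bsub>M\<^esub> t (h x)) = \<zero>\<^bsub>N\<^esub>"
      using x h(1) t(1) assms(5)
      by (simp add: mod_hom_minus[OF assms(1-3)] N.M.minus_eq_zero_iff)
    then show "(h x, x \<ominus>\<^bsub>M\<^esub> t (h x)) \<in> carrier (direct_sum N (kernel_module M N h))"
      using x h(1) t(1) by simp
    show "(case (h x, x \<ominus>\<^bsub>M\<^esub> t (h x)) of (y, k) \<Rightarrow> t y \<oplus>\<^bsub>M\<^esub> k) = x"
      using x h(1) t(1) by (simp add: M.M.add_minus_cancel)
  next
    fix z assume "z \<in> carrier (direct_sum N (kernel_module M N h))"
    then obtain y k where z: "z = (y, k)" "y \<in> carrier N" "k \<in> carrier M" "h k = \<zero>\<^bsub>N\<^esub>" by auto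
    then have "h (t y \<oplus>\<^bsub>M\<^esub> k) = y" using h(2) t(1) assms(5) by simp
    then show "(h (case z of (y, k) \<Rightarrow> t y \<oplus>\<^bsub>M\<^esub> k),
        (case z of (y, k) \<Rightarrow> t y \<oplus>\<^bsub>M\<^esub> k) \<ominus>\<^bsub>M\<^esub> t (h (case z of (y, k) \<Rightarrow> t y \<oplus>\<^bsub>M\<^esub> k))) = z"
      using z t(1) by (simp add: M.M.add.m_comm[of "t y"] a_minus_def M.M.a_assoc M.M.r_neg)
  qed
qed

section \<open>Powers of a module and homomorphisms out of R^n\<close>

definition regular_module :: "('a, 'c) ring_scheme \<Rightarrow> ('a, 'a) module"
  where "regular_module R = \<lparr>carrier = carrier R, monoid.mult = undefined, one = undefined,
    ring.zero = \<zero>\<^bsub>R\<^esub>, add = add R, smult = monoid.mult R\<rparr>"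

lemma regular_module_simps [simp]:
  "carrier (regular_module R) = carrier R" "\<zero>\<^bsub>regular_module R\<^esub> = \<zero>\<^bsub>R\<^esub>"
  "x \<oplus>\<^bsub>regular_module R\<^esub> y = x \<oplus>\<^bsub>R\<^esub> y" "a \<odot>\<^bsub>regular_module R\<^esub> x = a \<otimes>\<^bsub>R\<^esub> x"
  by (simp_all add: regular_module_def)

lemma left_module_regular:
  assumes "ring R" shows "left_module R (regular_module R)"
proof -
  interpret R: ring R by fact
  have "abelian_group (regular_module R)"
    by (rule abelian_groupI) (auto simp: R.a_ac intro: R.l_neg bexI[of _ "\<ominus>\<^bsub>R\<^esub> _"])
  then show ?thesis
    by (intro left_module.intro left_module_axioms.intro assms)
      (auto simp: R.l_distr R.r_distr R.m_assoc)
qed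

text \<open>Sequences vanishing from \<open>n\<close> on, so that the element type does not depend
  on \<open>n\<close>; for the regular module it is the type \<open>nat \<Rightarrow> 'a\<close> in
  which \<open>fgp_classes\<close> collects its representatives. The argument is a
  \<open>module_scheme\<close>, so a bimodule can be inserted directly.\<close>

definition power_module :: "('s, 'b, 'd) module_scheme \<Rightarrow> nat \<Rightarrow> ('s, nat \<Rightarrow> 'b) module"
  where "power_module B n =
    \<lparr>carrier = {u. \<forall>i. u i \<in> carrier B \<and> (n \<le> i \<longrightarrow> u i = \<zero>\<^bsub>B\<^esub>)},
     monoid.mult = undefined, one = undefined, ring.zero = (\<lambda>i. \<zero>\<^bsub>B\<^esub>),
     add = (\<lambda>u v i. u i \<oplus>\<^bsub>B\<^esub> v i), smult = (\<lambda>a u i. a \<odot>\<^bsub>B\<^esub> u i)\<rparr>"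

lemma power_module_iff:
  "u \<in> carrier (power_module B n) \<longleftrightarrow> (\<forall>i. u i \<in> carrier B) \<and> (\<forall>i\<ge>n. u i = \<zero>\<^bsub>B\<^esub>)"
  by (auto simp: power_module_def)

lemma power_module_simps [simp]:
  "\<zero>\<^bsub>power_module B n\<^esub> = (\<lambda>i. \<zero>\<^bsub>B\<^esub>)"
  "u \<oplus>\<^bsub>power_module B n\<^esub> v = (\<lambda>i. u i \<oplus>\<^bsub>B\<^esub> v i)"
  "a \<odot>\<^bsub>power_module B n\<^esub> u = (\<lambda>i. a \<odot>\<^bsub>B\<^esub> u i)"
  by (simp_all add: power_module_def)

lemma left_module_power:
  assumes "left_module R B" shows "left_module R (power_module B n)"
proof -
  interpret B: left_module R B by fact
  have "abelian_group (power_module B n)"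
  proof (rule abelian_groupI)
    fix u assume "u \<in> carrier (power_module B n)"
    then show "\<exists>v\<in>carrier (power_module B n). v \<oplus>\<^bsub>power_module B n\<^esub> u = \<zero>\<^bsub>power_module B n\<^esub>"
      by (intro bexI[of _ "\<lambda>i. \<ominus>\<^bsub>B\<^esub> u i"]) (auto simp: power_module_iff B.M.l_neg)
  qed (auto simp: power_module_iff B.M.a_ac)
  then show ?thesis
    by (intro left_module.intro left_module_axioms.intro B.R.ring_axioms)
      (auto simp: power_module_iff B.smult_l_distr B.smult_r_distr B.smult_assoc B.smult_r_null)
qed

abbreviation row_module :: "('a, 'c) ring_scheme \<Rightarrow> nat \<Rightarrow> ('a, nat \<Rightarrow> 'a) module"
  where "row_module R n \<equiv> power_module (regular_module R) n"

lemma row_module_eq: "row_module R n = free_module R {..<n}"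
proof -
  have "u \<in> carrier (row_module R n) \<longleftrightarrow> u \<in> carrier (free_module R {..<n})" for u
    unfolding power_module_iff free_module_iff
    using finite_subset[of "{i. u i \<noteq> \<zero>\<^bsub>R\<^esub>}" "{..<n}"]
    by (auto simp: subset_iff not_less[symmetric])
  then have "carrier (row_module R n) = carrier (free_module R {..<n})" by blast
  then show ?thesis
    by (simp add: power_module_def free_module_def regular_module_def)
qed

lemma row_module_iff:
  "u \<in> carrier (row_module R n) \<longleftrightarrow> (\<forall>i. u i \<in> carrier R) \<and> (\<forall>i\<ge>n. u i = \<zero>\<^bsub>R\<^esub>)"
  by (simp add: power_module_iff)

lemma left_module_row: "ring R \<Longrightarrow> left_module R (row_module R n)"
  by (simp add: left_module_power left_module_regular)

abbreviation unit_row :: "('a, 'c) ring_scheme \<Rightarrow> nat \<Rightarrow> nat \<Rightarrow> 'a"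
  where "unit_row R i \<equiv> (\<lambda>j. if j = i then \<one>\<^bsub>R\<^esub> else \<zero>\<^bsub>R\<^esub>)"

lemma unit_row_closed: "ring R \<Longrightarrow> i < n \<Longrightarrow> unit_row R i \<in> carrier (row_module R n)"
  by (auto simp: row_module_iff ring.ring_simprules)

text \<open>The index set is \<open>{..<n}\<close> and not the support of \<open>u\<close> as in
  \<open>lincomb\<close>: a ring homomorphism applied to the coefficients may shrink the support,
  but this sum keeps its shape.\<close>

definition row_comb ::
    "('a, 'm, 'd) module_scheme \<Rightarrow> nat \<Rightarrow> (nat \<Rightarrow> 'm) \<Rightarrow> (nat \<Rightarrow> 'a) \<Rightarrow> 'm"
  where "row_comb M n m u = finsum M (\<lambda>i. u i \<odot>\<^bsub>M\<^esub> m i) {..<n}"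

context
  fixes R :: "('a, 'c) ring_scheme" and M :: "('a, 'm) module" and m :: "nat \<Rightarrow> 'm" and n :: nat
  assumes M: "left_module R M" and m: "\<And>i. i < n \<Longrightarrow> m i \<in> carrier M"
begin

interpretation left_module R M by (fact M)

lemma row_comb_eq_lincomb:
  assumes "u \<in> carrier (row_module R n)"
  shows "row_comb M n m u = lincomb R M m u"
  unfolding row_comb_def
  using m assms by (intro lincomb_superset[symmetric, where I = "{..<n}"] M)
    (auto simp: row_module_eq free_module_iff)

lemma row_comb_hom: "row_comb M n m \<in> mod_hom R (row_module R n) M"
proof -
  interpret F: left_module R "row_module R n" by (rule left_module_row) unfold_locales
  have "lincomb R M m \<in> mod_hom R (row_module R n) M"
    unfolding row_module_eq using m by (intro lincomb_hom M) auto
  then show ?thesis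
    using row_comb_eq_lincomb F.M.a_closed F.smult_closed
    by (auto simp: mod_hom_def simp del: power_module_simps)
qed

lemma row_comb_unit [simp]:
  assumes "i < n"
  shows "row_comb M n m (unit_row R i) = m i"
proof -
  have "row_comb M n m (unit_row R i) = lincomb R M m (unit_row R i)"
    using assms by (intro row_comb_eq_lincomb unit_row_closed R.ring_axioms)
  also have "\<dots> = m i"
    using assms m by (intro lincomb_single(2)[OF M, where I = "{..<n}"]) auto
  finally show ?thesis .
qed

end

lemma row_comb_cong:
  assumes "left_module R M" "\<And>i. i < n \<Longrightarrow> m i \<in> carrier M" "\<And>i. i < n \<Longrightarrow> m i = m' i"
    "\<And>i. i < n \<Longrightarrow> u i \<in> carrier R"
  shows "row_comb M n m u = row_comb M n m' u"
proof -
  interpret left_module R M by fact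
  show ?thesis unfolding row_comb_def using assms by (intro M.finsum_cong') auto
qed

lemma mod_hom_row_comb:
  assumes "left_module R M" "left_module R N" "h \<in> mod_hom R M N" "\<And>i. i < n \<Longrightarrow> m i \<in> carrier M"
    "\<And>i. i < n \<Longrightarrow> u i \<in> carrier R"
  shows "h (row_comb M n m u) = row_comb N n (\<lambda>i. h (m i)) u"
proof -
  interpret M: left_module R M by fact
  interpret N: left_module R N by fact
  have "h (row_comb M n m u) = finsum N (\<lambda>i. h (u i \<odot>\<^bsub>M\<^esub> m i)) {..<n}"
    unfolding row_comb_def using assms(4,5) by (intro mod_hom_finsum[OF assms(1-3)]) auto
  also have "\<dots> = row_comb N n (\<lambda>i. h (m i)) u"
    unfolding row_comb_def using assms(4,5) mod_homD[OF assms(3)]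
    by (intro N.M.finsum_cong') auto
  finally show ?thesis .
qed

lemma row_coordinate_hom:
  assumes "ring R" shows "(\<lambda>u. u i) \<in> mod_hom R (row_module R n) (regular_module R)"
  by (auto simp: mod_hom_def row_module_iff)

lemma row_module_expand:
  assumes "ring R" "u \<in> carrier (row_module R n)"
  shows "row_comb (row_module R n) n (unit_row R) u = u"
proof
  fix j
  interpret R: ring R by fact
  note F = left_module_row[OF assms(1)] left_module_regular[OF assms(1)]
  have "row_comb (row_module R n) n (unit_row R) u j
      = row_comb (regular_module R) n (\<lambda>i. unit_row R i j) u"
    using assms by (intro mod_hom_row_comb[OF F row_coordinate_hom] unit_row_closed)
      (auto simp: row_module_iff)
  also have "\<dots> = finsum (regular_module R) (\<lambda>i. if j = i then u i else \<zero>\<^bsub>R\<^esub>) {..<n}"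
  proof -
    interpret F: left_module R "regular_module R" by (fact F)
    show ?thesis
      unfolding row_comb_def using assms(2)
      by (intro F.M.finsum_cong') (auto simp: row_module_iff)
  qed
  also have "\<dots> = u j"
  proof -
    interpret F: left_module R "regular_module R" by (fact F)
    show ?thesis
    proof (cases "j < n")
      case True
      then have "finsum (regular_module R) (\<lambda>i. if j = i then u i else \<zero>\<^bsub>regular_module R\<^esub>) {..<n} = u j"
        using assms(2) by (intro F.M.finsum_singleton) (auto simp: row_module_iff)
      then show ?thesis by (simp only: regular_module_simps)
    next
      case False
      then have "finsum (regular_module R) (\<lambda>i. if j = i then u i else \<zero>\<^bsub>R\<^esub>) {..<n}
        = finsum (regular_module R) (\<lambda>i. \<zero>\<^bsub>regular_module R\<^esub>) {..<n}"
        by (intro F.M.finsum_cong') auto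
      then show ?thesis using False assms(2) F.M.finsum_zero by (simp add: row_module_iff)
    qed
  qed
  finally show "row_comb (row_module R n) n (unit_row R) u j = u j" .
qed

lemma mod_hom_row_module:
  assumes "left_module R N" "h \<in> mod_hom R (row_module R n) N" "u \<in> carrier (row_module R n)"
  shows "h u = row_comb N n (\<lambda>i. h (unit_row R i)) u"
proof -
  interpret N: left_module R N by fact
  note R = N.R.ring_axioms
  have "h u = h (row_comb (row_module R n) n (unit_row R) u)"
    using row_module_expand[OF R assms(3)] by simp
  also have "\<dots> = row_comb N n (\<lambda>i. h (unit_row R i)) u"
    using assms(3) by (intro mod_hom_row_comb[OF left_module_row[OF R] assms(1,2)] unit_row_closed R)
      (auto simp: row_module_iff)
  finally show ?thesis .
qed

lemma mod_hom_row_module_eqI: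
  assumes "left_module R N" "h \<in> mod_hom R (row_module R n) N" "h' \<in> mod_hom R (row_module R n) N"
    "\<And>i. i < n \<Longrightarrow> h (unit_row R i) = h' (unit_row R i)" "u \<in> carrier (row_module R n)"
  shows "h u = h' u"
proof -
  interpret N: left_module R N by fact
  have "row_comb N n (\<lambda>i. h (unit_row R i)) u = row_comb N n (\<lambda>i. h' (unit_row R i)) u"
    using assms(4,5) mod_homD(1)[OF assms(2) unit_row_closed[OF N.R.ring_axioms]]
    by (intro row_comb_cong[OF assms(1)]) (simp_all add: row_module_iff)
  then show ?thesis using mod_hom_row_module assms by metis
qed

text \<open>Being a summand is expressed by a section and a retraction, without naming a complement.
  Such pairs compose, pass through direct sums and cutting, and may relate modules with different
  element types.\<close>

definition retract :: "('a, 'c) ring_scheme \<Rightarrow> ('a, 'm) module \<Rightarrow> ('a, 'n) module \<Rightarrow> bool"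
  where "retract R M N \<longleftrightarrow> (\<exists>s\<in>mod_hom R M N. \<exists>q\<in>mod_hom R N M. \<forall>x\<in>carrier M. q (s x) = x)"

lemma retractI:
  "s \<in> mod_hom R M N \<Longrightarrow> q \<in> mod_hom R N M \<Longrightarrow> (\<And>x. x \<in> carrier M \<Longrightarrow> q (s x) = x) \<Longrightarrow> retract R M N"
  by (auto simp: retract_def)

lemma retractE:
  assumes "retract R M N"
  obtains s q where "s \<in> mod_hom R M N" "q \<in> mod_hom R N M" "\<forall>x\<in>carrier M. q (s x) = x"
  using assms by (auto simp: retract_def)

lemma retract_trans:
  assumes "retract R L M" "retract R M N"
  shows "retract R L N"
proof -
  obtain s q s' q' where s: "s \<in> mod_hom R L M" "q \<in> mod_hom R M L" "\<And>x. x \<in> carrier L \<Longrightarrow> q (s x) = x"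
    "s' \<in> mod_hom R M N" "q' \<in> mod_hom R N M" "\<And>x. x \<in> carrier M \<Longrightarrow> q' (s' x) = x"
    using assms by (elim retractE) metis
  then show ?thesis
    using mod_homD(1)[OF s(1)]
    by (intro retractI[OF mod_hom_comp[OF s(1) s(4)] mod_hom_comp[OF s(5) s(2)]]) auto
qed

lemma isomorphic_imp_retract:
  assumes "isomorphic_modules R M N" "left_module R M" "left_module R N"
  shows "retract R M N"
  by (rule isomorphic_modulesE[OF assms]) (blast intro: retractI)

lemma retract_direct_sum_cong:
  assumes "retract R M M'" "retract R N N'"
  shows "retract R (direct_sum M N) (direct_sum M' N')"
proof -
  obtain s q s' q' where s: "s \<in> mod_hom R M M'" "q \<in> mod_hom R M' M" "\<And>x. x \<in> carrier M \<Longrightarrow> q (s x) = x"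
    "s' \<in> mod_hom R N N'" "q' \<in> mod_hom R N' N" "\<And>x. x \<in> carrier N \<Longrightarrow> q' (s' x) = x"
    using assms by (elim retractE) metis
  then show ?thesis
    by (intro retractI[of "map_prod s s'" _ _ _ "map_prod q q'"]) (auto simp: mod_hom_def)
qed

lemma isomorphic_row_module_add:
  assumes "ring R"
  shows "isomorphic_modules R (direct_sum (row_module R m) (row_module R n)) (row_module R (m + n))"
proof -
  interpret R: ring R by fact
  show ?thesis
    by (rule isomorphic_modulesI[of "\<lambda>(u, v) i. if i < m then u i else v (i - m)" _ _ _
          "\<lambda>u. (\<lambda>i. if i < m then u i else \<zero>\<^bsub>R\<^esub>, \<lambda>i. u (i + m))"])
      (auto simp: mod_hom_def row_module_iff fun_eq_iff)
qed

section \<open>Finitely generated projective modules as retracts of R^n\<close>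

lemma finsum_mem_subset:
  assumes "abelian_group M" "H \<subseteq> carrier M" "\<zero>\<^bsub>M\<^esub> \<in> H" "\<And>x y. x \<in> H \<Longrightarrow> y \<in> H \<Longrightarrow> x \<oplus>\<^bsub>M\<^esub> y \<in> H"
    "finite A" "\<And>i. i \<in> A \<Longrightarrow> f i \<in> H"
  shows "finsum M f A \<in> H"
  using assms(5,6)
proof (induction A rule: finite_induct)
  case empty
  interpret abelian_group M by fact
  show ?case using assms(3) by simp
next
  case (insert a A)
  interpret abelian_group M by fact
  have "f \<in> A \<rightarrow> carrier M" "f a \<in> carrier M" using insert assms(2) by auto
  then show ?case using insert assms(4) by simp
qed

text \<open>The images of the unit rows under the retraction generate \<open>P\<close>, and a lift
  is prescribed on these images and precomposed with the section. Together with
  \<open>fgp_moduleE\<close> this makes retracts of R^n the working form of the notion.\<close>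

lemma fgp_moduleI:
  fixes P :: "('a, 'm) module"
  assumes P: "left_module R P" and "retract R P (row_module R n)"
  shows "fgp_module R P"
proof -
  interpret P: left_module R P by fact
  note R = P.R.ring_axioms
  obtain s q where s: "s \<in> mod_hom R P (row_module R n)" and q: "q \<in> mod_hom R (row_module R n) P"
    and qs: "\<And>x. x \<in> carrier P \<Longrightarrow> q (s x) = x"
    using assms by (elim retractE) metis
  define m where "m i = q (unit_row R i)" for i
  have m: "m i \<in> carrier P" if "i < n" for i
    unfolding m_def by (rule mod_homD(1)[OF q unit_row_closed[OF R that]])
  have x: "x = row_comb P n m (s x)" if "x \<in> carrier P" for x
    unfolding m_def[abs_def] mod_hom_row_module[OF P q mod_homD(1)[OF s that], symmetric]
    by (simp add: qs[OF that])
  have sR: "s x i \<in> carrier R" if "x \<in> carrier P" for x i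
    using mod_homD(1)[OF s that] by (simp add: row_module_iff)
  have "fin_gen R P"
    unfolding fin_gen_def
  proof (intro exI[of _ "m ` {..<n}"] conjI equalityI subsetI)
    let ?A = "m ` {..<n}"
    let ?L = "{finsum P (\<lambda>x. c x \<odot>\<^bsub>P\<^esub> x) ?A |c. c \<in> ?A \<rightarrow> carrier R}"
    have AP: "?A \<subseteq> carrier P" using m by auto
    show "x \<in> carrier P" if "x \<in> ?A" for x using that m by auto
    show LP: "x \<in> carrier P" if "x \<in> ?L" for x
      using that AP by (auto intro!: P.M.finsum_closed P.smult_closed)
    \<comment> \<open>The family \<open>m\<close> may repeat elements, so the coefficients of a row
      do not directly define a function on the generating set. Instead the span of the set is shown
      to be closed under addition and to contain each single multiple.\<close>
    have span: "finsum P (\<lambda>i. s x i \<odot>\<^bsub>P\<^esub> m i) {..<n} \<in> ?L" if "x \<in> carrier P" for x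
    proof (rule finsum_mem_subset[OF P.M.abelian_group_axioms])
      show "?L \<subseteq> carrier P" using LP by blast
      show "\<zero>\<^bsub>P\<^esub> \<in> ?L"
      proof -
        have "finsum P (\<lambda>x. \<zero>\<^bsub>R\<^esub> \<odot>\<^bsub>P\<^esub> x) ?A = finsum P (\<lambda>x. \<zero>\<^bsub>P\<^esub>) ?A"
          using AP by (intro P.M.finsum_cong') (auto simp: P.smult_l_null)
        then show ?thesis by (auto intro!: exI[of _ "\<lambda>_. \<zero>\<^bsub>R\<^esub>"])
      qed
      show "x \<oplus>\<^bsub>P\<^esub> y \<in> ?L" if xy: "x \<in> ?L" "y \<in> ?L" for x y
      proof -
        obtain c d where cd: "x = finsum P (\<lambda>x. c x \<odot>\<^bsub>P\<^esub> x) ?A" "y = finsum P (\<lambda>x. d x \<odot>\<^bsub>P\<^esub> x) ?A"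
          "c \<in> ?A \<rightarrow> carrier R" "d \<in> ?A \<rightarrow> carrier R" using xy by blast
        have "x \<oplus>\<^bsub>P\<^esub> y = finsum P (\<lambda>x. c x \<odot>\<^bsub>P\<^esub> x \<oplus>\<^bsub>P\<^esub> d x \<odot>\<^bsub>P\<^esub> x) ?A"
          unfolding cd(1,2) using cd(3,4) AP by (intro P.M.finsum_addf[symmetric]) (auto simp: Pi_iff)
        also have "\<dots> = finsum P (\<lambda>x. (c x \<oplus>\<^bsub>R\<^esub> d x) \<odot>\<^bsub>P\<^esub> x) ?A"
          using cd(3,4) AP m by (intro P.M.finsum_cong') (auto simp: P.smult_l_distr Pi_iff)
        finally show ?thesis using cd(3,4) by (auto intro!: exI[of _ "\<lambda>x. c x \<oplus>\<^bsub>R\<^esub> d x"])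
      qed
      show "s x i \<odot>\<^bsub>P\<^esub> m i \<in> ?L" if i: "i \<in> {..<n}" for i
      proof -
        let ?a = "s x i"
        have a: "?a \<in> carrier R" using sR[OF \<open>x \<in> carrier P\<close>] .
        have "?a \<odot>\<^bsub>P\<^esub> m i = finsum P (\<lambda>z. if m i = z then ?a \<odot>\<^bsub>P\<^esub> z else \<zero>\<^bsub>P\<^esub>) ?A"
          using i AP a by (intro P.M.finsum_singleton[symmetric]) auto
        also have "\<dots> = finsum P (\<lambda>z. (if m i = z then ?a else \<zero>\<^bsub>R\<^esub>) \<odot>\<^bsub>P\<^esub> z) ?A"
          using AP a by (intro P.M.finsum_cong') (auto simp: P.smult_l_null)
        finally have "?a \<odot>\<^bsub>P\<^esub> m i = finsum P (\<lambda>z. (if m i = z then ?a else \<zero>\<^bsub>R\<^esub>) \<odot>\<^bsub>P\<^esub> z) ?A" .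
        moreover have "(\<lambda>z. if m i = z then ?a else \<zero>\<^bsub>R\<^esub>) \<in> ?A \<rightarrow> carrier R" using a by simp
        ultimately show ?thesis
          by (intro CollectI exI[of _ "\<lambda>z. if m i = z then ?a else \<zero>\<^bsub>R\<^esub>"] conjI)
      qed
    qed simp
    show "x \<in> ?L" if "x \<in> carrier P" for x
      using span[OF that] by (rule ssubst[OF x[OF that, unfolded row_comb_def], where P = "\<lambda>x. x \<in> ?L"])
  qed simp
  moreover have "projective_module R P"
    unfolding projective_module_def
  proof (intro allI impI ballI)
    fix N :: "('a, 'm \<Rightarrow> 'a) module" and N' :: "('a, 'm) module" and g f
    assume N: "left_module R N" "left_module R N'" and g: "g \<in> mod_hom R N N'"
      "g ` carrier N = carrier N'" and f: "f \<in> mod_hom R P N'"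
    have "\<forall>i<n. \<exists>y\<in>carrier N. g y = f (m i)"
      using g(2) mod_homD(1)[OF f] m by (metis (no_types, lifting) image_iff)
    then obtain k where k: "\<And>i. i < n \<Longrightarrow> k i \<in> carrier N" "\<And>i. i < n \<Longrightarrow> g (k i) = f (m i)" by metis
    have "(\<lambda>x. row_comb N n k (s x)) \<in> mod_hom R P N"
      by (rule mod_hom_comp[OF s row_comb_hom[OF N(1)]]) (use k in auto)
    moreover have "g (row_comb N n k (s x)) = f x" if xP: "x \<in> carrier P" for x
    proof -
      have "g (row_comb N n k (s x)) = row_comb N' n (\<lambda>i. g (k i)) (s x)"
        using k sR[OF xP] by (intro mod_hom_row_comb[OF N g(1)]) auto
      also have "\<dots> = row_comb N' n (\<lambda>i. f (m i)) (s x)"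
        using k sR[OF xP] m mod_homD(1)[OF f] by (intro row_comb_cong[OF N(2)]) auto
      also have "\<dots> = f (row_comb P n m (s x))"
        using m sR[OF xP] by (intro mod_hom_row_comb[OF P N(2) f, symmetric]) auto
      finally show ?thesis using x[OF xP] by simp
    qed
    ultimately show "\<exists>h\<in>mod_hom R P N. \<forall>x\<in>carrier P. g (h x) = f x"
      by (intro bexI[of _ "\<lambda>x. row_comb N n k (s x)"]) auto
  qed
  ultimately show ?thesis using P by (simp add: fgp_module_def)
qed

text \<open>A surjection from R^n onto \<open>P\<close> splits by projectivity. The rows have
  another element type than the test modules in \<open>projective_module\<close>, hence the detour
  through \<open>projective_module_lift\<close>.\<close>

lemma fgp_moduleE:
  fixes P :: "('a, 'm) module"
  assumes "fgp_module R P"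
  obtains n where "retract R P (row_module R n)"
proof -
  have P: "left_module R P" "projective_module R P" using assms by (auto simp: fgp_module_def)
  interpret P: left_module R P by (fact P)
  note R = P.R.ring_axioms
  obtain A where A: "finite A" "A \<subseteq> carrier P"
    "carrier P = {finsum P (\<lambda>x. c x \<odot>\<^bsub>P\<^esub> x) A |c. c \<in> A \<rightarrow> carrier R}"
    using assms by (auto simp: fgp_module_def fin_gen_def)
  define n where "n = card A"
  obtain m where m: "bij_betw m {..<n} A"
    using A(1) unfolding n_def by (metis atLeast0LessThan ex_bij_betw_nat_finite)
  have mP: "m i \<in> carrier P" if "i < n" for i using m A(2) that by (auto simp: bij_betw_def)
  have q: "row_comb P n m \<in> mod_hom R (row_module R n) P" by (rule row_comb_hom[OF P(1) mP])
  have "x \<in> row_comb P n m ` carrier (row_module R n)" if "x \<in> carrier P" for x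
  proof -
    obtain c where c: "c \<in> A \<rightarrow> carrier R" "x = finsum P (\<lambda>x. c x \<odot>\<^bsub>P\<^esub> x) A"
      using equalityD1[OF A(3), THEN subsetD, OF \<open>x \<in> carrier P\<close>] by blast
    define u where "u i = (if i < n then c (m i) else \<zero>\<^bsub>R\<^esub>)" for i
    have mA: "m ` {..<n} = A" "inj_on m {..<n}" using m by (simp_all add: bij_betw_def)
    have cm: "c (m i) \<in> carrier R" if "i < n" for i
      using funcset_mem[OF c(1)] m that by (simp add: bij_betw_apply)
    then have "u \<in> carrier (row_module R n)" by (simp add: row_module_iff u_def)
    moreover have "row_comb P n m u = x"
    proof -
      have "(\<lambda>x. c x \<odot>\<^bsub>P\<^esub> x) \<in> m ` {..<n} \<rightarrow> carrier P"
        unfolding image_subset_iff_funcset[symmetric] using cm mP by (simp add: image_subset_iff)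
      from P.M.finsum_reindex[OF this mA(2)]
      have "x = finsum P (\<lambda>i. c (m i) \<odot>\<^bsub>P\<^esub> m i) {..<n}" unfolding mA(1) c(2) .
      also have "\<dots> = row_comb P n m u"
        unfolding row_comb_def
      proof (rule P.M.finsum_cong')
        show "(\<lambda>i. u i \<odot>\<^bsub>P\<^esub> m i) \<in> {..<n} \<rightarrow> carrier P" using mP cm by (simp add: u_def)
      qed (simp_all add: u_def)
      finally show ?thesis by simp
    qed
    ultimately show ?thesis by (metis imageI)
  qed
  then have surj: "row_comb P n m ` carrier (row_module R n) = carrier P"
    using mod_homD(1)[OF q] by (intro equalityI image_subsetI subsetI)
  have "\<exists>s\<in>mod_hom R P (row_module R n). \<forall>x\<in>carrier P. row_comb P n m (s x) = x"
    by (rule projective_module_lift[where f = "\<lambda>x. x", OF P left_module_row[OF R] P(1)])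
      (rule q, rule surj, rule mod_hom_id)
  then obtain s where s: "s \<in> mod_hom R P (row_module R n)"
    "\<forall>x\<in>carrier P. row_comb P n m (s x) = x" by (rule bexE)
  have "retract R P (row_module R n)"
    by (rule retractI[OF s(1) q]) (rule bspec[OF s(2)])
  then show ?thesis by (rule that)
qed

lemma fgp_left_module: "fgp_module R P \<Longrightarrow> left_module R P"
  by (simp add: fgp_module_def)

lemma retract_fgp_module:
  assumes "left_module R M" "retract R M N" "fgp_module R N"
  shows "fgp_module R M"
  by (rule fgp_moduleE[OF assms(3)]) (rule fgp_moduleI[OF assms(1) retract_trans[OF assms(2)]])

lemma fgp_row_module: "ring R \<Longrightarrow> fgp_module R (row_module R n)"
  by (rule fgp_moduleI[of _ _ n]) (simp_all add: left_module_row isomorphic_imp_retract)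

lemma fgp_direct_sum:
  assumes "fgp_module R M" "fgp_module R N"
  shows "fgp_module R (direct_sum M N)"
proof -
  obtain m n where "retract R M (row_module R m)" "retract R N (row_module R n)"
    using assms by (elim fgp_moduleE) metis
  then have 1: "retract R (direct_sum M N) (direct_sum (row_module R m) (row_module R n))"
    by (rule retract_direct_sum_cong)
  have L: "left_module R M" "left_module R N" using assms by (auto intro: fgp_left_module)
  interpret M: left_module R M by (fact L)
  have R: "ring R" by unfold_locales
  show ?thesis
    by (rule fgp_moduleI[OF left_module_direct_sum[OF L], of "m + n"], rule retract_trans[OF 1])
      (intro isomorphic_imp_retract isomorphic_row_module_add left_module_direct_sum left_module_row R)
qed

text \<open>The splitting of \<open>h\<close> makes the kernel a summand of \<open>M\<close>, and
  summands inherit the property.\<close>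

lemma fgp_kernel_module:
  assumes "fgp_module R M" "left_module R N" "h \<in> mod_hom R M N" "t \<in> mod_hom R N M"
    "\<And>y. y \<in> carrier N \<Longrightarrow> h (t y) = y"
  shows "fgp_module R (kernel_module M N h)"
proof -
  let ?K = "kernel_module M N h"
  have M: "left_module R M" using assms(1) by (rule fgp_left_module)
  interpret N: left_module R N by fact
  have K: "left_module R ?K" by (rule left_module_kernel[OF M assms(2,3)])
  interpret K: left_module R ?K by (fact K)
  have "retract R ?K (direct_sum N ?K)"
    by (rule retractI[of "\<lambda>k. (\<zero>\<^bsub>N\<^esub>, k)" _ _ _ snd])
      (auto simp: mod_hom_def N.smult_r_null)
  moreover have "retract R (direct_sum N ?K) M"
    by (intro isomorphic_imp_retract[OF retract_direct_sum[OF M assms(2-5)]]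
        left_module_direct_sum assms(2) M K)
  ultimately show ?thesis by (rule retract_fgp_module[OF K retract_trans assms(1)])
qed

section \<open>Tensor products\<close>

declare mult_FactGroup [simp del] one_FactGroup [simp del]

section \<open>Quotients of free abelian groups by generated subgroups\<close>

context
  fixes U :: "'x set" and L :: "('x \<Rightarrow>\<^sub>0 int) set"
  assumes L: "L \<subseteq> carrier (free_Abelian_group U)"
begin

abbreviation (input) free_group ("\<FF>") where "\<FF> \<equiv> free_Abelian_group U"
abbreviation (input) relation_group ("\<KK>") where "\<KK> \<equiv> generate \<FF> L"

lemma relation_subgroup: "subgroup \<KK> \<FF>"
  using group.generate_is_subgroup[OF group_free_Abelian_group L] .

lemma relation_normal: "\<KK> \<lhd> \<FF>"
  using comm_group.subgroup_imp_normal[OF abelian_free_Abelian_group relation_subgroup] .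

lemma free_quotient_comm_group: "comm_group (\<FF> Mod \<KK>)"
  using comm_group.abelian_FactGroup[OF abelian_free_Abelian_group relation_subgroup] .

lemma free_quotient_add:
  assumes "x \<in> carrier \<FF>" "y \<in> carrier \<FF>"
  shows "(\<KK> #>\<^bsub>\<FF>\<^esub> x) \<otimes>\<^bsub>\<FF> Mod \<KK>\<^esub> (\<KK> #>\<^bsub>\<FF>\<^esub> y) = \<KK> #>\<^bsub>\<FF>\<^esub> (x + y)"
  using normal.rcos_sum[OF relation_normal assms] by (simp add: mult_FactGroup)

lemma free_quotient_carrier:
  "C \<in> carrier (\<FF> Mod \<KK>) \<longleftrightarrow> (\<exists>x\<in>carrier \<FF>. C = \<KK> #>\<^bsub>\<FF>\<^esub> x)"
  by (auto simp: carrier_FactGroup)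

lemma free_quotient_eqI:
  assumes "x \<in> carrier \<FF>" "y \<in> carrier \<FF>" "x - y \<in> \<KK>"
  shows "\<KK> #>\<^bsub>\<FF>\<^esub> x = \<KK> #>\<^bsub>\<FF>\<^esub> y"
proof -
  have "x \<in> \<KK> #>\<^bsub>\<FF>\<^esub> y"
    unfolding r_coset_def using assms by (auto intro!: bexI[of _ "x - y"])
  then show ?thesis
    using group.repr_independence[OF group_free_Abelian_group _ assms(2) relation_subgroup] by simp
qed

lemma free_quotient_one: "\<KK> #>\<^bsub>\<FF>\<^esub> 0 = \<one>\<^bsub>\<FF> Mod \<KK>\<^esub>"
  using group.coset_mult_one[OF group_free_Abelian_group, of \<KK> U] subgroup.subset[OF relation_subgroup]
  by (simp add: one_FactGroup)

lemma free_quotient_inv: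
  assumes "x \<in> carrier \<FF>"
  shows "inv\<^bsub>\<FF> Mod \<KK>\<^esub> (\<KK> #>\<^bsub>\<FF>\<^esub> x) = \<KK> #>\<^bsub>\<FF>\<^esub> (- x)"
proof -
  interpret Q: comm_group "\<FF> Mod \<KK>" by (rule free_quotient_comm_group)
  show ?thesis
    using assms by (intro Q.inv_equality) (auto simp: free_quotient_add free_quotient_one free_quotient_carrier)
qed

text \<open>A single closure case for quotients of two elements covers both group operations,
  matching the induction over formal differences in the free group. Tensor products and
  \<open>K0\<close> both take their induction from here.\<close>

lemma free_quotient_induct:
  assumes "C \<in> carrier (\<FF> Mod \<KK>)" "P (\<KK> #>\<^bsub>\<FF>\<^esub> 0)" "\<And>a. a \<in> U \<Longrightarrow> P (\<KK> #>\<^bsub>\<FF>\<^esub> frag_of a)"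
    "\<And>C D. C \<in> carrier (\<FF> Mod \<KK>) \<Longrightarrow> D \<in> carrier (\<FF> Mod \<KK>) \<Longrightarrow> P C \<Longrightarrow> P D
      \<Longrightarrow> P (C \<otimes>\<^bsub>\<FF> Mod \<KK>\<^esub> inv\<^bsub>\<FF> Mod \<KK>\<^esub> D)"
  shows "P C"
proof -
  obtain x where x: "Poly_Mapping.keys x \<subseteq> U" "C = \<KK> #>\<^bsub>\<FF>\<^esub> x"
    using assms(1) by (auto simp: free_quotient_carrier)
  have "P (\<KK> #>\<^bsub>\<FF>\<^esub> x)"
  proof (rule free_Abelian_group_induct[OF x(1)])
    fix x y assume *: "Poly_Mapping.keys x \<subseteq> U" "Poly_Mapping.keys y \<subseteq> U"
      "P (\<KK> #>\<^bsub>\<FF>\<^esub> x)" "P (\<KK> #>\<^bsub>\<FF>\<^esub> y)"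
    then have "P ((\<KK> #>\<^bsub>\<FF>\<^esub> x) \<otimes>\<^bsub>\<FF> Mod \<KK>\<^esub> inv\<^bsub>\<FF> Mod \<KK>\<^esub> (\<KK> #>\<^bsub>\<FF>\<^esub> y))"
      by (intro assms(4)) (auto simp: free_quotient_carrier)
    then show "P (\<KK> #>\<^bsub>\<FF>\<^esub> (x - y))" using * by (simp add: free_quotient_inv free_quotient_add)
  qed (use assms in auto)
  then show ?thesis using x by simp
qed

text \<open>The extension of \<open>f\<close> to the free group is only obtained inside the proof,
  so the assumption that relators are sent to the identity is made for every homomorphism extending
  \<open>f\<close>.\<close>

lemma free_quotient_universal:
  assumes "comm_group H" "f \<in> U \<rightarrow> carrier H"
    "\<And>h g. h \<in> hom \<FF> H \<Longrightarrow> (\<And>x. x \<in> U \<Longrightarrow> h (frag_of x) = f x) \<Longrightarrow> g \<in> L \<Longrightarrow> h g = \<one>\<^bsub>H\<^esub>"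
  obtains h where "h \<in> hom (\<FF> Mod \<KK>) H" "\<And>x. x \<in> U \<Longrightarrow> h (\<KK> #>\<^bsub>\<FF>\<^esub> frag_of x) = f x"
proof -
  interpret H: comm_group H by fact
  obtain k where k: "k \<in> hom \<FF> H" "\<And>x. x \<in> U \<Longrightarrow> k (frag_of x) = f x"
    using H.free_Abelian_group_universal[of f U] assms(2) by blast
  interpret k: group_hom \<FF> H k
    using k(1) by (simp add: group_hom_def group_hom_axioms_def)
  have "L \<subseteq> kernel \<FF> H k"
    using assms(3)[OF k] L by (auto simp: kernel_def subset_iff)
  then have "\<KK> \<subseteq> kernel \<FF> H k"
    by (intro k.G.generate_subgroup_incl k.subgroup_kernel)
  then obtain g where "g \<in> hom (\<FF> Mod \<KK>) H" "\<And>x. x \<in> carrier \<FF> \<Longrightarrow> g (\<KK> #>\<^bsub>\<FF>\<^esub> x) = k x"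
    using k.FactGroup_universal_kernel[OF relation_normal] by metis
  then show ?thesis using that k(2) by simp
qed

end

section \<open>Additive maps and balanced maps\<close>

lemma hom_add_monoid_iff:
  "h \<in> hom (add_monoid M) (add_monoid N) \<longleftrightarrow> h \<in> carrier M \<rightarrow> carrier N \<and>
    (\<forall>x\<in>carrier M. \<forall>y\<in>carrier M. h (x \<oplus>\<^bsub>M\<^esub> y) = h x \<oplus>\<^bsub>N\<^esub> h y)"
  by (simp add: hom_def)

lemma mod_hom_iff:
  "h \<in> mod_hom R M N \<longleftrightarrow> h \<in> hom (add_monoid M) (add_monoid N) \<and>
    (\<forall>a\<in>carrier R. \<forall>x\<in>carrier M. h (a \<odot>\<^bsub>M\<^esub> x) = a \<odot>\<^bsub>N\<^esub> h x)"
  by (auto simp: mod_hom_def hom_add_monoid_iff)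

lemma (in abelian_group) add_neg_cancel:
  assumes "x \<in> carrier G" "y \<in> carrier G" shows "x \<oplus> (y \<oplus> (\<ominus> x \<oplus> \<ominus> y)) = \<zero>"
  using assms r_neg[of "x \<oplus> y"] by (simp add: minus_add a_assoc)

lemma add_hom_minus:
  assumes "abelian_group M" "abelian_group N" "h \<in> hom (add_monoid M) (add_monoid N)"
    "x \<in> carrier M" "y \<in> carrier M"
  shows "h (x \<ominus>\<^bsub>M\<^esub> y) = h x \<ominus>\<^bsub>N\<^esub> h y"
proof -
  interpret M: abelian_group M by fact
  interpret N: abelian_group N by fact
  have c: "h x \<in> carrier N" "h y \<in> carrier N" "h (x \<ominus>\<^bsub>M\<^esub> y) \<in> carrier N"
    using assms by (auto simp: hom_add_monoid_iff)
  have "h y \<oplus>\<^bsub>N\<^esub> h (x \<ominus>\<^bsub>M\<^esub> y) = h (y \<oplus>\<^bsub>M\<^esub> (x \<ominus>\<^bsub>M\<^esub> y))"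
    using assms by (simp add: hom_add_monoid_iff)
  also have "\<dots> = h y \<oplus>\<^bsub>N\<^esub> (h x \<ominus>\<^bsub>N\<^esub> h y)"
    using c assms by (simp add: N.add_minus_cancel M.add_minus_cancel)
  finally show ?thesis using c by simp
qed

lemma add_hom_zero:
  assumes "abelian_group M" "abelian_group N" "h \<in> hom (add_monoid M) (add_monoid N)"
  shows "h \<zero>\<^bsub>M\<^esub> = \<zero>\<^bsub>N\<^esub>"
proof -
  interpret M: abelian_group M by fact
  interpret N: abelian_group N by fact
  have h0: "h \<zero>\<^bsub>M\<^esub> \<in> carrier N" using assms(3) by (auto simp: hom_add_monoid_iff)
  have "h \<zero>\<^bsub>M\<^esub> = h (\<zero>\<^bsub>M\<^esub> \<ominus>\<^bsub>M\<^esub> \<zero>\<^bsub>M\<^esub>)"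
    using M.minus_eq_zero_iff[of "\<zero>\<^bsub>M\<^esub>" "\<zero>\<^bsub>M\<^esub>"] by simp
  also have "\<dots> = h \<zero>\<^bsub>M\<^esub> \<ominus>\<^bsub>N\<^esub> h \<zero>\<^bsub>M\<^esub>" by (simp add: add_hom_minus[OF assms])
  also have "\<dots> = \<zero>\<^bsub>N\<^esub>" using h0 by (simp add: N.minus_eq_zero_iff)
  finally show ?thesis .
qed

lemma add_hom_finsum:
  assumes "abelian_group M" "abelian_group N" "h \<in> hom (add_monoid M) (add_monoid N)"
    "finite A" "f \<in> A \<rightarrow> carrier M"
  shows "h (finsum M f A) = finsum N (\<lambda>x. h (f x)) A"
proof -
  interpret M: abelian_group M by fact
  interpret N: abelian_group N by fact
  show ?thesis
    using assms(4,5)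
  proof (induction A rule: finite_induct)
    case empty
    then show ?case by (simp add: add_hom_zero[OF assms(1-3)])
  next
    case (insert a A)
    have "f \<in> A \<rightarrow> carrier M" "f a \<in> carrier M" using insert by auto
    moreover have "(\<lambda>x. h (f x)) \<in> A \<rightarrow> carrier N" "h (f a) \<in> carrier N"
      using insert assms(3) by (auto simp: hom_add_monoid_iff)
    ultimately show ?case
      using insert assms(3) by (simp add: hom_add_monoid_iff)
  qed
qed

text \<open>Only the addition of \<open>N\<close> enters and its scalar type is free, so the target
  may be a module over any ring, in particular over a ring other than the one acting on the left of
  \<open>B\<close>.\<close>

definition balanced_map ::
    "('r, 'c) ring_scheme \<Rightarrow> ('s, 'r, 'b) bimodule \<Rightarrow> ('r, 'm) module \<Rightarrow> ('t, 'n, 'd) module_scheme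
      \<Rightarrow> ('b \<Rightarrow> 'm \<Rightarrow> 'n) \<Rightarrow> bool"
  where "balanced_map R B M N \<beta> \<longleftrightarrow>
    (\<forall>b\<in>carrier B. \<forall>m\<in>carrier M. \<beta> b m \<in> carrier N) \<and>
    (\<forall>b\<in>carrier B. \<forall>b'\<in>carrier B. \<forall>m\<in>carrier M. \<beta> (b \<oplus>\<^bsub>B\<^esub> b') m = \<beta> b m \<oplus>\<^bsub>N\<^esub> \<beta> b' m) \<and>
    (\<forall>b\<in>carrier B. \<forall>m\<in>carrier M. \<forall>m'\<in>carrier M. \<beta> b (m \<oplus>\<^bsub>M\<^esub> m') = \<beta> b m \<oplus>\<^bsub>N\<^esub> \<beta> b m') \<and>
    (\<forall>b\<in>carrier B. \<forall>r\<in>carrier R. \<forall>m\<in>carrier M. \<beta> (rsmult B b r) m = \<beta> b (r \<odot>\<^bsub>M\<^esub> m))"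

section \<open>The tensor product as a left module and its universal property\<close>

locale bimodule =
  fixes S :: "('s, 'c) ring_scheme" and R :: "('r, 'd) ring_scheme" and B :: "('s, 'r, 'b) bimodule"
  assumes left_module_B: "left_module S B" and ring_R: "ring R"
    and rsmult_closed: "b \<in> carrier B \<Longrightarrow> r \<in> carrier R \<Longrightarrow> rsmult B b r \<in> carrier B"
    and rsmult_l_distr: "b \<in> carrier B \<Longrightarrow> b' \<in> carrier B \<Longrightarrow> r \<in> carrier R \<Longrightarrow>
      rsmult B (b \<oplus>\<^bsub>B\<^esub> b') r = rsmult B b r \<oplus>\<^bsub>B\<^esub> rsmult B b' r"
    and rsmult_r_distr: "b \<in> carrier B \<Longrightarrow> r \<in> carrier R \<Longrightarrow> r' \<in> carrier R \<Longrightarrow>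
      rsmult B b (r \<oplus>\<^bsub>R\<^esub> r') = rsmult B b r \<oplus>\<^bsub>B\<^esub> rsmult B b r'"
    and rsmult_assoc: "b \<in> carrier B \<Longrightarrow> r \<in> carrier R \<Longrightarrow> r' \<in> carrier R \<Longrightarrow>
      rsmult B (rsmult B b r) r' = rsmult B b (r \<otimes>\<^bsub>R\<^esub> r')"
    and smult_rsmult: "s \<in> carrier S \<Longrightarrow> b \<in> carrier B \<Longrightarrow> r \<in> carrier R \<Longrightarrow>
      rsmult B (s \<odot>\<^bsub>B\<^esub> b) r = s \<odot>\<^bsub>B\<^esub> rsmult B b r"
begin

sublocale B: left_module S B by (rule left_module_B)

sublocale R: ring R by (rule ring_R)

end

abbreviation tens ::
    "('r, 'd) ring_scheme \<Rightarrow> ('s, 'r, 'b) bimodule \<Rightarrow> ('r, 'm) module \<Rightarrow> 'b \<Rightarrow> 'm \<Rightarrow> ('b \<times> 'm \<Rightarrow>\<^sub>0 int) set"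
  where "tens R B M b m \<equiv>
    tensor_relations R B M #>\<^bsub>free_Abelian_group (carrier B \<times> carrier M)\<^esub> frag_of (b, m)"

locale tensor_product = bimodule S R B + M: left_module R M
  for S :: "('s, 'c) ring_scheme" and R :: "('r, 'd) ring_scheme" and B :: "('s, 'r, 'b) bimodule"
    and M :: "('r, 'm) module"
begin

abbreviation (input) "F \<equiv> free_Abelian_group (carrier B \<times> carrier M)"
abbreviation (input) "K \<equiv> tensor_relations R B M"
abbreviation (input) "T \<equiv> tensor R B M"

definition relators :: "('b \<times> 'm \<Rightarrow>\<^sub>0 int) set"
  where "relators = {frag_of (b \<oplus>\<^bsub>B\<^esub> b', m) - frag_of (b, m) - frag_of (b', m)
        |b b' m. b \<in> carrier B \<and> b' \<in> carrier B \<and> m \<in> carrier M} \<union>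
     {frag_of (b, m \<oplus>\<^bsub>M\<^esub> m') - frag_of (b, m) - frag_of (b, m')
        |b m m'. b \<in> carrier B \<and> m \<in> carrier M \<and> m' \<in> carrier M} \<union>
     {frag_of (rsmult B b r, m) - frag_of (b, r \<odot>\<^bsub>M\<^esub> m)
        |b r m. b \<in> carrier B \<and> r \<in> carrier R \<and> m \<in> carrier M}"

lemma K_eq: "K = generate F relators"
  by (simp add: tensor_relations_def relators_def)

lemma relators_closed: "relators \<subseteq> carrier F"
proof -
  have "x - y \<in> carrier F" if "x \<in> carrier F" "y \<in> carrier F" for x y
    using that keys_diff[of x y] by auto
  then show ?thesis
    unfolding relators_def by (auto simp: rsmult_closed simp del: carrier_free_Abelian_group_iff
        intro!: frag_of_in_free_Abelian_group[THEN iffD2])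
qed

lemmas quotient_facts = free_quotient_add[OF relators_closed, folded K_eq]
  free_quotient_carrier[OF relators_closed, folded K_eq]
  free_quotient_one[OF relators_closed, folded K_eq]

lemma tensor_simps:
  "carrier T = carrier (F Mod K)" "\<zero>\<^bsub>T\<^esub> = \<one>\<^bsub>F Mod K\<^esub>" "x \<oplus>\<^bsub>T\<^esub> y = x \<otimes>\<^bsub>F Mod K\<^esub> y"
  "s \<odot>\<^bsub>T\<^esub> C = (\<Union>c\<in>C. K #>\<^bsub>F\<^esub> frag_extend (\<lambda>(b, m). frag_of (s \<odot>\<^bsub>B\<^esub> b, m)) c)"
  by (simp_all add: tensor_def Let_def)

lemma comm_group_quotient: "comm_group (F Mod K)"
  by (rule free_quotient_comm_group[OF relators_closed, folded K_eq])

lemma abelian_group_tensor: "abelian_group T"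
proof -
  interpret Q: comm_group "F Mod K" by (rule comm_group_quotient)
  show ?thesis
    by (rule abelian_groupI) (auto simp: tensor_simps Q.m_ac intro: bexI[of _ "inv\<^bsub>F Mod K\<^esub> _"])
qed

sublocale T: abelian_group T by (rule abelian_group_tensor)

lemma neg_tensor:
  assumes "t \<in> carrier T" shows "\<ominus>\<^bsub>T\<^esub> t = inv\<^bsub>F Mod K\<^esub> t"
proof -
  interpret Q: comm_group "F Mod K" by (rule comm_group_quotient)
  show ?thesis using assms by (intro T.minus_equality) (simp_all add: tensor_simps)
qed

lemma tens_closed [simp]:
  "b \<in> carrier B \<Longrightarrow> m \<in> carrier M \<Longrightarrow> tens R B M b m \<in> carrier T"
  by (auto simp: tensor_simps quotient_facts)

lemma relator_mem: "x \<in> relators \<Longrightarrow> x \<in> K"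
  unfolding K_eq by (rule generate.incl)

lemma frag_diff_closed: "x \<in> carrier F \<Longrightarrow> y \<in> carrier F \<Longrightarrow> x - y \<in> carrier F"
  using keys_diff[of x y] by auto

lemma frag_add_closed: "x \<in> carrier F \<Longrightarrow> y \<in> carrier F \<Longrightarrow> x + y \<in> carrier F"
  using keys_add[of x y] by auto

lemma coset_eqI: "x \<in> carrier F \<Longrightarrow> y \<in> carrier F \<Longrightarrow> x - y \<in> K \<Longrightarrow> K #>\<^bsub>F\<^esub> x = K #>\<^bsub>F\<^esub> y"
  using free_quotient_eqI[OF relators_closed, folded K_eq] .

lemma balanced_tens: "balanced_map R B M T (tens R B M)"
  unfolding balanced_map_def
proof (intro conjI ballI)
  fix b b' m assume *: "b \<in> carrier B" "b' \<in> carrier B" "m \<in> carrier M"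
  then have "frag_of (b \<oplus>\<^bsub>B\<^esub> b', m) - (frag_of (b, m) + frag_of (b', m)) \<in> K"
    by (intro relator_mem) (auto simp: relators_def diff_diff_eq)
  then have "tens R B M (b \<oplus>\<^bsub>B\<^esub> b') m = K #>\<^bsub>F\<^esub> (frag_of (b, m) + frag_of (b', m))"
    using * by (intro coset_eqI frag_add_closed) auto
  then show "tens R B M (b \<oplus>\<^bsub>B\<^esub> b') m = tens R B M b m \<oplus>\<^bsub>T\<^esub> tens R B M b' m"
    using * by (simp add: tensor_simps quotient_facts)
next
  fix b m m' assume *: "b \<in> carrier B" "m \<in> carrier M" "m' \<in> carrier M"
  then have "frag_of (b, m \<oplus>\<^bsub>M\<^esub> m') - (frag_of (b, m) + frag_of (b, m')) \<in> K"
    by (intro relator_mem) (auto simp: relators_def diff_diff_eq)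
  then have "tens R B M b (m \<oplus>\<^bsub>M\<^esub> m') = K #>\<^bsub>F\<^esub> (frag_of (b, m) + frag_of (b, m'))"
    using * by (intro coset_eqI frag_add_closed) auto
  then show "tens R B M b (m \<oplus>\<^bsub>M\<^esub> m') = tens R B M b m \<oplus>\<^bsub>T\<^esub> tens R B M b m'"
    using * by (simp add: tensor_simps quotient_facts)
next
  fix b r m assume *: "b \<in> carrier B" "r \<in> carrier R" "m \<in> carrier M"
  then have "frag_of (rsmult B b r, m) - frag_of (b, r \<odot>\<^bsub>M\<^esub> m) \<in> K"
    by (intro relator_mem) (auto simp: relators_def)
  then show "tens R B M (rsmult B b r) m = tens R B M b (r \<odot>\<^bsub>M\<^esub> m)"
    using * by (intro coset_eqI) (auto simp: rsmult_closed)
qed simp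

lemmas tens_add_left = balanced_tens[unfolded balanced_map_def, THEN conjunct2, THEN conjunct1, rule_format]
lemmas tens_add_right = balanced_tens[unfolded balanced_map_def, THEN conjunct2, THEN conjunct2,
    THEN conjunct1, rule_format]
lemmas tens_rsmult = balanced_tens[unfolded balanced_map_def, THEN conjunct2, THEN conjunct2,
    THEN conjunct2, rule_format]

lemma tensor_induct [consumes 1, case_names zero tens minus]:
  assumes "t \<in> carrier T" "P \<zero>\<^bsub>T\<^esub>"
    "\<And>b m. b \<in> carrier B \<Longrightarrow> m \<in> carrier M \<Longrightarrow> P (tens R B M b m)"
    "\<And>t u. t \<in> carrier T \<Longrightarrow> u \<in> carrier T \<Longrightarrow> P t \<Longrightarrow> P u \<Longrightarrow> P (t \<ominus>\<^bsub>T\<^esub> u)"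
  shows "P t"
proof (rule free_quotient_induct[OF relators_closed, folded K_eq])
  show "t \<in> carrier (F Mod K)" using assms(1) by (simp add: tensor_simps)
  show "P (K #>\<^bsub>F\<^esub> 0)" using assms(2) by (simp add: tensor_simps quotient_facts)
  show "P (K #>\<^bsub>F\<^esub> frag_of a)" if "a \<in> carrier B \<times> carrier M" for a using assms(3) that by auto
  show "P (C \<otimes>\<^bsub>F Mod K\<^esub> inv\<^bsub>F Mod K\<^esub> D)"
    if "C \<in> carrier (F Mod K)" "D \<in> carrier (F Mod K)" "P C" "P D" for C D
    using assms(4)[of C D] that neg_tensor[of D] by (simp add: tensor_simps a_minus_def)
qed

text \<open>Pure tensors generate the additive group. The maps are only required to be additive
  because the lemma is also used to derive the module laws and the linearity of lifted maps.\<close>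

lemma tensor_add_hom_eqI:
  assumes "abelian_group N" "f \<in> hom (add_monoid T) (add_monoid N)" "g \<in> hom (add_monoid T) (add_monoid N)"
    "\<And>b m. b \<in> carrier B \<Longrightarrow> m \<in> carrier M \<Longrightarrow> f (tens R B M b m) = g (tens R B M b m)" "t \<in> carrier T"
  shows "f t = g t"
  using assms(5)
  by (induction rule: tensor_induct)
    (simp_all add: add_hom_zero[OF abelian_group_tensor assms(1)] assms(2-4)
      add_hom_minus[OF abelian_group_tensor assms(1)])

abbreviation (input) "scale s \<equiv> frag_extend (\<lambda>(b, m). frag_of (s \<odot>\<^bsub>B\<^esub> b, m))"

lemma scale_closed:
  assumes "s \<in> carrier S" "x \<in> carrier F" shows "scale s x \<in> carrier F"
  using assms keys_frag_extend[of "\<lambda>(b, m). frag_of (s \<odot>\<^bsub>B\<^esub> b, m)" x] by fastforce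

text \<open>This is what makes the scalar action on cosets well defined. Scaling sends each kind of
  relator to one of the same kind; for the third kind this is the compatibility of the two actions
  on \<open>B\<close>.\<close>

lemma scale_relations:
  assumes s: "s \<in> carrier S" and x: "x \<in> K" shows "scale s x \<in> K"
proof -
  have r: "scale s y \<in> K" if "y \<in> relators" for y
    using that unfolding relators_def
  proof (elim UnE CollectE exE conjE)
    fix b b' m assume y: "y = frag_of (b \<oplus>\<^bsub>B\<^esub> b', m) - frag_of (b, m) - frag_of (b', m)"
      and b: "b \<in> carrier B" "b' \<in> carrier B" and m: "m \<in> carrier M"
    have "scale s y = frag_of (s \<odot>\<^bsub>B\<^esub> b \<oplus>\<^bsub>B\<^esub> s \<odot>\<^bsub>B\<^esub> b', m) - frag_of (s \<odot>\<^bsub>B\<^esub> b, m) - frag_of (s \<odot>\<^bsub>B\<^esub> b', m)"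
      unfolding y using s b by (simp add: frag_extend_diff B.smult_r_distr)
    then show ?thesis
      using B.smult_closed[OF s b(1)] B.smult_closed[OF s b(2)] m
      by (intro relator_mem) (auto simp: relators_def)
  next
    fix b m m' assume y: "y = frag_of (b, m \<oplus>\<^bsub>M\<^esub> m') - frag_of (b, m) - frag_of (b, m')"
      and b: "b \<in> carrier B" and m: "m \<in> carrier M" "m' \<in> carrier M"
    have "scale s y = frag_of (s \<odot>\<^bsub>B\<^esub> b, m \<oplus>\<^bsub>M\<^esub> m') - frag_of (s \<odot>\<^bsub>B\<^esub> b, m) - frag_of (s \<odot>\<^bsub>B\<^esub> b, m')"
      unfolding y by (simp add: frag_extend_diff)
    then show ?thesis
      using B.smult_closed[OF s b] m by (intro relator_mem) (auto simp: relators_def)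
  next
    fix b r m assume y: "y = frag_of (rsmult B b r, m) - frag_of (b, r \<odot>\<^bsub>M\<^esub> m)"
      and b: "b \<in> carrier B" and r: "r \<in> carrier R" and m: "m \<in> carrier M"
    have "scale s y = frag_of (rsmult B (s \<odot>\<^bsub>B\<^esub> b) r, m) - frag_of (s \<odot>\<^bsub>B\<^esub> b, r \<odot>\<^bsub>M\<^esub> m)"
      unfolding y using s b r by (simp add: frag_extend_diff smult_rsmult)
    then show ?thesis
      using B.smult_closed[OF s b] r m by (intro relator_mem) (auto simp: relators_def)
  qed
  have subK: "subgroup K F" using relation_subgroup[OF relators_closed, folded K_eq] .
  show ?thesis
    using x unfolding K_eq
  proof (induction rule: generate.induct)
    case one
    then show ?case using subgroup.one_closed[OF subK] by (simp add: K_eq)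
  next
    case (incl h)
    then show ?case using r by (simp add: K_eq)
  next
    case (inv h)
    then have "inv\<^bsub>F\<^esub> scale s h \<in> K" using r subgroup.m_inv_closed[OF subK] by blast
    moreover have "h \<in> carrier F" using inv relators_closed by blast
    ultimately show ?case
      using scale_closed[OF s, of h] by (simp add: K_eq frag_extend_minus)
  next
    case (eng h1 h2)
    then show ?case using subgroup.m_closed[OF subK] by (simp add: K_eq frag_extend_add)
  qed
qed

text \<open>The union over all representatives in the definition of the action collapses to one
  coset: two representatives differ by a relation, and scaling keeps it a relation.\<close>

lemma smult_coset:
  assumes "s \<in> carrier S" "x \<in> carrier F"
  shows "s \<odot>\<^bsub>T\<^esub> (K #>\<^bsub>F\<^esub> x) = K #>\<^bsub>F\<^esub> scale s x"
proof -
  have subK: "subgroup K F" using relation_subgroup[OF relators_closed, folded K_eq] .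
  have "K #>\<^bsub>F\<^esub> scale s c = K #>\<^bsub>F\<^esub> scale s x" if "c \<in> K #>\<^bsub>F\<^esub> x" for c
  proof -
    obtain k where k: "k \<in> K" "c = k + x" using \<open>c \<in> K #>\<^bsub>F\<^esub> x\<close> by (auto simp: r_coset_def)
    have "k \<in> carrier F" using k(1) subgroup.subset[OF subK] by blast
    then show ?thesis
      using scale_relations[OF assms(1) k(1)] scale_closed[OF assms] scale_closed[OF assms(1), of k]
      unfolding k(2) frag_extend_add
      by (intro coset_eqI frag_add_closed) auto
  qed
  moreover have "x \<in> K #>\<^bsub>F\<^esub> x"
    using group.rcos_self[OF group_free_Abelian_group _ subK] assms(2) by blast
  ultimately show ?thesis unfolding tensor_simps by blast
qed

lemma smult_tens [simp]:
  assumes "s \<in> carrier S" "b \<in> carrier B" "m \<in> carrier M"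
  shows "s \<odot>\<^bsub>T\<^esub> tens R B M b m = tens R B M (s \<odot>\<^bsub>B\<^esub> b) m"
  using assms by (subst smult_coset) auto

lemma smult_add_hom:
  assumes "s \<in> carrier S"
  shows "(\<lambda>t. s \<odot>\<^bsub>T\<^esub> t) \<in> hom (add_monoid T) (add_monoid T)"
  unfolding hom_add_monoid_iff
proof (intro conjI Pi_I ballI)
  fix t assume "t \<in> carrier T"
  then obtain x where x: "x \<in> carrier F" "t = K #>\<^bsub>F\<^esub> x" by (auto simp: tensor_simps quotient_facts)
  then show "s \<odot>\<^bsub>T\<^esub> t \<in> carrier T"
    using scale_closed[OF assms x(1)] smult_coset[OF assms x(1)]
    by (auto simp: tensor_simps(1) quotient_facts)
  fix u assume "u \<in> carrier T"
  then obtain y where y: "y \<in> carrier F" "u = K #>\<^bsub>F\<^esub> y" by (auto simp: tensor_simps quotient_facts)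
  show "s \<odot>\<^bsub>T\<^esub> (t \<oplus>\<^bsub>T\<^esub> u) = s \<odot>\<^bsub>T\<^esub> t \<oplus>\<^bsub>T\<^esub> s \<odot>\<^bsub>T\<^esub> u"
    using x y scale_closed[OF assms] frag_add_closed[OF x(1) y(1)]
    by (simp add: tensor_simps(3) quotient_facts smult_coset[OF assms] frag_extend_add
        del: carrier_free_Abelian_group_iff)
qed

lemma left_module_tensor: "left_module S T"
proof (intro left_module.intro left_module_axioms.intro abelian_group_tensor B.R.ring_axioms)
  note c = smult_add_hom[unfolded hom_add_monoid_iff, THEN conjunct1, THEN funcset_mem]
  note a = smult_add_hom[unfolded hom_add_monoid_iff, THEN conjunct2, rule_format]
  show "s \<odot>\<^bsub>T\<^esub> t \<in> carrier T" if "s \<in> carrier S" "t \<in> carrier T" for s t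
    using c that by blast
  show "s \<odot>\<^bsub>T\<^esub> (t \<oplus>\<^bsub>T\<^esub> u) = s \<odot>\<^bsub>T\<^esub> t \<oplus>\<^bsub>T\<^esub> s \<odot>\<^bsub>T\<^esub> u"
    if "s \<in> carrier S" "t \<in> carrier T" "u \<in> carrier T" for s t u
    using a that by blast
  show "(s \<oplus>\<^bsub>S\<^esub> s') \<odot>\<^bsub>T\<^esub> t = s \<odot>\<^bsub>T\<^esub> t \<oplus>\<^bsub>T\<^esub> s' \<odot>\<^bsub>T\<^esub> t"
    if "s \<in> carrier S" "s' \<in> carrier S" "t \<in> carrier T" for s s' t
    by (rule tensor_add_hom_eqI[OF abelian_group_tensor smult_add_hom _ _ that(3)])
      (use that c a in \<open>auto simp: hom_add_monoid_iff B.smult_l_distr tens_add_left T.a_ac\<close>)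
  show "(s \<otimes>\<^bsub>S\<^esub> s') \<odot>\<^bsub>T\<^esub> t = s \<odot>\<^bsub>T\<^esub> (s' \<odot>\<^bsub>T\<^esub> t)"
    if "s \<in> carrier S" "s' \<in> carrier S" "t \<in> carrier T" for s s' t
    by (rule tensor_add_hom_eqI[OF abelian_group_tensor smult_add_hom _ _ that(3)])
      (use that c a in \<open>auto simp: hom_add_monoid_iff B.smult_assoc\<close>)
  show "\<one>\<^bsub>S\<^esub> \<odot>\<^bsub>T\<^esub> t = t" if "t \<in> carrier T" for t
    by (rule tensor_add_hom_eqI[OF abelian_group_tensor smult_add_hom _ _ that])
      (use that in \<open>auto simp: hom_add_monoid_iff\<close>)
qed

sublocale T: left_module S T by (rule left_module_tensor)

text \<open>The additive half of the universal property is kept apart because in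
  \<open>cut_tensor\<close> and \<open>red_induced\<close> the target is a module over a different
  ring than the tensor product, so that no linearity over the left ring can be asked for.\<close>

lemma tensor_lift_add:
  assumes N: "abelian_group N" and \<beta>: "balanced_map R B M N \<beta>"
  shows "\<exists>h\<in>hom (add_monoid T) (add_monoid N). \<forall>b\<in>carrier B. \<forall>m\<in>carrier M. h (tens R B M b m) = \<beta> b m"
proof -
  interpret N: abelian_group N by fact
  note b = \<beta>[unfolded balanced_map_def]
  show ?thesis
  proof (rule free_quotient_universal[OF relators_closed N.a_comm_group, of "\<lambda>(b, m). \<beta> b m", folded K_eq])
    show "(\<lambda>(b, m). \<beta> b m) \<in> carrier B \<times> carrier M \<rightarrow> carrier (add_monoid N)"
      using b by auto
    show "h g = \<one>\<^bsub>add_monoid N\<^esub>" if h: "h \<in> hom F (add_monoid N)"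
      "\<And>x. x \<in> carrier B \<times> carrier M \<Longrightarrow> h (frag_of x) = (case x of (b, m) \<Rightarrow> \<beta> b m)" and g: "g \<in> relators"
    for h g
    proof -
      interpret h: group_hom F "add_monoid N" h
        using h(1) N.a_group by (simp add: group_hom_def group_hom_axioms_def)
      have d: "h (x - y) = h x \<ominus>\<^bsub>N\<^esub> h y" if "x \<in> carrier F" "y \<in> carrier F" for x y
      proof -
        have "h (inv\<^bsub>F\<^esub> y) = \<ominus>\<^bsub>N\<^esub> h y" using h.hom_inv[OF that(2)] by (simp add: a_inv_def)
        moreover have "inv\<^bsub>F\<^esub> y = - y" "- y \<in> carrier F" using that(2) by auto
        moreover have "h (x + - y) = h x \<oplus>\<^bsub>N\<^esub> h (- y)"
          using h.hom_mult[of x "- y"] that(1) calculation(3) by simp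
        ultimately show ?thesis by (simp add: a_minus_def)
      qed
      show ?thesis
        using g unfolding relators_def
        by (elim UnE CollectE exE conjE; hypsubst)
          (use b in \<open>simp_all add: d frag_diff_closed h(2) rsmult_closed N.minus_eq
            N.a_ac N.r_neg N.add_neg_cancel N.minus_eq_zero_iff del: carrier_free_Abelian_group_iff
            add: frag_of_in_free_Abelian_group\<close>)
    qed
  next
    fix h assume "h \<in> hom (F Mod K) (add_monoid N)"
      "\<And>x. x \<in> carrier B \<times> carrier M \<Longrightarrow> h (K #>\<^bsub>F\<^esub> frag_of x) = (case x of (b, m) \<Rightarrow> \<beta> b m)"
    then show ?thesis by (intro bexI[of _ h]) (auto simp: hom_def tensor_simps)
  qed
qed

lemma tensor_lift:
  fixes N :: "('s, 'n) module"
  assumes N: "left_module S N" and \<beta>: "balanced_map R B M N \<beta>"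
    and smult: "\<And>s b m. s \<in> carrier S \<Longrightarrow> b \<in> carrier B \<Longrightarrow> m \<in> carrier M \<Longrightarrow> \<beta> (s \<odot>\<^bsub>B\<^esub> b) m = s \<odot>\<^bsub>N\<^esub> \<beta> b m"
  shows "\<exists>h\<in>mod_hom S T N. \<forall>b\<in>carrier B. \<forall>m\<in>carrier M. h (tens R B M b m) = \<beta> b m"
proof -
  interpret N: left_module S N by fact
  obtain h where h: "h \<in> hom (add_monoid T) (add_monoid N)"
    "\<forall>b\<in>carrier B. \<forall>m\<in>carrier M. h (tens R B M b m) = \<beta> b m"
    using tensor_lift_add[OF N.M.abelian_group_axioms \<beta>] by (elim bexE)
  have hc: "h t \<in> carrier N" if "t \<in> carrier T" for t
    using h(1) that by (auto simp: hom_add_monoid_iff)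
  have ha: "h (t \<oplus>\<^bsub>T\<^esub> u) = h t \<oplus>\<^bsub>N\<^esub> h u" if "t \<in> carrier T" "u \<in> carrier T" for t u
    using h(1) that by (simp add: hom_add_monoid_iff)
  have "h (s \<odot>\<^bsub>T\<^esub> t) = s \<odot>\<^bsub>N\<^esub> h t" if s: "s \<in> carrier S" and t: "t \<in> carrier T" for s t
  proof (rule tensor_add_hom_eqI[OF N.M.abelian_group_axioms _ _ _ t])
    show "(\<lambda>t. h (s \<odot>\<^bsub>T\<^esub> t)) \<in> hom (add_monoid T) (add_monoid N)"
      using s hc by (simp add: hom_add_monoid_iff T.smult_r_distr ha)
    show "(\<lambda>t. s \<odot>\<^bsub>N\<^esub> h t) \<in> hom (add_monoid T) (add_monoid N)"
      using s hc by (simp add: hom_add_monoid_iff N.smult_r_distr ha)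
    show "h (s \<odot>\<^bsub>T\<^esub> tens R B M b m) = s \<odot>\<^bsub>N\<^esub> h (tens R B M b m)"
      if "b \<in> carrier B" "m \<in> carrier M" for b m
      using s that by (simp add: h(2) smult)
  qed
  then have "h \<in> mod_hom S T N" using h(1) by (simp add: mod_hom_iff)
  with h(2) show ?thesis by (rule bexI)
qed

text \<open>The candidate inverse \<open>j\<close> need only be additive, since \<open>j\<close>
  after the induced map is compared with the identity on pure tensors. The other composite is tested
  against any map with the values \<open>\<beta>\<close>, because the induced map itself exists only
  inside the proof.\<close>

lemma tensor_isomorphic:
  fixes N :: "('s, 'n) module"
  assumes N: "left_module S N" and \<beta>: "balanced_map R B M N \<beta>"
    and smult: "\<And>s b m. s \<in> carrier S \<Longrightarrow> b \<in> carrier B \<Longrightarrow> m \<in> carrier M \<Longrightarrow> \<beta> (s \<odot>\<^bsub>B\<^esub> b) m = s \<odot>\<^bsub>N\<^esub> \<beta> b m"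
    and j: "j \<in> hom (add_monoid N) (add_monoid T)"
      "\<And>b m. b \<in> carrier B \<Longrightarrow> m \<in> carrier M \<Longrightarrow> j (\<beta> b m) = tens R B M b m"
    and surj: "\<And>h y. h \<in> mod_hom S T N \<Longrightarrow> \<forall>b\<in>carrier B. \<forall>m\<in>carrier M. h (tens R B M b m) = \<beta> b m \<Longrightarrow>
      y \<in> carrier N \<Longrightarrow> h (j y) = y"
  shows "isomorphic_modules S T N"
proof -
  obtain h where h: "h \<in> mod_hom S T N"
    "\<forall>b\<in>carrier B. \<forall>m\<in>carrier M. h (tens R B M b m) = \<beta> b m"
    using tensor_lift[OF N \<beta>] smult by metis
  have jc: "j y \<in> carrier T" if "y \<in> carrier N" for y
    using j(1) that by (auto simp: hom_add_monoid_iff)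
  have "(\<lambda>t. j (h t)) \<in> hom (add_monoid T) (add_monoid T)"
    using mod_homD(1,2)[OF h(1)] j(1) jc by (simp add: hom_add_monoid_iff)
  then have "j (h t) = t" if "t \<in> carrier T" for t
    using tensor_add_hom_eqI[OF abelian_group_tensor, of "\<lambda>t. j (h t)" "\<lambda>t. t" t] that
    by (simp add: hom_add_monoid_iff h(2) j(2))
  with jc surj[OF h] show ?thesis by (intro isomorphic_modulesI[OF h(1), of j])
qed

end

section \<open>Functoriality and additivity of the tensor product\<close>

lemma tensor_map:
  assumes "tensor_product S R B M" "tensor_product S R B M'" "f \<in> mod_hom R M M'"
  shows "\<exists>h\<in>mod_hom S (tensor R B M) (tensor R B M').
    \<forall>b\<in>carrier B. \<forall>m\<in>carrier M. h (tens R B M b m) = tens R B M' b (f m)"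
proof -
  interpret M: tensor_product S R B M by fact
  interpret M': tensor_product S R B M' by fact
  have "balanced_map R B M (tensor R B M') (\<lambda>b m. tens R B M' b (f m))"
    using assms(3)
    by (auto simp: balanced_map_def mod_hom_def M'.tens_add_left M'.tens_add_right M'.tens_rsmult Pi_iff)
  moreover have "tens R B M' (s \<odot>\<^bsub>B\<^esub> b) (f m) = s \<odot>\<^bsub>tensor R B M'\<^esub> tens R B M' b (f m)"
    if "s \<in> carrier S" "b \<in> carrier B" "m \<in> carrier M" for s b m
    using that mod_homD(1)[OF assms(3)] by simp
  ultimately show ?thesis by (rule M.tensor_lift[OF M'.left_module_tensor])
qed

lemma tensor_isomorphic_cong:
  assumes "tensor_product S R B M" "tensor_product S R B M'" "isomorphic_modules R M M'"
  shows "isomorphic_modules S (tensor R B M) (tensor R B M')"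
proof -
  interpret M: tensor_product S R B M by fact
  interpret M': tensor_product S R B M' by fact
  obtain f g where fg: "f \<in> mod_hom R M M'" "g \<in> mod_hom R M' M"
    "\<forall>x\<in>carrier M. g (f x) = x" "\<forall>y\<in>carrier M'. f (g y) = y"
    using isomorphic_modulesE[OF assms(3) M.M.left_module_axioms M'.M.left_module_axioms] .
  obtain h where h: "h \<in> mod_hom S (tensor R B M) (tensor R B M')"
    "\<forall>b\<in>carrier B. \<forall>m\<in>carrier M. h (tens R B M b m) = tens R B M' b (f m)"
    using tensor_map[OF assms(1,2) fg(1)] by (elim bexE)
  obtain k where k: "k \<in> mod_hom S (tensor R B M') (tensor R B M)"
    "\<forall>b\<in>carrier B. \<forall>m\<in>carrier M'. k (tens R B M' b m) = tens R B M b (g m)"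
    using tensor_map[OF assms(2,1) fg(2)] by (elim bexE)

  have "k (h t) = t" if "t \<in> carrier (tensor R B M)" for t
    using M.tensor_add_hom_eqI[OF M.abelian_group_tensor, of "\<lambda>t. k (h t)" "\<lambda>t. t" t] that
      mod_hom_comp[OF h(1) k(1)] mod_homD(1)[OF fg(1)]
    by (simp add: mod_hom_iff h(2) k(2) fg(3) hom_add_monoid_iff)
  moreover have "h (k t) = t" if "t \<in> carrier (tensor R B M')" for t
    using M'.tensor_add_hom_eqI[OF M'.abelian_group_tensor, of "\<lambda>t. h (k t)" "\<lambda>t. t" t] that
      mod_hom_comp[OF k(1) h(1)] mod_homD(1)[OF fg(2)]
    by (simp add: mod_hom_iff h(2) k(2) fg(4) hom_add_monoid_iff)
  ultimately show ?thesis
    using mod_homD(1)[OF k(1)] by (intro isomorphic_modulesI[OF h(1), of k])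
qed

text \<open>The inclusions of the two summands induce maps of tensor products, and their sum inverts
  the map that separates the components.\<close>

lemma tensor_direct_sum:
  assumes "tensor_product S R B M" "tensor_product S R B M'"
  shows "isomorphic_modules S (tensor R B (direct_sum M M')) (direct_sum (tensor R B M) (tensor R B M'))"
proof -
  interpret M: tensor_product S R B M by fact
  interpret M': tensor_product S R B M' by fact
  let ?D = "direct_sum M M'"
  interpret D: tensor_product S R B ?D
    by (intro tensor_product.intro M.bimodule_axioms left_module_direct_sum M.M.left_module_axioms
        M'.M.left_module_axioms)
  have i: "(\<lambda>m. (m, \<zero>\<^bsub>M'\<^esub>)) \<in> mod_hom R M ?D" "(\<lambda>m. (\<zero>\<^bsub>M\<^esub>, m)) \<in> mod_hom R M' ?D"
    by (auto simp: mod_hom_def M.M.smult_r_null M'.M.smult_r_null)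
  obtain h where h: "h \<in> mod_hom S (tensor R B M) (tensor R B ?D)"
    "\<forall>b\<in>carrier B. \<forall>m\<in>carrier M. h (tens R B M b m) = tens R B ?D b (m, \<zero>\<^bsub>M'\<^esub>)"
    using tensor_map[OF assms(1) D.tensor_product_axioms i(1)] by (elim bexE)
  obtain h' where h': "h' \<in> mod_hom S (tensor R B M') (tensor R B ?D)"
    "\<forall>b\<in>carrier B. \<forall>m\<in>carrier M'. h' (tens R B M' b m) = tens R B ?D b (\<zero>\<^bsub>M\<^esub>, m)"
    using tensor_map[OF assms(2) D.tensor_product_axioms i(2)] by (elim bexE)
  let ?N = "direct_sum (tensor R B M) (tensor R B M')"
  let ?\<beta> = "\<lambda>b (m, m'). (tens R B M b m, tens R B M' b m')"
  let ?j = "\<lambda>(t, u). h t \<oplus>\<^bsub>tensor R B ?D\<^esub> h' u"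
  show ?thesis
  proof (rule D.tensor_isomorphic[of ?N ?\<beta> ?j])
    show "left_module S ?N"
      by (intro left_module_direct_sum M.left_module_tensor M'.left_module_tensor)
    then interpret N: left_module S ?N .
    show "balanced_map R B ?D ?N ?\<beta>"
      by (auto simp: balanced_map_def M.tens_add_left M'.tens_add_left M.tens_add_right
          M'.tens_add_right M.tens_rsmult M'.tens_rsmult)
    show "?\<beta> (s \<odot>\<^bsub>B\<^esub> b) z = s \<odot>\<^bsub>?N\<^esub> ?\<beta> b z"
      if "s \<in> carrier S" "b \<in> carrier B" "z \<in> carrier ?D" for s b z
      using that by auto
    show j: "?j \<in> hom (add_monoid ?N) (add_monoid (tensor R B ?D))"
      unfolding hom_add_monoid_iff
      using mod_homD(1,2)[OF h(1)] mod_homD(1,2)[OF h'(1)] by (auto simp: D.T.a_ac)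
    show "?j (?\<beta> b z) = tens R B ?D b z" if b: "b \<in> carrier B" and z: "z \<in> carrier ?D" for b z
    proof -
      obtain m m' where m: "z = (m, m')" "m \<in> carrier M" "m' \<in> carrier M'" using z by auto
      then show ?thesis
        using b h(2) h'(2) D.tens_add_right[OF b, of "(m, \<zero>\<^bsub>M'\<^esub>)" "(\<zero>\<^bsub>M\<^esub>, m')"] by simp
    qed
    fix k y
    assume k: "k \<in> mod_hom S (tensor R B ?D) ?N"
      "\<forall>b\<in>carrier B. \<forall>m\<in>carrier ?D. k (tens R B ?D b m) = ?\<beta> b m" and y: "y \<in> carrier ?N"
    have z: "tens R B M b \<zero>\<^bsub>M\<^esub> = \<zero>\<^bsub>tensor R B M\<^esub>" "tens R B M' b \<zero>\<^bsub>M'\<^esub> = \<zero>\<^bsub>tensor R B M'\<^esub>"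
      if "b \<in> carrier B" for b
      using M.tens_add_right[OF that, of "\<zero>\<^bsub>M\<^esub>" "\<zero>\<^bsub>M\<^esub>"] M'.tens_add_right[OF that, of "\<zero>\<^bsub>M'\<^esub>" "\<zero>\<^bsub>M'\<^esub>"] that
      by simp_all
    obtain t u where tu: "y = (t, u)" "t \<in> carrier (tensor R B M)" "u \<in> carrier (tensor R B M')"
      using y by auto
    have "k (h t) = (t, \<zero>\<^bsub>tensor R B M'\<^esub>)"
    proof (rule M.tensor_add_hom_eqI[where f = "\<lambda>t. k (h t)" and g = "\<lambda>t. (t, \<zero>\<^bsub>tensor R B M'\<^esub>)",
          OF N.M.abelian_group_axioms _ _ _ tu(2)])
      show "(\<lambda>t. k (h t)) \<in> hom (add_monoid (tensor R B M)) (add_monoid ?N)"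
        using mod_hom_comp[OF h(1) k(1)] unfolding mod_hom_iff by (rule conjunct1)
      show "(\<lambda>t. (t, \<zero>\<^bsub>tensor R B M'\<^esub>)) \<in> hom (add_monoid (tensor R B M)) (add_monoid ?N)"
        unfolding hom_add_monoid_iff by simp
      fix b m assume "b \<in> carrier B" "m \<in> carrier M"
      then show "k (h (tens R B M b m)) = (tens R B M b m, \<zero>\<^bsub>tensor R B M'\<^esub>)"
        using h(2)[rule_format, of b m] k(2)[rule_format, of b "(m, \<zero>\<^bsub>M'\<^esub>)"] z by simp
    qed
    moreover have "k (h' u) = (\<zero>\<^bsub>tensor R B M\<^esub>, u)"
    proof (rule M'.tensor_add_hom_eqI[where f = "\<lambda>t. k (h' t)" and g = "\<lambda>t. (\<zero>\<^bsub>tensor R B M\<^esub>, t)",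
          OF N.M.abelian_group_axioms _ _ _ tu(3)])
      show "(\<lambda>t. k (h' t)) \<in> hom (add_monoid (tensor R B M')) (add_monoid ?N)"
        using mod_hom_comp[OF h'(1) k(1)] unfolding mod_hom_iff by (rule conjunct1)
      show "(\<lambda>t. (\<zero>\<^bsub>tensor R B M\<^esub>, t)) \<in> hom (add_monoid (tensor R B M')) (add_monoid ?N)"
        unfolding hom_add_monoid_iff by simp
      fix b m assume "b \<in> carrier B" "m \<in> carrier M'"
      then show "k (h' (tens R B M' b m)) = (\<zero>\<^bsub>tensor R B M\<^esub>, tens R B M' b m)"
        using h'(2)[rule_format, of b m] k(2)[rule_format, of b "(\<zero>\<^bsub>M\<^esub>, m)"] z by simp
    qed
    ultimately show "k (?j y) = y"
      using tu mod_homD(2)[OF k(1)] mod_homD(1)[OF h(1)] mod_homD(1)[OF h'(1)] by simp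
  qed
qed

context tensor_product
begin

lemma tens_finsum:
  assumes "b \<in> carrier B" "finite A" "f \<in> A \<rightarrow> carrier M"
  shows "tens R B M b (finsum M f A) = finsum T (\<lambda>i. tens R B M b (f i)) A"
  using assms
  by (intro add_hom_finsum M.M.abelian_group_axioms abelian_group_tensor)
    (auto simp: hom_add_monoid_iff tens_add_right)

lemma rsmult_zero: "b \<in> carrier B \<Longrightarrow> rsmult B b \<zero>\<^bsub>R\<^esub> = \<zero>\<^bsub>B\<^esub>"
  using rsmult_r_distr[of b "\<zero>\<^bsub>R\<^esub>" "\<zero>\<^bsub>R\<^esub>"] rsmult_closed[of b "\<zero>\<^bsub>R\<^esub>"]
  by (simp add: B.M.add.r_cancel_one)

text \<open>Both maps are explicit: if \<open>s m = (s\<^sub>i(m))\<close> and \<open>x\<^sub>i\<close> is the image of the unit row, then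
  \<open>b \<otimes> m\<close> goes to \<open>(b s\<^sub>i(m))\<close> and \<open>(b\<^sub>i)\<close> to \<open>\<Sum> b\<^sub>i \<otimes> x\<^sub>i\<close>.\<close>

lemma tensor_retract:
  assumes s: "s \<in> mod_hom R M (row_module R n)" and q: "q \<in> mod_hom R (row_module R n) M"
    and qs: "\<And>x. x \<in> carrier M \<Longrightarrow> q (s x) = x"
  shows "retract S T (power_module B n)"
proof -
  let ?P = "power_module B n"
  have P: "left_module S ?P" by (rule left_module_power[OF left_module_B])
  define x where "x i = q (unit_row R i)" for i
  have x: "x i \<in> carrier M" if "i < n" for i
    unfolding x_def by (rule mod_homD(1)[OF q unit_row_closed[OF ring_R that]])
  have sR: "s m i \<in> carrier R" "n \<le> i \<Longrightarrow> s m i = \<zero>\<^bsub>R\<^esub>" if "m \<in> carrier M" for m i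
    using mod_homD(1)[OF s that] by (simp_all add: row_module_iff)
  let ?\<beta> = "\<lambda>b m i. rsmult B b (s m i)"
  have "balanced_map R B M ?P ?\<beta>"
    using sR mod_homD[OF s]
    by (auto simp: balanced_map_def power_module_iff rsmult_closed rsmult_zero rsmult_l_distr
        rsmult_r_distr rsmult_assoc)
  moreover have "?\<beta> (a \<odot>\<^bsub>B\<^esub> b) m = a \<odot>\<^bsub>?P\<^esub> ?\<beta> b m"
    if "a \<in> carrier S" "b \<in> carrier B" "m \<in> carrier M" for a b m
    using that sR by (auto simp: smult_rsmult)
  ultimately have "\<exists>h\<in>mod_hom S T ?P. \<forall>b\<in>carrier B. \<forall>m\<in>carrier M. h (tens R B M b m) = ?\<beta> b m"
    by (rule tensor_lift[OF P])
  then obtain h where h: "h \<in> mod_hom S T ?P"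
    "\<forall>b\<in>carrier B. \<forall>m\<in>carrier M. h (tens R B M b m) = ?\<beta> b m" by (elim bexE)
  define k where "k u = finsum T (\<lambda>i. tens R B M (u i) (x i)) {..<n}" for u
  have k: "k \<in> mod_hom S ?P T"
    unfolding mod_hom_def
  proof (intro CollectI conjI ballI Pi_I)
    fix u assume u: "u \<in> carrier ?P"
    then have u': "u i \<in> carrier B" for i by (simp add: power_module_iff)
    then show "k u \<in> carrier T" unfolding k_def using x by (intro T.finsum_closed) auto
    show "k (a \<odot>\<^bsub>?P\<^esub> u) = a \<odot>\<^bsub>T\<^esub> k u" if a: "a \<in> carrier S" for a
    proof -
      have "a \<odot>\<^bsub>T\<^esub> k u = finsum T (\<lambda>i. a \<odot>\<^bsub>T\<^esub> tens R B M (u i) (x i)) {..<n}"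
        unfolding k_def using u' x a by (intro T.smult_finsum) auto
      also have "\<dots> = k (a \<odot>\<^bsub>?P\<^esub> u)"
        unfolding k_def using u' x a by (intro T.finsum_cong') auto
      finally show ?thesis by simp
    qed
    fix v assume v: "v \<in> carrier ?P"
    then have v': "v i \<in> carrier B" for i by (simp add: power_module_iff)
    have "k u \<oplus>\<^bsub>T\<^esub> k v = finsum T (\<lambda>i. tens R B M (u i) (x i) \<oplus>\<^bsub>T\<^esub> tens R B M (v i) (x i)) {..<n}"
      unfolding k_def using u' v' x by (intro T.finsum_addf[symmetric]) auto
    also have "\<dots> = k (u \<oplus>\<^bsub>?P\<^esub> v)"
      unfolding k_def using u' v' x by (intro T.finsum_cong') (auto simp: tens_add_left)
    finally show "k (u \<oplus>\<^bsub>?P\<^esub> v) = k u \<oplus>\<^bsub>T\<^esub> k v" by simp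
  qed
  have "k (h t) = t" if "t \<in> carrier T" for t
  proof (rule tensor_add_hom_eqI[where f = "\<lambda>t. k (h t)" and g = "\<lambda>t. t", OF abelian_group_tensor _ _ _ that])
    show "(\<lambda>t. k (h t)) \<in> hom (add_monoid T) (add_monoid T)"
      using mod_hom_comp[OF h(1) k] by (simp add: mod_hom_iff)
    fix b m assume b: "b \<in> carrier B" and m: "m \<in> carrier M"
    have "k (h (tens R B M b m)) = finsum T (\<lambda>i. tens R B M b (s m i \<odot>\<^bsub>M\<^esub> x i)) {..<n}"
      unfolding k_def h(2)[rule_format, OF b m] using sR[OF m] x b
      by (intro T.finsum_cong') (auto simp: tens_rsmult)
    also have "\<dots> = tens R B M b (row_comb M n x (s m))"
      unfolding row_comb_def using sR[OF m] x b by (intro tens_finsum[symmetric]) auto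
    also have "row_comb M n x (s m) = m"
      using mod_hom_row_module[OF M.left_module_axioms q mod_homD(1)[OF s m]] qs[OF m]
      by (simp add: x_def[abs_def])
    finally show "k (h (tens R B M b m)) = tens R B M b m" .
  qed (auto simp: hom_add_monoid_iff)
  then show ?thesis using h(1) k by (intro retractI)
qed

end

section \<open>The Grothendieck group\<close>

lemma iso_class_nonempty: "fgp_module R M \<Longrightarrow> iso_class R M \<noteq> {}"
  using fgp_module_representative[of R M] by (auto simp: iso_class_def)

text \<open>A class records only modules on sequences. Equal classes force an isomorphism because
  they are nonempty, which is what \<open>fgp_module_representative\<close> provides; a common
  member then links both modules.\<close>

lemma iso_class_eq_iff:
  fixes R :: "('a, 'c) ring_scheme"
  assumes M: "fgp_module R M" and N: "fgp_module R N"
  shows "iso_class R M = iso_class R N \<longleftrightarrow> isomorphic_modules R M N"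
proof
  assume eq: "iso_class R M = iso_class R N"
  obtain P where P: "P \<in> iso_class R M" using iso_class_nonempty[OF M] by blast
  then have P: "fgp_module R P" "isomorphic_modules R M P" "isomorphic_modules R N P"
    using eq by (auto simp: iso_class_def)
  show "isomorphic_modules R M N"
    by (rule isomorphic_modules_trans[OF P(2) isomorphic_modules_sym[OF P(3)]])
      (intro fgp_left_module N P)+
next
  assume "isomorphic_modules R M N"
  moreover from this have "isomorphic_modules R N M"
    by (rule isomorphic_modules_sym[OF _ fgp_left_module[OF M] fgp_left_module[OF N]])
  ultimately have "isomorphic_modules R M P \<longleftrightarrow> isomorphic_modules R N P"
    for P :: "('a, nat \<Rightarrow> 'a) module"
    using isomorphic_modules_trans[of R M N P] isomorphic_modules_trans[of R N M P] by blast
  then show "iso_class R M = iso_class R N" by (simp add: iso_class_def)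
qed

lemma iso_class_closed: "fgp_module R M \<Longrightarrow> iso_class R M \<in> fgp_classes R"
proof -
  assume M: "fgp_module R M"
  then obtain P where P: "P \<in> iso_class R M" using iso_class_nonempty by blast
  then have "fgp_module R P" "isomorphic_modules R M P" by (auto simp: iso_class_def)
  then show ?thesis using iso_class_eq_iff[OF M] unfolding fgp_classes_def by blast
qed

lemma fgp_classesE:
  assumes "c \<in> fgp_classes R"
  obtains P :: "('a, nat \<Rightarrow> 'a) module" where "fgp_module R P" "c = iso_class R P"
  using assms by (auto simp: fgp_classes_def)

text \<open>Functions on classes have to go back to a module of the fixed element type, since a
  direct sum of two such modules lives on pairs.\<close>

definition class_rep :: "('a, nat \<Rightarrow> 'a) module set \<Rightarrow> ('a, nat \<Rightarrow> 'a) module"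
  where "class_rep c = (SOME M. M \<in> c)"

lemma class_rep:
  assumes "fgp_module R M"
  shows "fgp_module R (class_rep (iso_class R M))" "isomorphic_modules R M (class_rep (iso_class R M))"
proof -
  have "class_rep (iso_class R M) \<in> iso_class R M"
    unfolding class_rep_def using iso_class_nonempty[OF assms] by (simp add: some_in_eq)
  then show "fgp_module R (class_rep (iso_class R M))"
    "isomorphic_modules R M (class_rep (iso_class R M))"
    by (auto simp: iso_class_def)
qed

text \<open>The commutative monoid usually called V(R), whose group completion is K_0(R). Equality
  in the presented group \<open>K0 R\<close> is decided by computing in it.\<close>

definition class_monoid :: "('a, 'c) ring_scheme \<Rightarrow> ('a, nat \<Rightarrow> 'a) module set monoid"
  where "class_monoid R = \<lparr>carrier = fgp_classes R,
    monoid.mult = (\<lambda>c d. iso_class R (direct_sum (class_rep c) (class_rep d))),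
    one = iso_class R (row_module R 0)\<rparr>"

lemma class_monoid_mult:
  assumes "fgp_module R M" "fgp_module R N"
  shows "iso_class R M \<otimes>\<^bsub>class_monoid R\<^esub> iso_class R N = iso_class R (direct_sum M N)"
proof -
  have "isomorphic_modules R (direct_sum M N)
      (direct_sum (class_rep (iso_class R M)) (class_rep (iso_class R N)))"
    by (intro isomorphic_direct_sum_cong class_rep(2) assms)
  then show ?thesis
    using iso_class_eq_iff[OF fgp_direct_sum[OF assms]
        fgp_direct_sum[OF class_rep(1)[OF assms(1)] class_rep(1)[OF assms(2)]]]
    by (simp add: class_monoid_def)
qed

lemma isomorphic_direct_sum_row_0:
  assumes "left_module R M"
  shows "isomorphic_modules R (direct_sum M (row_module R 0)) M"
proof -
  interpret M: left_module R M by fact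
  show ?thesis
    by (rule isomorphic_direct_sum_trivial[OF assms left_module_row[OF M.R.ring_axioms]])
      (auto simp: power_module_iff)
qed

lemma comm_monoid_class_monoid:
  fixes R :: "('a, 'c) ring_scheme"
  assumes "ring R" shows "comm_monoid (class_monoid R)"
proof (rule comm_monoidI)
  have car: "carrier (class_monoid R) = fgp_classes R" by (simp add: class_monoid_def)
  have zero: "fgp_module R (row_module R 0)" by (rule fgp_row_module[OF assms])
  show "\<one>\<^bsub>class_monoid R\<^esub> \<in> carrier (class_monoid R)"
    using iso_class_closed[OF zero] by (simp add: class_monoid_def)
  fix c assume "c \<in> carrier (class_monoid R)"
  then have "c \<in> fgp_classes R" by (simp add: car)
  then obtain P :: "('a, nat \<Rightarrow> 'a) module" where P: "fgp_module R P" "c = iso_class R P" by (rule fgp_classesE)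
  have "isomorphic_modules R (direct_sum (row_module R 0) P) P"
    using isomorphic_direct_sum_commute isomorphic_direct_sum_row_0[OF fgp_left_module[OF P(1)]]
    by (rule isomorphic_modules_trans)
  then show "\<one>\<^bsub>class_monoid R\<^esub> \<otimes>\<^bsub>class_monoid R\<^esub> c = c"
    using class_monoid_mult[OF zero P(1)] iso_class_eq_iff[OF fgp_direct_sum[OF zero P(1)] P(1)] P(2)
    by (simp add: class_monoid_def)
  fix d assume "d \<in> carrier (class_monoid R)"
  then have "d \<in> fgp_classes R" by (simp add: car)
  then obtain Q :: "('a, nat \<Rightarrow> 'a) module" where Q: "fgp_module R Q" "d = iso_class R Q" by (rule fgp_classesE)
  show "c \<otimes>\<^bsub>class_monoid R\<^esub> d \<in> carrier (class_monoid R)"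
    unfolding P(2) Q(2) class_monoid_mult[OF P(1) Q(1)] car
    by (intro iso_class_closed fgp_direct_sum P Q)
  show "c \<otimes>\<^bsub>class_monoid R\<^esub> d = d \<otimes>\<^bsub>class_monoid R\<^esub> c"
    unfolding P(2) Q(2) class_monoid_mult[OF P(1) Q(1)] class_monoid_mult[OF Q(1) P(1)]
    using isomorphic_direct_sum_commute
    by (intro iso_class_eq_iff[THEN iffD2] fgp_direct_sum P Q)
  fix e assume "e \<in> carrier (class_monoid R)"
  then have "e \<in> fgp_classes R" by (simp add: car)
  then obtain T :: "('a, nat \<Rightarrow> 'a) module" where T: "fgp_module R T" "e = iso_class R T" by (rule fgp_classesE)
  show "c \<otimes>\<^bsub>class_monoid R\<^esub> d \<otimes>\<^bsub>class_monoid R\<^esub> e = c \<otimes>\<^bsub>class_monoid R\<^esub> (d \<otimes>\<^bsub>class_monoid R\<^esub> e)"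
    unfolding P(2) Q(2) T(2) class_monoid_mult[OF P(1) Q(1)] class_monoid_mult[OF Q(1) T(1)]
      class_monoid_mult[OF fgp_direct_sum[OF P(1) Q(1)] T(1)]
      class_monoid_mult[OF P(1) fgp_direct_sum[OF Q(1) T(1)]]
    using isomorphic_direct_sum_assoc
    by (intro iso_class_eq_iff[THEN iffD2] fgp_direct_sum P Q T)
qed

lemma (in comm_monoid) foldr_mult_append:
  assumes "set as \<subseteq> carrier G" "set bs \<subseteq> carrier G"
  shows "foldr (\<otimes>) (as @ bs) \<one> = foldr (\<otimes>) as \<one> \<otimes> foldr (\<otimes>) bs \<one>"
  using assms by (induction as) (auto simp: m_assoc)

text \<open>The coefficient of a generator in the formal sum is its multiplicity in the list. An
  identity in the free group thus turns into an identity of products in any commutative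
  monoid.\<close>

lemma sum_list_frag_eq_imp_mset_eq:
  assumes "sum_list (map frag_of as) = sum_list (map frag_of bs)"
  shows "mset as = mset bs"
proof (rule multiset_eqI)
  have count: "Poly_Mapping.lookup (sum_list (map frag_of cs)) c = int (count (mset cs) c)" for cs c
    by (induction cs) (auto simp: lookup_add)
  show "count (mset as) c = count (mset bs) c" for c
    using count[of as c] count[of bs c] assms by simp
qed

section \<open>The group K_0: universal property and equality of classes\<close>

context
  fixes R :: "('a, 'c) ring_scheme"
  assumes R: "ring R"
begin

interpretation class_monoid: comm_monoid "class_monoid R" by (rule comm_monoid_class_monoid[OF R])

abbreviation (input) "class_group \<equiv> free_Abelian_group (fgp_classes R)"

abbreviation (input) "split_relations \<equiv>
  {frag_of (iso_class R (direct_sum P Q)) - frag_of (iso_class R P) - frag_of (iso_class R Q)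
    |(P :: ('a, nat \<Rightarrow> 'a) module) (Q :: ('a, nat \<Rightarrow> 'a) module). fgp_module R P \<and> fgp_module R Q}"

lemma split_relations_closed: "split_relations \<subseteq> carrier class_group"
proof -
  have diff: "x - y \<in> carrier class_group" if "x \<in> carrier class_group" "y \<in> carrier class_group" for x y
    using that keys_diff[of x y] by auto
  have "frag_of (iso_class R (direct_sum P Q)) - frag_of (iso_class R P) - frag_of (iso_class R Q)
      \<in> carrier class_group"
    if "fgp_module R P" "fgp_module R Q" for P Q :: "('a, nat \<Rightarrow> 'a) module"
    using that
    by (intro diff frag_of_in_free_Abelian_group[THEN iffD2] iso_class_closed fgp_direct_sum)
  then show ?thesis by blast
qed

lemmas K0_quotient =
  free_quotient_comm_group[OF split_relations_closed, folded K0_relations_def, folded K0_def]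
  free_quotient_add[OF split_relations_closed, folded K0_relations_def, folded K0_def]
  free_quotient_eqI[OF split_relations_closed, folded K0_relations_def]
  free_quotient_carrier[OF split_relations_closed, folded K0_relations_def, folded K0_def]
  free_quotient_one[OF split_relations_closed, folded K0_relations_def, folded K0_def]
  relation_subgroup[OF split_relations_closed, folded K0_relations_def]

lemma comm_group_K0: "comm_group (K0 R)"
  by (rule K0_quotient(1))

interpretation K0: comm_group "K0 R" by (rule comm_group_K0)

lemma K0_class_closed: "fgp_module R M \<Longrightarrow> K0_class R M \<in> carrier (K0 R)"
  unfolding K0_class_def K0_quotient(4)
  by (rule bexI[of _ "frag_of (iso_class R M)"]) (simp_all add: iso_class_closed)

lemma K0_class_cong:
  assumes "isomorphic_modules R M N" "fgp_module R M" "fgp_module R N"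
  shows "K0_class R M = K0_class R N"
  using iso_class_eq_iff[OF assms(2,3)] assms(1) by (simp add: K0_class_def)

lemma fgp_representative:
  assumes "fgp_module R M"
  obtains P :: "('a, nat \<Rightarrow> 'a) module" where "fgp_module R P" "isomorphic_modules R M P"
    "K0_class R M = K0_class R P"
  using class_rep[OF assms] K0_class_cong[OF class_rep(2)[OF assms] assms class_rep(1)[OF assms]]
  by (rule that)

text \<open>The defining relations only speak of modules on sequences, so \<open>M\<close> and
  \<open>N\<close> are first replaced by isomorphic representatives.\<close>

lemma K0_class_direct_sum:
  assumes "fgp_module R M" "fgp_module R N"
  shows "K0_class R (direct_sum M N) = K0_class R M \<otimes>\<^bsub>K0 R\<^esub> K0_class R N"
proof -
  obtain P :: "('a, nat \<Rightarrow> 'a) module" where P: "fgp_module R P" "isomorphic_modules R M P"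
    "K0_class R M = K0_class R P" using fgp_representative[OF assms(1)] .
  obtain Q :: "('a, nat \<Rightarrow> 'a) module" where Q: "fgp_module R Q" "isomorphic_modules R N Q"
    "K0_class R N = K0_class R Q" using fgp_representative[OF assms(2)] .
  have c: "frag_of (iso_class R (direct_sum P Q)) \<in> carrier class_group"
    "frag_of (iso_class R P) \<in> carrier class_group" "frag_of (iso_class R Q) \<in> carrier class_group"
    using P(1) Q(1) by (auto intro: iso_class_closed fgp_direct_sum)
  have "K0_class R (direct_sum M N) = K0_class R (direct_sum P Q)"
    by (intro K0_class_cong isomorphic_direct_sum_cong fgp_direct_sum assms P Q)
  also have "\<dots> = K0_relations R #>\<^bsub>class_group\<^esub> (frag_of (iso_class R P) + frag_of (iso_class R Q))"
    unfolding K0_class_def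
  proof (rule K0_quotient(3)[OF c(1)])
    show "frag_of (iso_class R P) + frag_of (iso_class R Q) \<in> carrier class_group"
      using c(2,3) keys_add[of "frag_of (iso_class R P)" "frag_of (iso_class R Q)"] by auto
    show "frag_of (iso_class R (direct_sum P Q)) - (frag_of (iso_class R P) + frag_of (iso_class R Q))
        \<in> K0_relations R"
      unfolding K0_relations_def using P(1) Q(1)
      by (intro generate.incl) (auto simp: diff_diff_eq)
  qed
  also have "\<dots> = K0_class R P \<otimes>\<^bsub>K0 R\<^esub> K0_class R Q"
    unfolding K0_class_def by (rule K0_quotient(2)[OF c(2,3), symmetric])
  finally show ?thesis using P(3) Q(3) by simp
qed

lemma K0_class_trivial:
  assumes "left_module R M" "carrier M = {\<zero>\<^bsub>M\<^esub>}"
  shows "fgp_module R M" "K0_class R M = \<one>\<^bsub>K0 R\<^esub>"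
proof -
  interpret M: left_module R M by fact
  have "isomorphic_modules R M (row_module R 0)"
    using assms(2)
    by (intro isomorphic_modulesI[of "\<lambda>x. (\<lambda>i. \<zero>\<^bsub>R\<^esub>)" _ _ _ "\<lambda>x. \<zero>\<^bsub>M\<^esub>"])
      (auto simp: mod_hom_def power_module_iff)
  then show fgp: "fgp_module R M"
    by (intro fgp_moduleI[OF assms(1)] isomorphic_imp_retract assms(1) left_module_row R)
  \<comment> \<open>A trivial \<open>M\<close> absorbs itself, so its class is an idempotent of a
    group and hence the identity.\<close>
  have "K0_class R (direct_sum M M) = K0_class R M"
    by (rule K0_class_cong[OF isomorphic_direct_sum_trivial[OF assms(1,1,2)] fgp_direct_sum[OF fgp fgp] fgp])
  then have "K0_class R M \<otimes>\<^bsub>K0 R\<^esub> K0_class R M = K0_class R M"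
    using K0_class_direct_sum[OF fgp fgp] by simp
  then show "K0_class R M = \<one>\<^bsub>K0 R\<^esub>" using K0_class_closed[OF fgp] by simp
qed

text \<open>The function \<open>f\<close> accepts only modules on sequences, whereas
  \<open>direct_sum P Q\<close> lives on pairs. Additivity is therefore stated for any
  \<open>N\<close> isomorphic to the sum.\<close>

lemma K0_universal:
  fixes f :: "('a, nat \<Rightarrow> 'a) module \<Rightarrow> 'h"
  assumes H: "comm_group H" and f: "\<And>P. fgp_module R P \<Longrightarrow> f P \<in> carrier H"
    and iso: "\<And>P Q. fgp_module R P \<Longrightarrow> fgp_module R Q \<Longrightarrow> isomorphic_modules R P Q \<Longrightarrow> f P = f Q"
    and sum: "\<And>P Q N. fgp_module R P \<Longrightarrow> fgp_module R Q \<Longrightarrow> fgp_module R N \<Longrightarrow>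
      isomorphic_modules R (direct_sum P Q) N \<Longrightarrow> f N = f P \<otimes>\<^bsub>H\<^esub> f Q"
  shows "\<exists>h\<in>hom (K0 R) H. \<forall>P. fgp_module R P \<longrightarrow> h (K0_class R P) = f P"
proof (rule free_quotient_universal[OF split_relations_closed H, of "\<lambda>c. f (class_rep c)",
      folded K0_relations_def, folded K0_def])
  have g: "f (class_rep (iso_class R P)) = f P" if "fgp_module R P" for P :: "('a, nat \<Rightarrow> 'a) module"
    using iso[OF that class_rep(1)[OF that] class_rep(2)[OF that]] by simp
  show "(\<lambda>c. f (class_rep c)) \<in> fgp_classes R \<rightarrow> carrier H"
    using g f by (auto elim!: fgp_classesE)
  show "h x = \<one>\<^bsub>H\<^esub>" if h: "h \<in> hom class_group H"
    "\<And>c. c \<in> fgp_classes R \<Longrightarrow> h (frag_of c) = f (class_rep c)" and x: "x \<in> split_relations" for h x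
  proof -
    interpret H: comm_group H by fact
    interpret h: group_hom class_group H h
      using h(1) H.group_axioms by (simp add: group_hom_def group_hom_axioms_def)
    obtain P Q :: "('a, nat \<Rightarrow> 'a) module" where PQ: "fgp_module R P" "fgp_module R Q" and
      x: "x = frag_of (iso_class R (direct_sum P Q)) - frag_of (iso_class R P) - frag_of (iso_class R Q)"
      using x by blast
    note D = fgp_direct_sum[OF PQ]
    let ?D = "iso_class R (direct_sum P Q)"
    have hD: "h (frag_of ?D) = f P \<otimes>\<^bsub>H\<^esub> f Q"
      using h(2)[OF iso_class_closed[OF D]] sum[OF PQ class_rep(1)[OF D] class_rep(2)[OF D]] by simp
    have hPQ: "h (frag_of (iso_class R P)) = f P" "h (frag_of (iso_class R Q)) = f Q"
      using h(2)[OF iso_class_closed[OF PQ(1)]] h(2)[OF iso_class_closed[OF PQ(2)]] PQ g by simp_all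
    have c: "x \<in> carrier class_group" using split_relations_closed \<open>x \<in> split_relations\<close> by blast
    have cP: "frag_of (iso_class R P) \<in> carrier class_group" "frag_of (iso_class R Q) \<in> carrier class_group"
      using iso_class_closed PQ by auto
    have cPQ: "frag_of (iso_class R P) + frag_of (iso_class R Q) \<in> carrier class_group"
      using h.G.m_closed[OF cP] by simp
    have "frag_of ?D = x + (frag_of (iso_class R P) + frag_of (iso_class R Q))"
      using x by simp
    then have "h (frag_of ?D) = h x \<otimes>\<^bsub>H\<^esub> (h (frag_of (iso_class R P)) \<otimes>\<^bsub>H\<^esub> h (frag_of (iso_class R Q)))"
      using h.hom_mult[OF c cPQ] h.hom_mult[OF cP] by simp
    then show ?thesis
      using hD hPQ f[OF PQ(1)] f[OF PQ(2)] h.hom_closed[OF c] H.r_cancel_one[of "f P \<otimes>\<^bsub>H\<^esub> f Q" "h x"]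
      by simp
  qed
next
  fix h assume h: "h \<in> hom (K0 R) H"
    "\<And>c. c \<in> fgp_classes R \<Longrightarrow> h (K0_relations R #>\<^bsub>class_group\<^esub> frag_of c) = f (class_rep c)"
  have "h (K0_class R P) = f P" if "fgp_module R P" for P :: "('a, nat \<Rightarrow> 'a) module"
    using h(2)[OF iso_class_closed[OF that]] iso[OF that class_rep(1)[OF that] class_rep(2)[OF that]]
    by (simp add: K0_class_def)
  then show ?thesis using h(1) by blast
qed

lemma K0_elim:
  assumes "x \<in> carrier (K0 R)"
  obtains P Q :: "('a, nat \<Rightarrow> 'a) module" where "fgp_module R P" "fgp_module R Q"
    "x = K0_class R P \<otimes>\<^bsub>K0 R\<^esub> inv\<^bsub>K0 R\<^esub> K0_class R Q"
proof -
  let ?E = "\<lambda>x. \<exists>(P :: ('a, nat \<Rightarrow> 'a) module) (Q :: ('a, nat \<Rightarrow> 'a) module). fgp_module R P \<and> fgp_module R Q \<and>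
    x = K0_class R P \<otimes>\<^bsub>K0 R\<^esub> inv\<^bsub>K0 R\<^esub> K0_class R Q"
  have "carrier (row_module R 0) = {\<zero>\<^bsub>row_module R 0\<^esub>}"
    using ring.ring_simprules(2)[OF R] by (auto simp: power_module_iff)
  note zero = K0_class_trivial[OF left_module_row[OF R] this]
  have "?E x"
  proof (rule free_quotient_induct[OF split_relations_closed, of x ?E, folded K0_relations_def, folded K0_def])
    show "x \<in> carrier (K0 R)" by fact
    show "?E (K0_relations R #>\<^bsub>class_group\<^esub> 0)"
      unfolding K0_quotient(5) using zero by (intro exI[of _ "row_module R 0"]) simp
    show "?E (K0_relations R #>\<^bsub>class_group\<^esub> frag_of c)" if "c \<in> fgp_classes R" for c
    proof -
      obtain P :: "('a, nat \<Rightarrow> 'a) module" where P: "fgp_module R P" "c = iso_class R P" using \<open>c \<in> fgp_classes R\<close> by (rule fgp_classesE)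
      have "K0_relations R #>\<^bsub>class_group\<^esub> frag_of c = K0_class R P" by (simp add: K0_class_def P(2))
      also have "\<dots> = K0_class R P \<otimes>\<^bsub>K0 R\<^esub> inv\<^bsub>K0 R\<^esub> K0_class R (row_module R 0)"
        using zero(2) K0_class_closed[OF P(1)] by simp
      finally show ?thesis using P(1) zero(1) by blast
    qed
    show "?E (C \<otimes>\<^bsub>K0 R\<^esub> inv\<^bsub>K0 R\<^esub> D)"
      if "C \<in> carrier (K0 R)" "D \<in> carrier (K0 R)" "?E C" "?E D" for C D
    proof -
      obtain P Q :: "('a, nat \<Rightarrow> 'a) module" where PQ: "fgp_module R P" "fgp_module R Q"
        "C = K0_class R P \<otimes>\<^bsub>K0 R\<^esub> inv\<^bsub>K0 R\<^esub> K0_class R Q" using \<open>?E C\<close> by (elim exE conjE)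
      obtain P' Q' :: "('a, nat \<Rightarrow> 'a) module" where PQ': "fgp_module R P'" "fgp_module R Q'"
        "D = K0_class R P' \<otimes>\<^bsub>K0 R\<^esub> inv\<^bsub>K0 R\<^esub> K0_class R Q'" using \<open>?E D\<close> by (elim exE conjE)
      obtain M :: "('a, nat \<Rightarrow> 'a) module" where M: "fgp_module R M"
        "isomorphic_modules R (direct_sum P Q') M" "K0_class R (direct_sum P Q') = K0_class R M"
        using fgp_representative[OF fgp_direct_sum[OF PQ(1) PQ'(2)]] .
      obtain N :: "('a, nat \<Rightarrow> 'a) module" where N: "fgp_module R N"
        "isomorphic_modules R (direct_sum Q P') N" "K0_class R (direct_sum Q P') = K0_class R N"
        using fgp_representative[OF fgp_direct_sum[OF PQ(2) PQ'(1)]] .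
      have c: "K0_class R P \<in> carrier (K0 R)" "K0_class R Q \<in> carrier (K0 R)"
        "K0_class R P' \<in> carrier (K0 R)" "K0_class R Q' \<in> carrier (K0 R)"
        using PQ PQ' by (auto intro: K0_class_closed)
      have "C \<otimes>\<^bsub>K0 R\<^esub> inv\<^bsub>K0 R\<^esub> D = (K0_class R P \<otimes>\<^bsub>K0 R\<^esub> K0_class R Q') \<otimes>\<^bsub>K0 R\<^esub>
          inv\<^bsub>K0 R\<^esub> (K0_class R Q \<otimes>\<^bsub>K0 R\<^esub> K0_class R P')"
        unfolding PQ(3) PQ'(3) using c by (simp add: K0.inv_mult K0.m_ac)
      also have "\<dots> = K0_class R M \<otimes>\<^bsub>K0 R\<^esub> inv\<^bsub>K0 R\<^esub> K0_class R N"
        using M(3) N(3) K0_class_direct_sum[OF PQ(1) PQ'(2)] K0_class_direct_sum[OF PQ(2) PQ'(1)] by simp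
      finally show ?thesis using M(1) N(1) by (intro exI conjI)
    qed
  qed
  then show ?thesis using that by (elim exE conjE)
qed

text \<open>The usual criterion for equality in a group completion, extracted here from the
  presentation by generators and relations: equal classes mean isomorphic after adding a common
  module.\<close>

lemma K0_class_eqD:
  fixes M :: "('a, 'm) module" and N :: "('a, 'n) module"
  assumes M: "fgp_module R M" and N: "fgp_module R N" and eq: "K0_class R M = K0_class R N"
  obtains P :: "('a, nat \<Rightarrow> 'a) module" where "fgp_module R P"
    "isomorphic_modules R (direct_sum M P) (direct_sum N P)"
proof -
  let ?V = "class_monoid R"
  let ?prod = "\<lambda>as. foldr (\<otimes>\<^bsub>?V\<^esub>) as \<one>\<^bsub>?V\<^esub>"
  have car: "carrier ?V = fgp_classes R" by (simp add: class_monoid_def)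
  \<comment> \<open>The invariant of the relation subgroup: a formal difference of two lists whose
    products in \<open>class_monoid\<close> agree up to a common factor \<open>k\<close>. The monoid
    need not be cancellative, so factors are never removed but multiply up when relations are added;
    inverting a generating relation exchanges the two lists.\<close>
  define Z where "Z x \<longleftrightarrow> (\<exists>as bs. set as \<subseteq> carrier ?V \<and> set bs \<subseteq> carrier ?V \<and>
    x = sum_list (map frag_of as) - sum_list (map frag_of bs) \<and>
    (\<exists>k\<in>carrier ?V. ?prod as \<otimes>\<^bsub>?V\<^esub> k = ?prod bs \<otimes>\<^bsub>?V\<^esub> k))" for x
  have Z: "Z x" if "x \<in> K0_relations R" for x
    using that unfolding K0_relations_def
  proof (induction rule: generate.induct)
    case one
    show ?case unfolding Z_def by (intro exI[of _ "[]"]) auto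
  next
    case (incl x)
    then obtain P Q :: "('a, nat \<Rightarrow> 'a) module" where PQ: "fgp_module R P" "fgp_module R Q" and
      x: "x = frag_of (iso_class R (direct_sum P Q)) - frag_of (iso_class R P) - frag_of (iso_class R Q)"
      by blast
    have "iso_class R (direct_sum P Q) \<in> carrier ?V" "iso_class R P \<in> carrier ?V" "iso_class R Q \<in> carrier ?V"
      unfolding car by (intro iso_class_closed fgp_direct_sum PQ)+
    then show ?case
      unfolding Z_def
      by (intro exI[of _ "[iso_class R (direct_sum P Q)]"] exI[of _ "[iso_class R P, iso_class R Q]"]
          conjI bexI[of _ "\<one>\<^bsub>?V\<^esub>"])
        (auto simp: x class_monoid_mult[OF PQ])
  next
    case (inv x)
    then obtain P Q :: "('a, nat \<Rightarrow> 'a) module" where PQ: "fgp_module R P" "fgp_module R Q" and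
      x: "x = frag_of (iso_class R (direct_sum P Q)) - frag_of (iso_class R P) - frag_of (iso_class R Q)"
      by blast
    have "iso_class R (direct_sum P Q) \<in> carrier ?V" "iso_class R P \<in> carrier ?V" "iso_class R Q \<in> carrier ?V"
      unfolding car by (intro iso_class_closed fgp_direct_sum PQ)+
    moreover have "inv\<^bsub>class_group\<^esub> x = - x"
      using subsetD[OF split_relations_closed inv] by simp
    ultimately show ?case
      unfolding Z_def
      by (intro exI[of _ "[iso_class R P, iso_class R Q]"] exI[of _ "[iso_class R (direct_sum P Q)]"]
          conjI bexI[of _ "\<one>\<^bsub>?V\<^esub>"])
        (auto simp: x class_monoid_mult[OF PQ])
  next
    case (eng x y)
    obtain as bs k where a: "set as \<subseteq> carrier ?V" "set bs \<subseteq> carrier ?V" "k \<in> carrier ?V"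
      "x = sum_list (map frag_of as) - sum_list (map frag_of bs)" "?prod as \<otimes>\<^bsub>?V\<^esub> k = ?prod bs \<otimes>\<^bsub>?V\<^esub> k"
      using eng(3) unfolding Z_def by (elim exE conjE bexE)
    obtain cs ds l where c: "set cs \<subseteq> carrier ?V" "set ds \<subseteq> carrier ?V" "l \<in> carrier ?V"
      "y = sum_list (map frag_of cs) - sum_list (map frag_of ds)" "?prod cs \<otimes>\<^bsub>?V\<^esub> l = ?prod ds \<otimes>\<^bsub>?V\<^esub> l"
      using eng(4) unfolding Z_def by (elim exE conjE bexE)
    have p: "?prod as \<in> carrier ?V" "?prod bs \<in> carrier ?V" "?prod cs \<in> carrier ?V" "?prod ds \<in> carrier ?V"
      using a c class_monoid.multlist_closed by auto
    have "?prod (as @ cs) \<otimes>\<^bsub>?V\<^esub> (k \<otimes>\<^bsub>?V\<^esub> l) = (?prod as \<otimes>\<^bsub>?V\<^esub> k) \<otimes>\<^bsub>?V\<^esub> (?prod cs \<otimes>\<^bsub>?V\<^esub> l)"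
      unfolding class_monoid.foldr_mult_append[OF a(1) c(1)]
      using p a(3) c(3) by (simp add: class_monoid.m_ac)
    also have "\<dots> = ?prod (bs @ ds) \<otimes>\<^bsub>?V\<^esub> (k \<otimes>\<^bsub>?V\<^esub> l)"
      unfolding a(5) c(5) class_monoid.foldr_mult_append[OF a(2) c(2)]
      using p a(3) c(3) by (simp add: class_monoid.m_ac)
    finally have "?prod (as @ cs) \<otimes>\<^bsub>?V\<^esub> (k \<otimes>\<^bsub>?V\<^esub> l) = ?prod (bs @ ds) \<otimes>\<^bsub>?V\<^esub> (k \<otimes>\<^bsub>?V\<^esub> l)" .
    then show ?case
      unfolding Z_def using a c
      by (intro exI[of _ "as @ cs"] exI[of _ "bs @ ds"] conjI bexI[of _ "k \<otimes>\<^bsub>?V\<^esub> l"]) auto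
  qed
  have cl: "frag_of (iso_class R M) \<in> carrier class_group" "frag_of (iso_class R N) \<in> carrier class_group"
    using iso_class_closed M N by auto
  have "frag_of (iso_class R M) \<in> K0_relations R #>\<^bsub>class_group\<^esub> frag_of (iso_class R N)"
    using group.rcos_self[OF group_free_Abelian_group cl(1) K0_quotient(6)] eq
    by (simp add: K0_class_def)
  then obtain r where r: "r \<in> K0_relations R" "frag_of (iso_class R M) = r + frag_of (iso_class R N)"
    by (auto simp: r_coset_def)
  obtain as bs k where a: "set as \<subseteq> carrier ?V" "set bs \<subseteq> carrier ?V" "k \<in> carrier ?V"
    "r = sum_list (map frag_of as) - sum_list (map frag_of bs)" "?prod as \<otimes>\<^bsub>?V\<^esub> k = ?prod bs \<otimes>\<^bsub>?V\<^esub> k"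
    using Z[OF r(1)] unfolding Z_def by (elim exE conjE bexE)
  let ?m = "iso_class R M" and ?n = "iso_class R N"
  have mn: "?m \<in> carrier ?V" "?n \<in> carrier ?V" using iso_class_closed M N by (auto simp: car)
  \<comment> \<open>Moving the negative part of \<open>r\<close> to the other side leaves two sums
    with positive coefficients, which can be compared as multisets.\<close>
  have "sum_list (map frag_of (?m # bs)) = sum_list (map frag_of (?n # as))"
    using r(2) a(4) by (simp add: algebra_simps)
  then have "mset (?m # bs) = mset (?n # as)" by (rule sum_list_frag_eq_imp_mset_eq)
  then have "?prod (?m # bs) = ?prod (?n # as)"
    using mn a by (intro class_monoid.multlist_perm_cong) auto
  then have 1: "?m \<otimes>\<^bsub>?V\<^esub> ?prod bs = ?n \<otimes>\<^bsub>?V\<^esub> ?prod as" by simp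
  have p: "?prod as \<in> carrier ?V" "?prod bs \<in> carrier ?V"
    using a class_monoid.multlist_closed by auto
  have "?m \<otimes>\<^bsub>?V\<^esub> (?prod bs \<otimes>\<^bsub>?V\<^esub> k) = ?n \<otimes>\<^bsub>?V\<^esub> (?prod as \<otimes>\<^bsub>?V\<^esub> k)"
    using 1 mn p a(3) by (simp add: class_monoid.m_assoc[symmetric])
  then have 2: "?m \<otimes>\<^bsub>?V\<^esub> (?prod bs \<otimes>\<^bsub>?V\<^esub> k) = ?n \<otimes>\<^bsub>?V\<^esub> (?prod bs \<otimes>\<^bsub>?V\<^esub> k)" using a(5) by simp
  have "?prod bs \<otimes>\<^bsub>?V\<^esub> k \<in> fgp_classes R" using p a(3) car by auto
  then obtain P :: "('a, nat \<Rightarrow> 'a) module" where P: "fgp_module R P" "?prod bs \<otimes>\<^bsub>?V\<^esub> k = iso_class R P" by (rule fgp_classesE)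
  have "iso_class R (direct_sum M P) = iso_class R (direct_sum N P)"
    using 2 unfolding P(2) class_monoid_mult[OF M P(1)] class_monoid_mult[OF N P(1)] .
  then have "isomorphic_modules R (direct_sum M P) (direct_sum N P)"
    using iso_class_eq_iff[OF fgp_direct_sum[OF M P(1)] fgp_direct_sum[OF N P(1)]] by simp
  then show ?thesis using P(1) that by blast
qed

end

text \<open>The condition \<open>power_retract\<close> makes tensoring with \<open>B\<close>
  preserve finitely generated projective modules. It holds whenever \<open>B\<close> is a summand of
  the left regular module; the instances are \<open>Re\<close> over R, S over itself, and R over
  itself with S acting on the right.\<close>

locale fgp_bimodule = bimodule S R B
  for S :: "('s, 'c) ring_scheme" and R :: "('r, 'd) ring_scheme" and B :: "('s, 'r, 'b) bimodule" +
  assumes power_retract: "retract S (power_module B n) (row_module S n)"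
begin

lemma tensor_product: "left_module R M \<Longrightarrow> tensor_product S R B M"
  by (intro tensor_product.intro bimodule_axioms)

lemma fgp_tensor:
  fixes M :: "('r, 'm) module"
  assumes "fgp_module R M" shows "fgp_module S (tensor R B M)"
proof -
  interpret M: tensor_product S R B M by (intro tensor_product fgp_left_module assms)
  obtain n where "retract R M (row_module R n)" using assms by (rule fgp_moduleE)
  then obtain s q where s: "s \<in> mod_hom R M (row_module R n)" "q \<in> mod_hom R (row_module R n) M"
    "\<forall>x\<in>carrier M. q (s x) = x" by (rule retractE)
  have "retract S (tensor R B M) (power_module B n)"
    by (rule M.tensor_retract[OF s(1,2)]) (rule bspec[OF s(3)])
  then show ?thesis
    by (intro fgp_moduleI[OF M.left_module_tensor] retract_trans[OF _ power_retract])
qed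

lemma K0_tensor_hom:
  "\<exists>\<phi>\<in>hom (K0 R) (K0 S). \<forall>P :: ('r, nat \<Rightarrow> 'r) module. fgp_module R P \<longrightarrow>
    \<phi> (K0_class R P) = K0_class S (tensor R B P)"
proof (rule K0_universal[OF ring_R comm_group_K0[OF B.R.ring_axioms]])
  fix P Q :: "('r, nat \<Rightarrow> 'r) module"
  assume P: "fgp_module R P"
  show "K0_class S (tensor R B P) \<in> carrier (K0 S)"
    by (intro K0_class_closed[OF B.R.ring_axioms] fgp_tensor P)
  assume Q: "fgp_module R Q"
  show "K0_class S (tensor R B P) = K0_class S (tensor R B Q)" if "isomorphic_modules R P Q"
    by (intro K0_class_cong[OF B.R.ring_axioms] tensor_isomorphic_cong tensor_product that
        fgp_tensor fgp_left_module P Q)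
  fix N :: "('r, nat \<Rightarrow> 'r) module"
  assume N: "fgp_module R N" and iso: "isomorphic_modules R (direct_sum P Q) N"
  have "K0_class S (tensor R B N) = K0_class S (tensor R B (direct_sum P Q))"
    by (intro K0_class_cong[OF B.R.ring_axioms] tensor_isomorphic_cong tensor_product
        isomorphic_modules_sym[OF iso] left_module_direct_sum fgp_tensor fgp_left_module N
        fgp_direct_sum P Q)
  also have "\<dots> = K0_class S (direct_sum (tensor R B P) (tensor R B Q))"
    by (intro K0_class_cong[OF B.R.ring_axioms] tensor_direct_sum tensor_product
        fgp_tensor fgp_left_module fgp_direct_sum P Q)
  also have "\<dots> = K0_class S (tensor R B P) \<otimes>\<^bsub>K0 S\<^esub> K0_class S (tensor R B Q)"
    by (intro K0_class_direct_sum[OF B.R.ring_axioms] fgp_tensor P Q)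
  finally show "K0_class S (tensor R B N) = K0_class S (tensor R B P) \<otimes>\<^bsub>K0 S\<^esub> K0_class S (tensor R B Q)" .
qed

text \<open>Tensor products have element types of their own, so composites of induced maps can only
  be evaluated once the formula holds for modules of arbitrary type.\<close>

lemma K0_tensor_hom_class:
  fixes M :: "('r, 'm) module"
  assumes \<phi>: "\<forall>P :: ('r, nat \<Rightarrow> 'r) module. fgp_module R P \<longrightarrow>
      \<phi> (K0_class R P) = K0_class S (tensor R B P)" and M: "fgp_module R M"
  shows "\<phi> (K0_class R M) = K0_class S (tensor R B M)"
proof -
  obtain P :: "('r, nat \<Rightarrow> 'r) module" where P: "fgp_module R P" "isomorphic_modules R M P"
    "K0_class R M = K0_class R P" using fgp_representative[OF ring_R M] .
  have "K0_class S (tensor R B M) = K0_class S (tensor R B P)"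
    by (intro K0_class_cong[OF B.R.ring_axioms] tensor_isomorphic_cong tensor_product P
        fgp_tensor fgp_left_module M)
  then show ?thesis using \<phi> P by simp
qed

end

section \<open>Modules generated by the image of an idempotent\<close>

lemma (in left_module) smult_r_minus:
  assumes "a \<in> carrier R" "x \<in> carrier M" shows "a \<odot>\<^bsub>M\<^esub> (\<ominus>\<^bsub>M\<^esub> x) = \<ominus>\<^bsub>M\<^esub> (a \<odot>\<^bsub>M\<^esub> x)"
proof -
  have "a \<odot>\<^bsub>M\<^esub> (\<ominus>\<^bsub>M\<^esub> x) \<oplus>\<^bsub>M\<^esub> a \<odot>\<^bsub>M\<^esub> x = \<zero>\<^bsub>M\<^esub>"
    using assms by (simp add: smult_r_distr[symmetric] M.l_neg smult_r_null)
  then show ?thesis using assms by (intro M.minus_equality[symmetric]) auto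
qed

lemma (in left_module) smult_l_minus:
  assumes "a \<in> carrier R" "x \<in> carrier M" shows "(\<ominus>\<^bsub>R\<^esub> a) \<odot>\<^bsub>M\<^esub> x = \<ominus>\<^bsub>M\<^esub> (a \<odot>\<^bsub>M\<^esub> x)"
proof -
  have "(\<ominus>\<^bsub>R\<^esub> a) \<odot>\<^bsub>M\<^esub> x \<oplus>\<^bsub>M\<^esub> a \<odot>\<^bsub>M\<^esub> x = \<zero>\<^bsub>M\<^esub>"
    using assms by (simp add: smult_l_distr[symmetric] R.l_neg smult_l_null)
  then show ?thesis using assms by (intro M.minus_equality[symmetric]) auto
qed

section \<open>The corner ring and \<open>Re\<close> as a bimodule\<close>

locale idempotent = ring R for R :: "('a, 'c) ring_scheme" (structure) +
  fixes e :: 'a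
  assumes e_closed [simp]: "e \<in> carrier R" and e_idem [simp]: "e \<otimes> e = e"
begin

abbreviation (input) "C \<equiv> corner_ring R e"

abbreviation (input) "Be \<equiv> corner_bimodule R e"

abbreviation (input) "Z \<equiv> power_module (corner_bimodule R e)"

lemma e_idem_left [simp]: "x \<in> carrier R \<Longrightarrow> e \<otimes> (e \<otimes> x) = e \<otimes> x"
  by (simp add: m_assoc[symmetric])

lemma corner_simps [simp]:
  "x \<oplus>\<^bsub>C\<^esub> y = x \<oplus> y" "x \<otimes>\<^bsub>C\<^esub> y = x \<otimes> y" "\<zero>\<^bsub>C\<^esub> = \<zero>" "\<one>\<^bsub>C\<^esub> = e"
  by (simp_all add: corner_ring_def)

lemma corner_iff: "x \<in> carrier C \<longleftrightarrow> x \<in> carrier R \<and> e \<otimes> x = x \<and> x \<otimes> e = x"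
proof
  show "x \<in> carrier C \<Longrightarrow> x \<in> carrier R \<and> e \<otimes> x = x \<and> x \<otimes> e = x"
    by (auto simp: corner_ring_def m_assoc)
  assume "x \<in> carrier R \<and> e \<otimes> x = x \<and> x \<otimes> e = x"
  then show "x \<in> carrier C" by (auto simp: corner_ring_def intro!: exI[of _ x])
qed

lemma ring_corner: "ring C"
proof (rule ringI)
  show "abelian_group C"
    by (rule abelian_groupI)
      (auto simp: corner_iff a_ac l_distr r_distr l_minus r_minus r_neg intro!: bexI[of _ "\<ominus> _"])
  show "monoid C"
    by (rule monoidI) (auto simp: corner_iff m_assoc, simp add: m_assoc[symmetric])
qed (auto simp: corner_iff l_distr r_distr)

lemma Be_simps [simp]:
  "x \<oplus>\<^bsub>Be\<^esub> y = x \<oplus> y" "\<zero>\<^bsub>Be\<^esub> = \<zero>" "a \<odot>\<^bsub>Be\<^esub> x = a \<otimes> x" "rsmult Be x a = x \<otimes> a"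
  by (simp_all add: corner_bimodule_def)

lemma Be_iff: "x \<in> carrier Be \<longleftrightarrow> x \<in> carrier R \<and> x \<otimes> e = x"
proof
  show "x \<in> carrier Be \<Longrightarrow> x \<in> carrier R \<and> x \<otimes> e = x"
    by (auto simp: corner_bimodule_def m_assoc)
  assume "x \<in> carrier R \<and> x \<otimes> e = x"
  then show "x \<in> carrier Be" by (auto simp: corner_bimodule_def intro!: exI[of _ x])
qed

lemma left_module_Be: "left_module R Be"
proof -
  have "abelian_group Be"
    by (rule abelian_groupI)
      (auto simp: Be_iff a_ac l_distr l_minus r_neg intro!: bexI[of _ "\<ominus> _"])
  then show ?thesis
    by (intro left_module.intro left_module_axioms.intro ring_axioms)
      (auto simp: Be_iff l_distr r_distr m_assoc)
qed

lemma left_module_Z: "left_module R (Z n)"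
  by (rule left_module_power[OF left_module_Be])

lemma Z_iff: "u \<in> carrier (Z n) \<longleftrightarrow> (\<forall>i. u i \<in> carrier R \<and> u i \<otimes> e = u i) \<and> (\<forall>i\<ge>n. u i = \<zero>)"
  by (simp add: power_module_iff Be_iff)

lemma retract_Z: "retract R (Z n) (row_module R n)"
  by (rule retractI[of "\<lambda>u. u" _ _ _ "\<lambda>u i. u i \<otimes> e"])
    (auto simp: mod_hom_def power_module_iff Be_iff l_distr m_assoc)

sublocale Be: fgp_bimodule R C Be
  by (intro fgp_bimodule.intro bimodule.intro fgp_bimodule_axioms.intro left_module_Be ring_corner
      retract_Z) (auto simp: Be_iff corner_iff l_distr r_distr m_assoc)

text \<open>The identity of the corner ring is \<open>e\<close>, so \<open>unit_row C i\<close> is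
  the unit row multiplied by \<open>e\<close>, an element of (Re)^n. The expansion is the one for
  R^n, transported along right multiplication by \<open>e\<close>, which fixes (Re)^n.\<close>

lemma Z_hom_expand:
  assumes Y: "left_module R Y" and q: "q \<in> mod_hom R (Z n) Y" and u: "u \<in> carrier (Z n)"
  shows "q u = row_comb Y n (\<lambda>i. q (unit_row C i)) u"
proof -
  have "(\<lambda>u i. u i \<otimes> e) \<in> mod_hom R (row_module R n) (Z n)"
    by (auto simp: mod_hom_def power_module_iff Be_iff l_distr m_assoc)
  then have h: "(\<lambda>u. q (\<lambda>i. u i \<otimes> e)) \<in> mod_hom R (row_module R n) Y"
    using q by (rule mod_hom_comp)
  have "u \<in> carrier (row_module R n)" using u by (simp add: power_module_iff Be_iff)
  from mod_hom_row_module[OF Y h this]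
  have "q (\<lambda>i. u i \<otimes> e) = row_comb Y n (\<lambda>i. q (\<lambda>j. unit_row R i j \<otimes> e)) u" .
  moreover have "(\<lambda>j. unit_row R i j \<otimes> e) = unit_row C i" for i by (auto simp: fun_eq_iff)
  moreover have "(\<lambda>i. u i \<otimes> e) = u" using u by (simp add: Z_iff)
  ultimately show ?thesis by simp
qed

text \<open>This is the submodule (ReR)Y; the right factor of an element
  \<open>r \<otimes> e \<otimes> s\<close> of the ideal is absorbed into \<open>y\<close>.\<close>

definition ideal_span :: "('a, 'm) module \<Rightarrow> 'm set"
  where "ideal_span Y = generate (add_monoid Y) {(r \<otimes> e) \<odot>\<^bsub>Y\<^esub> y |r y. r \<in> carrier R \<and> y \<in> carrier Y}"

context
  fixes Y :: "('a, 'm) module"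
  assumes Y: "left_module R Y"
begin

interpretation Y: left_module R Y by (fact Y)

lemma ideal_span_zero: "\<zero>\<^bsub>Y\<^esub> \<in> ideal_span Y"
  using generate.one[of "add_monoid Y"] by (simp add: ideal_span_def)

lemma ideal_span_add: "x \<in> ideal_span Y \<Longrightarrow> y \<in> ideal_span Y \<Longrightarrow> x \<oplus>\<^bsub>Y\<^esub> y \<in> ideal_span Y"
  using generate.eng[of _ "add_monoid Y"] by (simp add: ideal_span_def)

lemma ideal_span_gen: "r \<in> carrier R \<Longrightarrow> y \<in> carrier Y \<Longrightarrow> (r \<otimes> e) \<odot>\<^bsub>Y\<^esub> y \<in> ideal_span Y"
  unfolding ideal_span_def by (intro generate.incl) blast

text \<open>Inverses give no case of their own: the negative of a generator is the generator with
  \<open>\<ominus> r\<close> in place of \<open>r\<close>.\<close>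

lemma ideal_span_induct [consumes 1, case_names zero gen add]:
  assumes "x \<in> ideal_span Y" "P \<zero>\<^bsub>Y\<^esub>"
    "\<And>r y. r \<in> carrier R \<Longrightarrow> y \<in> carrier Y \<Longrightarrow> P ((r \<otimes> e) \<odot>\<^bsub>Y\<^esub> y)"
    "\<And>x y. P x \<Longrightarrow> P y \<Longrightarrow> P (x \<oplus>\<^bsub>Y\<^esub> y)"
  shows "P x"
  using assms(1) unfolding ideal_span_def
proof (induction rule: generate.induct)
  case (inv x)
  then obtain r y where x: "x = (r \<otimes> e) \<odot>\<^bsub>Y\<^esub> y" and r: "r \<in> carrier R" and y: "y \<in> carrier Y" by blast
  have "inv\<^bsub>add_monoid Y\<^esub> x = (\<ominus> r \<otimes> e) \<odot>\<^bsub>Y\<^esub> y"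
    using r y by (simp add: x a_inv_def[symmetric] l_minus Y.smult_l_minus)
  then show ?case using assms(3)[of "\<ominus> r" y] r y by simp
qed (use assms(2-4) in auto)

lemma ideal_span_closed: "x \<in> ideal_span Y \<Longrightarrow> x \<in> carrier Y"
  by (induction rule: ideal_span_induct) simp_all

end

lemma ideal_span_hom:
  assumes "left_module R Y" "left_module R Y'" "h \<in> mod_hom R Y Y'" "x \<in> ideal_span Y"
  shows "h x \<in> ideal_span Y'"
proof -
  have "h x \<in> ideal_span Y' \<and> x \<in> carrier Y"
    using assms(4)
  proof (induction rule: ideal_span_induct[OF assms(1), consumes 1, case_names zero gen add])
    case zero
    interpret Y: left_module R Y by fact
    show ?case using mod_hom_zero[OF assms(1-3)] ideal_span_zero[OF assms(2)] by simp
  next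
    case (gen r y)
    interpret Y: left_module R Y by fact
    show ?case
      using gen mod_homD[OF assms(3)] ideal_span_gen[OF assms(2), of r "h y"] by simp
  next
    case (add x y)
    interpret Y: left_module R Y by fact
    show ?case
      using add mod_homD[OF assms(3)] ideal_span_add[OF assms(2)] by simp
  qed
  then show ?thesis ..
qed

text \<open>The entries satisfy \<open>u i \<otimes> e = u i\<close>, so every summand of the
  expansion has the form of a generator of the span.\<close>

lemma Z_hom_ideal_span:
  assumes Y: "left_module R Y" and q: "q \<in> mod_hom R (Z n) Y" and u: "u \<in> carrier (Z n)"
  shows "q u \<in> ideal_span Y"
  unfolding Z_hom_expand[OF assms] row_comb_def
proof (rule finsum_mem_subset)
  interpret Y: left_module R Y by fact
  show "abelian_group Y" by (rule Y.M.abelian_group_axioms)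
  show "ideal_span Y \<subseteq> carrier Y" using ideal_span_closed[OF Y] by blast
  fix i assume i: "i \<in> {..<n}"
  have "unit_row C i \<in> carrier (Z n)" using i by (auto simp: Z_iff)
  then have "(u i \<otimes> e) \<odot>\<^bsub>Y\<^esub> q (unit_row C i) \<in> ideal_span Y"
    using u mod_homD(1)[OF q] by (intro ideal_span_gen[OF Y]) (auto simp: Z_iff)
  then show "u i \<odot>\<^bsub>Y\<^esub> q (unit_row C i) \<in> ideal_span Y" using u by (simp add: Z_iff)
qed (auto intro: ideal_span_zero ideal_span_add Y)

text \<open>Two maps out of powers of \<open>Re\<close> become one map out of the power of added
  rank, by cutting a row into two pieces. Only images are recorded, since the inductions below
  collect elements of images.\<close>

lemma Z_hom_merge:
  assumes Y: "left_module R Y" and q: "q \<in> mod_hom R (Z m) Y" "q' \<in> mod_hom R (Z n) Y"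
  shows "\<exists>k\<in>mod_hom R (Z (m + n)) Y. \<forall>u\<in>carrier (Z m). \<forall>v\<in>carrier (Z n).
    q u \<oplus>\<^bsub>Y\<^esub> q' v \<in> k ` carrier (Z (m + n))"
proof -
  interpret Y: left_module R Y by fact
  let ?f = "\<lambda>w i. if i < m then w i else \<zero>" and ?g = "\<lambda>w i. w (i + m)"
  have fg: "?f \<in> mod_hom R (Z (m + n)) (Z m)" "?g \<in> mod_hom R (Z (m + n)) (Z n)"
    by (auto simp: mod_hom_def Z_iff)
  note c = mod_hom_comp[OF fg(1) q(1)] mod_hom_comp[OF fg(2) q(2)]
  have k: "(\<lambda>w. q (?f w) \<oplus>\<^bsub>Y\<^esub> q' (?g w)) \<in> mod_hom R (Z (m + n)) Y"
    unfolding mod_hom_def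
  proof (intro CollectI conjI ballI Pi_I)
    fix w assume w: "w \<in> carrier (Z (m + n))"
    note cw = mod_homD(1)[OF c(1) w] mod_homD(1)[OF c(2) w]
    then show "q (?f w) \<oplus>\<^bsub>Y\<^esub> q' (?g w) \<in> carrier Y" by simp
    show "q (?f (a \<odot>\<^bsub>Z (m + n)\<^esub> w)) \<oplus>\<^bsub>Y\<^esub> q' (?g (a \<odot>\<^bsub>Z (m + n)\<^esub> w)) = a \<odot>\<^bsub>Y\<^esub> (q (?f w) \<oplus>\<^bsub>Y\<^esub> q' (?g w))"
      if a: "a \<in> carrier R" for a
      using cw a mod_homD(3)[OF c(1) a w] mod_homD(3)[OF c(2) a w] by (simp add: Y.smult_r_distr)
    fix w' assume w': "w' \<in> carrier (Z (m + n))"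
    note cw' = mod_homD(1)[OF c(1) w'] mod_homD(1)[OF c(2) w']
    show "q (?f (w \<oplus>\<^bsub>Z (m + n)\<^esub> w')) \<oplus>\<^bsub>Y\<^esub> q' (?g (w \<oplus>\<^bsub>Z (m + n)\<^esub> w'))
        = q (?f w) \<oplus>\<^bsub>Y\<^esub> q' (?g w) \<oplus>\<^bsub>Y\<^esub> (q (?f w') \<oplus>\<^bsub>Y\<^esub> q' (?g w'))"
      using cw cw' mod_homD(2)[OF c(1) w w'] mod_homD(2)[OF c(2) w w'] by (simp add: Y.M.a_ac)
  qed
  have "q u \<oplus>\<^bsub>Y\<^esub> q' v \<in> (\<lambda>w. q (?f w) \<oplus>\<^bsub>Y\<^esub> q' (?g w)) ` carrier (Z (m + n))"
    if u: "u \<in> carrier (Z m)" and v: "v \<in> carrier (Z n)" for u v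
  proof (rule image_eqI[where x = "\<lambda>i. if i < m then u i else v (i - m)"])
    have "?f (\<lambda>i. if i < m then u i else v (i - m)) = u" using u by (auto simp: Z_iff fun_eq_iff)
    moreover have "?g (\<lambda>i. if i < m then u i else v (i - m)) = v" by (auto simp: fun_eq_iff)
    ultimately show "q u \<oplus>\<^bsub>Y\<^esub> q' v = q (?f (\<lambda>i. if i < m then u i else v (i - m)))
        \<oplus>\<^bsub>Y\<^esub> q' (?g (\<lambda>i. if i < m then u i else v (i - m)))" by simp
    show "(\<lambda>i. if i < m then u i else v (i - m)) \<in> carrier (Z (m + n))"
      using u v by (auto simp: Z_iff)
  qed
  then show ?thesis using k by (intro bexI[OF _ k] ballI)
qed

text \<open>Converse of \<open>Z_hom_ideal_span\<close>: a generator is the image of the one-entry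
  row \<open>r \<otimes> e\<close> under the map that multiplies the entry into \<open>y\<close>,
  and sums are reached by merging.\<close>

lemma ideal_span_Z_hom:
  assumes Y: "left_module R Y" and y: "y \<in> ideal_span Y"
  shows "\<exists>n. \<exists>q\<in>mod_hom R (Z n) Y. y \<in> q ` carrier (Z n)"
  using y
proof (induction rule: ideal_span_induct[OF Y, consumes 1, case_names zero gen add])
  case zero
  interpret Y: left_module R Y by fact
  have "(\<lambda>u. \<zero>\<^bsub>Y\<^esub>) \<in> mod_hom R (Z 0) Y" by (auto simp: mod_hom_def Y.smult_r_null)
  moreover have "(\<lambda>i. \<zero>) \<in> carrier (Z 0)" by (auto simp: Z_iff)
  ultimately show ?case by (intro exI[of _ 0] bexI[of _ "\<lambda>u. \<zero>\<^bsub>Y\<^esub>"]) auto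
next
  case (gen r y)
  interpret Y: left_module R Y by fact
  have "(\<lambda>u. u 0 \<odot>\<^bsub>Y\<^esub> y) \<in> mod_hom R (Z 1) Y"
    using gen by (auto simp: mod_hom_def Z_iff Y.smult_l_distr Y.smult_assoc)
  moreover have "(\<lambda>i. if i = 0 then r \<otimes> e else \<zero>) \<in> carrier (Z 1)"
    using gen by (auto simp: Z_iff m_assoc)
  ultimately show ?case
    by (intro exI[of _ 1] bexI[of _ "\<lambda>u. u 0 \<odot>\<^bsub>Y\<^esub> y"] image_eqI[of _ _ "\<lambda>i. if i = 0 then r \<otimes> e else \<zero>"])
      simp_all
next
  case (add x y)
  obtain m q where q: "q \<in> mod_hom R (Z m) Y" "x \<in> q ` carrier (Z m)" using add(1) by blast
  obtain n q' where q': "q' \<in> mod_hom R (Z n) Y" "y \<in> q' ` carrier (Z n)" using add(2) by blast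
  obtain u v where "x = q u" "u \<in> carrier (Z m)" "y = q' v" "v \<in> carrier (Z n)" using q(2) q'(2) by blast
  then show ?case using Z_hom_merge[OF Y q(1) q'(1)] by blast
qed

lemma ideal_span_finite_Z_hom:
  assumes Y: "left_module R Y" and "finite G" "G \<subseteq> ideal_span Y"
  shows "\<exists>n. \<exists>q\<in>mod_hom R (Z n) Y. G \<subseteq> q ` carrier (Z n)"
  using assms(2,3)
proof (induction G rule: finite_induct)
  case empty
  then show ?case using ideal_span_Z_hom[OF Y ideal_span_zero[OF Y]] by blast
next
  case (insert g G)
  interpret Y: left_module R Y by fact
  obtain m q where q: "q \<in> mod_hom R (Z m) Y" "g \<in> q ` carrier (Z m)"
    using ideal_span_Z_hom[OF Y, of g] insert by blast
  obtain n q' where q': "q' \<in> mod_hom R (Z n) Y" "G \<subseteq> q' ` carrier (Z n)" using insert by blast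
  obtain k where k: "k \<in> mod_hom R (Z (m + n)) Y" "\<forall>u\<in>carrier (Z m). \<forall>v\<in>carrier (Z n).
    q u \<oplus>\<^bsub>Y\<^esub> q' v \<in> k ` carrier (Z (m + n))" using Z_hom_merge[OF Y q(1) q'(1)] by blast
  have zero: "(\<lambda>i. \<zero>) \<in> carrier (Z l)" for l by (auto simp: Z_iff)
  have q0: "q (\<lambda>i. \<zero>) = \<zero>\<^bsub>Y\<^esub>" "q' (\<lambda>i. \<zero>) = \<zero>\<^bsub>Y\<^esub>"
    using mod_hom_zero[OF left_module_Z Y q(1)] mod_hom_zero[OF left_module_Z Y q'(1)] by simp_all
  obtain u where u: "u \<in> carrier (Z m)" "g = q u" using q(2) by blast
  have "g \<in> k ` carrier (Z (m + n))"
    using k(2)[rule_format, OF u(1) zero] u mod_homD(1)[OF q(1) u(1)] by (simp add: q0)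
  moreover have "h \<in> k ` carrier (Z (m + n))" if "h \<in> G" for h
  proof -
    obtain v where v: "v \<in> carrier (Z n)" "h = q' v" using q'(2) \<open>h \<in> G\<close> by blast
    then show ?thesis
      using k(2)[rule_format, OF zero v(1)] mod_homD(1)[OF q'(1) v(1)] by (simp add: q0)
  qed
  ultimately show ?case using k(1) by blast
qed

text \<open>Only the images of finitely many generators of \<open>M\<close> have to be reached, so
  one map \<open>u\<close> from a power of \<open>Re\<close> covers them all. Preimages of these
  under \<open>u\<close> define a map on the free module, and composing it with the section
  \<open>s\<close> gives \<open>w\<close>.\<close>

lemma factor_through_Z:
  assumes M: "fgp_module R M" and Y: "left_module R Y" and g: "g \<in> mod_hom R M Y"
    and span: "\<And>x. x \<in> carrier M \<Longrightarrow> g x \<in> ideal_span Y"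
  shows "\<exists>n. \<exists>u\<in>mod_hom R (Z n) Y. \<exists>w\<in>mod_hom R M (Z n). \<forall>x\<in>carrier M. g x = u (w x)"
proof -
  obtain m where "retract R M (row_module R m)" using M by (rule fgp_moduleE)
  then obtain s q where s: "s \<in> mod_hom R M (row_module R m)" and q: "q \<in> mod_hom R (row_module R m) M"
    and qs: "\<forall>x\<in>carrier M. q (s x) = x" by (rule retractE)
  let ?x = "\<lambda>i. q (unit_row R i)"
  have x: "?x i \<in> carrier M" if "i < m" for i
    by (rule mod_homD(1)[OF q unit_row_closed[OF ring_axioms that]])
  have "(\<lambda>i. g (?x i)) ` {..<m} \<subseteq> ideal_span Y" using span x by blast
  then obtain n u where u: "u \<in> mod_hom R (Z n) Y" "(\<lambda>i. g (?x i)) ` {..<m} \<subseteq> u ` carrier (Z n)"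
    using ideal_span_finite_Z_hom[OF Y, of "(\<lambda>i. g (?x i)) ` {..<m}"] by blast
  have "\<forall>i<m. \<exists>a\<in>carrier (Z n). u a = g (?x i)"  proof (intro allI impI)
    fix i assume "i < m"
    then have "g (?x i) \<in> u ` carrier (Z n)" using u(2) by (auto simp: image_subset_iff)
    then show "\<exists>a\<in>carrier (Z n). u a = g (?x i)" by (auto simp: image_iff)
  qed
  then obtain a where a: "\<And>i. i < m \<Longrightarrow> a i \<in> carrier (Z n)" "\<And>i. i < m \<Longrightarrow> u (a i) = g (?x i)" by metis
  have r: "row_comb (Z n) m a \<in> mod_hom R (row_module R m) (Z n)"
    by (rule row_comb_hom[OF left_module_Z a(1)])
  have "g x = u (row_comb (Z n) m a (s x))" if "x \<in> carrier M" for x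
  proof -
    have "g (q (s x)) = u (row_comb (Z n) m a (s x))"
      by (rule mod_hom_row_module_eqI[OF Y mod_hom_comp[OF q g] mod_hom_comp[OF r u(1)] _ mod_homD(1)[OF s that]])
        (simp only: row_comb_unit[OF left_module_Z a(1)] a(2))
    then show ?thesis using qs that by simp
  qed
  then show ?thesis
    by (intro exI[of _ n] bexI[OF _ u(1)] bexI[OF _ mod_hom_comp[OF s r]] ballI)
qed

lemma fgp_Z: "fgp_module R (Z n)"
  by (rule fgp_moduleI[OF left_module_Z retract_Z])

text \<open>The eRe-module eM, taken as the fixed points of \<open>e\<close> so that all operations
  are inherited. On summands of powers of \<open>Re\<close> it inverts the functor given by
  \<open>Re\<close>, by \<open>tensor_cut\<close> and \<open>cut_tensor\<close>.\<close>

definition cut :: "('a, 'm) module \<Rightarrow> ('a, 'm) module"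
  where "cut M = M\<lparr>carrier := {x \<in> carrier M. e \<odot>\<^bsub>M\<^esub> x = x}\<rparr>"

lemma cut_simps [simp]:
  "x \<in> carrier (cut M) \<longleftrightarrow> x \<in> carrier M \<and> e \<odot>\<^bsub>M\<^esub> x = x"
  "x \<oplus>\<^bsub>cut M\<^esub> y = x \<oplus>\<^bsub>M\<^esub> y" "\<zero>\<^bsub>cut M\<^esub> = \<zero>\<^bsub>M\<^esub>" "a \<odot>\<^bsub>cut M\<^esub> x = a \<odot>\<^bsub>M\<^esub> x"
  by (simp_all add: cut_def)

lemma left_module_cut:
  assumes "left_module R M" shows "left_module C (cut M)"
proof -
  interpret M: left_module R M by fact
  have "abelian_group (cut M)"
  proof (rule abelian_groupI)
    fix x assume "x \<in> carrier (cut M)"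
    then show "\<exists>y\<in>carrier (cut M). y \<oplus>\<^bsub>cut M\<^esub> x = \<zero>\<^bsub>cut M\<^esub>"
      by (intro bexI[of _ "\<ominus>\<^bsub>M\<^esub> x"]) (auto simp: M.smult_r_minus M.M.l_neg)
  qed (auto simp: M.smult_r_null M.smult_r_distr M.M.a_ac)
  then show ?thesis
    by (intro left_module.intro left_module_axioms.intro ring_corner)
      (auto simp: corner_iff M.smult_l_distr M.smult_r_distr M.smult_assoc[symmetric])
qed

lemma cut_hom:
  assumes "h \<in> mod_hom R M N" shows "h \<in> mod_hom C (cut M) (cut N)"
  using mod_homD[OF assms] by (auto simp: mod_hom_def[of C] corner_iff) (metis e_closed)

lemma cut_isomorphic:
  assumes "isomorphic_modules R M N" "left_module R M" "left_module R N"
  shows "isomorphic_modules C (cut M) (cut N)"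
proof -
  obtain f g where f: "f \<in> mod_hom R M N" "g \<in> mod_hom R N M"
    "\<forall>x\<in>carrier M. g (f x) = x" "\<forall>y\<in>carrier N. f (g y) = y"
    using assms by (rule isomorphic_modulesE)
  show ?thesis
    by (rule isomorphic_modulesI[OF cut_hom[OF f(1)] mod_homD(1)[OF cut_hom[OF f(2)]]])
      (use f(3,4) in auto)
qed

lemma cut_direct_sum: "isomorphic_modules C (cut (direct_sum M N)) (direct_sum (cut M) (cut N))"
  by (rule isomorphic_modulesI[of "\<lambda>x. x" _ _ _ "\<lambda>x. x"]) (auto simp: mod_hom_def)

text \<open>An equality of modules and not just an isomorphism: both sides are sequences over R with
  entries in eRe and with the operations of R.\<close>

lemma cut_Z: "cut (Z n) = row_module C n"
proof -
  have "u \<in> carrier (cut (Z n)) \<longleftrightarrow> u \<in> carrier (row_module C n)" for u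
    by (auto simp: Z_iff row_module_iff corner_iff fun_eq_iff)
  then have "carrier (cut (Z n)) = carrier (row_module C n)" by blast
  moreover have "cut (Z n) = (Z n)\<lparr>carrier := carrier (cut (Z n))\<rparr>" by (simp add: cut_def)
  moreover have "(Z n)\<lparr>carrier := carrier (row_module C n)\<rparr> = row_module C n"
    by (simp add: power_module_def)
  ultimately show ?thesis by simp
qed

lemma fgp_cut:
  assumes "left_module R M" "retract R M (Z n)" shows "fgp_module C (cut M)"
proof -
  obtain s q where s: "s \<in> mod_hom R M (Z n)" "q \<in> mod_hom R (Z n) M" "\<forall>x\<in>carrier M. q (s x) = x"
    using assms(2) by (rule retractE)
  have "retract C (cut M) (row_module C n)"
    unfolding cut_Z[symmetric]
    by (rule retractI[OF cut_hom[OF s(1)] cut_hom[OF s(2)]]) (use s(3) in simp)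
  then show ?thesis by (rule fgp_moduleI[OF left_module_cut[OF assms(1)]])
qed

text \<open>The multiplication map from the tensor product to \<open>M\<close> is inverted by
  sending \<open>y\<close> to the sum of \<open>s y i\<close> tensored with \<open>x i\<close>,
  where the \<open>x i\<close> are the images in eM of the rows \<open>unit_row C i\<close>. The
  hypothesis on \<open>M\<close> supplies these coordinates.\<close>

lemma tensor_cut:
  assumes M: "left_module R M" and "retract R M (Z n)"
  shows "isomorphic_modules R (tensor C Be (cut M)) M"
proof -
  interpret M: left_module R M by fact
  interpret T: tensor_product R C Be "cut M" by (intro Be.tensor_product left_module_cut M)
  let ?T = "tensor C Be (cut M)"
  obtain s q where s: "s \<in> mod_hom R M (Z n)" and q: "q \<in> mod_hom R (Z n) M"
    and qs: "\<forall>x\<in>carrier M. q (s x) = x"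
    using assms(2) by (rule retractE)
  define x where "x i = q (unit_row C i)" for i
  have unit: "unit_row C i \<in> carrier (row_module C n)" if "i < n" for i
    by (rule unit_row_closed[OF ring_corner that])
  have xc: "x i \<in> carrier (cut M)" if "i < n" for i
    unfolding x_def by (rule mod_homD(1)[OF cut_hom[OF q]]) (use unit[OF that] cut_Z in simp)
  then have x: "x i \<in> carrier M" if "i < n" for i using that by simp
  have sR: "s y i \<in> carrier Be" if "y \<in> carrier M" for y i
    using mod_homD(1)[OF s that] by (simp add: power_module_iff)
  have expand: "row_comb M n x (s y) = y" if "y \<in> carrier M" for y
    using Z_hom_expand[OF M q mod_homD(1)[OF s that]] qs that by (simp add: x_def[abs_def])
  let ?j = "\<lambda>y. finsum ?T (\<lambda>i. tens C Be (cut M) (s y i) (x i)) {..<n}"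
  show ?thesis
  proof (rule T.tensor_isomorphic[OF M, of "\<lambda>b y. b \<odot>\<^bsub>M\<^esub> y" ?j])
    show "balanced_map C Be (cut M) M (\<lambda>b y. b \<odot>\<^bsub>M\<^esub> y)"
      by (auto simp: balanced_map_def Be_iff corner_iff M.smult_l_distr M.smult_r_distr M.smult_assoc)
    show "(a \<odot>\<^bsub>Be\<^esub> b) \<odot>\<^bsub>M\<^esub> y = a \<odot>\<^bsub>M\<^esub> (b \<odot>\<^bsub>M\<^esub> y)"
      if "a \<in> carrier R" "b \<in> carrier Be" "y \<in> carrier (cut M)" for a b y
      using that by (simp add: Be_iff M.smult_assoc)
    show "?j \<in> hom (add_monoid M) (add_monoid ?T)"
      unfolding hom_add_monoid_iff
    proof (intro conjI Pi_I ballI)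
      fix y z assume y: "y \<in> carrier M"
      show "?j y \<in> carrier ?T"
        using sR[OF y] xc by (intro T.T.finsum_closed) (simp add: T.tens_closed)
      assume z: "z \<in> carrier M"
      have "?j y \<oplus>\<^bsub>?T\<^esub> ?j z = finsum ?T (\<lambda>i. tens C Be (cut M) (s y i) (x i) \<oplus>\<^bsub>?T\<^esub>
          tens C Be (cut M) (s z i) (x i)) {..<n}"
        using sR[OF y] sR[OF z] xc by (intro T.T.finsum_addf[symmetric]) (simp_all add: T.tens_closed)
      also have "\<dots> = ?j (y \<oplus>\<^bsub>M\<^esub> z)"
        using sR[OF y] sR[OF z] sR[OF M.M.a_closed[OF y z]] xc T.tens_add_left mod_homD(2)[OF s y z]
        by (intro T.T.finsum_cong') (simp_all add: T.tens_closed)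
      finally show "?j (y \<oplus>\<^bsub>M\<^esub> z) = ?j y \<oplus>\<^bsub>?T\<^esub> ?j z" by simp
    qed
    fix b y assume b: "b \<in> carrier Be" and y: "y \<in> carrier (cut M)"
    then have yM: "y \<in> carrier M" by simp
    have bR: "b \<in> carrier R" using b by (simp add: Be_iff)
    \<comment> \<open>For \<open>y\<close> in eM the coordinates lie in eRe and not only in
      \<open>Re\<close>, so they can be moved across the tensor sign.\<close>
    have "s y \<in> carrier (row_module C n)" using mod_homD(1)[OF cut_hom[OF s] y] cut_Z by simp
    then have sC: "s y i \<in> carrier C" for i by (simp add: row_module_iff)
    have "?j (b \<odot>\<^bsub>M\<^esub> y) = finsum ?T (\<lambda>i. tens C Be (cut M) b (s y i \<odot>\<^bsub>cut M\<^esub> x i)) {..<n}"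
    proof (rule T.T.finsum_cong')
      show "(\<lambda>i. tens C Be (cut M) b (s y i \<odot>\<^bsub>cut M\<^esub> x i)) \<in> {..<n} \<rightarrow> carrier ?T"
        using b xc sC T.M.smult_closed by (intro Pi_I T.tens_closed) auto
      show "tens C Be (cut M) (s (b \<odot>\<^bsub>M\<^esub> y) i) (x i) = tens C Be (cut M) b (s y i \<odot>\<^bsub>cut M\<^esub> x i)"
        if "i \<in> {..<n}" for i
        using T.tens_rsmult[OF b sC xc, of i i] mod_homD(3)[OF s bR yM] that by simp
    qed simp
    also have "\<dots> = tens C Be (cut M) b (row_comb (cut M) n x (s y))"
      unfolding row_comb_def using b xc sC T.M.smult_closed
      by (intro T.tens_finsum[symmetric]) auto
    also have "row_comb (cut M) n x (s y) = y"
      using mod_hom_row_module[OF left_module_cut[OF M], of q n "s y"] cut_hom[OF q] qs yM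
        \<open>s y \<in> carrier (row_module C n)\<close>
      by (simp add: cut_Z x_def[abs_def])
    finally show "?j (b \<odot>\<^bsub>M\<^esub> y) = tens C Be (cut M) b y" .
  next
    fix h y assume h: "h \<in> mod_hom R ?T M"
      "\<forall>b\<in>carrier Be. \<forall>m\<in>carrier (cut M). h (tens C Be (cut M) b m) = b \<odot>\<^bsub>M\<^esub> m" and y: "y \<in> carrier M"
    have "h (?j y) = finsum M (\<lambda>i. h (tens C Be (cut M) (s y i) (x i))) {..<n}"
      using sR[OF y] xc
      by (intro mod_hom_finsum[OF T.left_module_tensor M h(1)]) (simp_all add: T.tens_closed)
    also have "\<dots> = row_comb M n x (s y)"
      unfolding row_comb_def using sR[OF y] xc h(2) by (intro M.M.finsum_cong') (simp_all add: Be_iff)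
    finally show "h (?j y) = y" using expand[OF y] by simp
  qed
qed

lemma tensor_retract_Z:
  assumes "fgp_module C P"
  shows "\<exists>n. retract R (tensor C Be P) (Z n)"
proof -
  interpret T: tensor_product R C Be P by (intro Be.tensor_product fgp_left_module assms)
  obtain n where "retract C P (row_module C n)" using assms by (rule fgp_moduleE)
  then obtain s q where s: "s \<in> mod_hom C P (row_module C n)" "q \<in> mod_hom C (row_module C n) P"
    "\<forall>x\<in>carrier P. q (s x) = x" by (rule retractE)
  have "retract R (tensor C Be P) (Z n)"
    by (rule T.tensor_retract[OF s(1,2)]) (rule bspec[OF s(3)])
  then show ?thesis ..
qed

text \<open>Multiplying \<open>Re\<close> by \<open>e\<close> from the left gives eRe, so
  \<open>p\<close> corresponds to \<open>e\<close> tensored with \<open>p\<close>, and back a pure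
  tensor of \<open>b\<close> and \<open>p\<close> goes to \<open>e \<otimes> b\<close> acting on
  \<open>p\<close>. This backward map is defined on the whole tensor product but is only additive
  there.\<close>

lemma cut_tensor:
  assumes P: "left_module C P"
  shows "isomorphic_modules C P (cut (tensor C Be P))"
proof -
  interpret T: tensor_product R C Be P by (intro Be.tensor_product P)
  let ?T = "tensor C Be P"
  have e: "e \<in> carrier Be" by (simp add: Be_iff)
  have eC: "e \<otimes> b \<in> carrier C" if "b \<in> carrier Be" for b
    using that by (simp add: Be_iff corner_iff m_assoc)
  have cR: "c \<in> carrier Be" "c \<in> carrier R" "e \<otimes> c = c" "c \<otimes> e = c" if "c \<in> carrier C" for c
    using that by (simp_all add: Be_iff corner_iff)
  have "balanced_map C Be P P (\<lambda>b p. (e \<otimes> b) \<odot>\<^bsub>P\<^esub> p)"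
  proof -
    have 1: "(e \<otimes> (b \<oplus> b')) \<odot>\<^bsub>P\<^esub> p = (e \<otimes> b) \<odot>\<^bsub>P\<^esub> p \<oplus>\<^bsub>P\<^esub> (e \<otimes> b') \<odot>\<^bsub>P\<^esub> p"
      if "b \<in> carrier Be" "b' \<in> carrier Be" "p \<in> carrier P" for b b' p
      using T.M.smult_l_distr[OF eC[OF that(1)] eC[OF that(2)] that(3)] that
      by (simp add: Be_iff r_distr)
    have 2: "(e \<otimes> (b \<otimes> c)) \<odot>\<^bsub>P\<^esub> p = (e \<otimes> b) \<odot>\<^bsub>P\<^esub> (c \<odot>\<^bsub>P\<^esub> p)"
      if "b \<in> carrier Be" "c \<in> carrier C" "p \<in> carrier P" for b c p
      using T.M.smult_assoc[OF eC[OF that(1)] that(2,3)] that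
      by (simp add: Be_iff corner_iff m_assoc)
    show ?thesis
      using eC by (auto simp: balanced_map_def 1 2 T.M.smult_r_distr)
  qed
  then obtain h where h: "h \<in> hom (add_monoid ?T) (add_monoid P)"
    "\<forall>b\<in>carrier Be. \<forall>p\<in>carrier P. h (tens C Be P b p) = (e \<otimes> b) \<odot>\<^bsub>P\<^esub> p"
    using T.tensor_lift_add[OF T.M.M.abelian_group_axioms] by blast
  have hc: "h t \<in> carrier P" if "t \<in> carrier ?T" for t
    using h(1) that by (auto simp: hom_add_monoid_iff)
  have ha: "h (t \<oplus>\<^bsub>?T\<^esub> u) = h t \<oplus>\<^bsub>P\<^esub> h u" if "t \<in> carrier ?T" "u \<in> carrier ?T" for t u
    using h(1) that by (simp add: hom_add_monoid_iff)
  let ?f = "tens C Be P e"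
  have f: "?f \<in> mod_hom C P (cut ?T)"
    unfolding mod_hom_def
  proof (intro CollectI conjI ballI Pi_I)
    fix p assume p: "p \<in> carrier P"
    show "?f p \<in> carrier (cut ?T)" using e p by simp
    show "?f (c \<odot>\<^bsub>P\<^esub> p) = c \<odot>\<^bsub>cut ?T\<^esub> ?f p" if c: "c \<in> carrier C" for c
      using T.tens_rsmult[OF e c p] T.smult_tens[OF _ e p, of c] cR[OF c] by simp
    show "?f (p \<oplus>\<^bsub>P\<^esub> p') = ?f p \<oplus>\<^bsub>cut ?T\<^esub> ?f p'" if "p' \<in> carrier P" for p'
      using T.tens_add_right[OF e p that] by simp
  qed
  \<comment> \<open>On a pure tensor, \<open>e \<otimes> b\<close> belongs to the corner ring and
    passes to the right factor, leaving \<open>e\<close> on the left.\<close>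
  have fh: "e \<odot>\<^bsub>?T\<^esub> t = ?f (h t)" if t: "t \<in> carrier ?T" for t
  proof (rule T.tensor_add_hom_eqI[where f = "\<lambda>t. e \<odot>\<^bsub>?T\<^esub> t" and g = "\<lambda>t. ?f (h t)",
        OF T.abelian_group_tensor _ _ _ t])
    show "(\<lambda>t. e \<odot>\<^bsub>?T\<^esub> t) \<in> hom (add_monoid ?T) (add_monoid ?T)" by (rule T.smult_add_hom) simp
    show "(\<lambda>t. ?f (h t)) \<in> hom (add_monoid ?T) (add_monoid ?T)"
      unfolding hom_add_monoid_iff using e hc ha T.tens_add_right[OF e] by simp
    fix b p assume b: "b \<in> carrier Be" and p: "p \<in> carrier P"
    have "b \<in> carrier R" using b by (simp add: Be_iff)
    then show "e \<odot>\<^bsub>?T\<^esub> tens C Be P b p = ?f (h (tens C Be P b p))"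
      using T.tens_rsmult[OF e eC[OF b] p] T.smult_tens[OF e_closed b p] h(2) b p by simp
  qed
  show ?thesis
  proof (rule isomorphic_modulesI[OF f, of h])
    show "h t \<in> carrier P" if "t \<in> carrier (cut ?T)" for t using hc that by simp
    show "h (?f p) = p" if "p \<in> carrier P" for p
      using h(2)[rule_format, OF e that] T.M.smult_one[OF that] by simp
    show "?f (h t) = t" if "t \<in> carrier (cut ?T)" for t using fh[of t] that by simp
  qed
qed

end

lemma mod_hom_diff:
  assumes "left_module R M" "left_module R N" "f \<in> mod_hom R M N" "g \<in> mod_hom R M N"
  shows "(\<lambda>x. f x \<ominus>\<^bsub>N\<^esub> g x) \<in> mod_hom R M N"
proof -
  interpret M: left_module R M by fact
  interpret N: left_module R N by fact
  note fg = mod_homD[OF assms(3)] mod_homD[OF assms(4)]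
  have "(a \<oplus>\<^bsub>N\<^esub> b) \<ominus>\<^bsub>N\<^esub> (c \<oplus>\<^bsub>N\<^esub> d) = (a \<ominus>\<^bsub>N\<^esub> c) \<oplus>\<^bsub>N\<^esub> (b \<ominus>\<^bsub>N\<^esub> d)"
    if "a \<in> carrier N" "b \<in> carrier N" "c \<in> carrier N" "d \<in> carrier N" for a b c d
    using that by (simp add: a_minus_def N.M.minus_add N.M.a_ac)
  then show ?thesis
    unfolding mod_hom_def
    using fg by (auto simp: a_minus_def N.smult_r_distr N.smult_r_minus)
qed

section \<open>Base change of row modules along a ring homomorphism\<close>

lemma row_module_hom_closed:
  assumes "ring R" "ring S" "\<theta> \<in> ring_hom R S" "u \<in> carrier (row_module R n)"
  shows "(\<lambda>i. \<theta> (u i)) \<in> carrier (row_module S n)"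
  using assms ring_hom_closed[OF assms(3)] ring_hom_zero[OF assms(3,1,2)] by (simp add: row_module_iff)

text \<open>The matrix of \<open>d\<close> with \<open>\<theta>\<close> applied to every entry.
  Abstractly this is the map induced by \<open>d\<close> on the extension of scalars of R^n along
  \<open>\<theta>\<close>; coordinates avoid identifying that extension with S^n.\<close>

definition base_change :: "('a, 'c) ring_scheme \<Rightarrow> ('b, 'd) ring_scheme \<Rightarrow> ('a \<Rightarrow> 'b) \<Rightarrow> nat
    \<Rightarrow> ((nat \<Rightarrow> 'a) \<Rightarrow> nat \<Rightarrow> 'a) \<Rightarrow> (nat \<Rightarrow> 'b) \<Rightarrow> nat \<Rightarrow> 'b"
  where "base_change R S \<theta> n d = row_comb (row_module S n) n (\<lambda>i j. \<theta> (d (unit_row R i) j))"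

context
  fixes R :: "('a, 'c) ring_scheme" and S :: "('b, 'd) ring_scheme" and \<theta> :: "'a \<Rightarrow> 'b" and n :: nat
  assumes R: "ring R" and S: "ring S" and \<theta>: "\<theta> \<in> ring_hom R S"
begin

interpretation R: ring R by (fact R)
interpretation S: ring S by (fact S)

lemma base_change_row_closed:
  assumes "d \<in> mod_hom R (row_module R n) (row_module R n)" "i < n"
  shows "(\<lambda>j. \<theta> (d (unit_row R i) j)) \<in> carrier (row_module S n)"
  by (rule row_module_hom_closed[OF R S \<theta> mod_homD(1)[OF assms(1) unit_row_closed[OF R assms(2)]]])

lemma base_change_hom:
  assumes "d \<in> mod_hom R (row_module R n) (row_module R n)"
  shows "base_change R S \<theta> n d \<in> mod_hom S (row_module S n) (row_module S n)"
  unfolding base_change_def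
  by (rule row_comb_hom[OF left_module_row[OF S] base_change_row_closed[OF assms]])

text \<open>A ring homomorphism passes through the finite sum of products that computes a coordinate
  of \<open>d u\<close>.\<close>

lemma base_change_apply:
  assumes d: "d \<in> mod_hom R (row_module R n) (row_module R n)" and u: "u \<in> carrier (row_module R n)"
  shows "base_change R S \<theta> n d (\<lambda>i. \<theta> (u i)) = (\<lambda>j. \<theta> (d u j))"
proof
  fix j
  let ?m = "\<lambda>i. d (unit_row R i)"
  have m: "?m i \<in> carrier (row_module R n)" if "i < n" for i
    by (rule mod_homD(1)[OF d unit_row_closed[OF R that]])
  have mj: "?m i j \<in> carrier R" if "i < n" for i using m[OF that] by (simp add: row_module_iff)
  have uR: "u i \<in> carrier R" for i using u by (simp add: row_module_iff)
  interpret RR: left_module R "regular_module R" by (rule left_module_regular[OF R])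
  interpret SS: left_module S "regular_module S" by (rule left_module_regular[OF S])
  have \<theta>h: "\<theta> \<in> hom (add_monoid (regular_module R)) (add_monoid (regular_module S))"
    unfolding hom_add_monoid_iff using ring_hom_closed[OF \<theta>] ring_hom_add[OF \<theta>] by simp
  have "base_change R S \<theta> n d (\<lambda>i. \<theta> (u i)) j
      = row_comb (regular_module S) n (\<lambda>i. \<theta> (?m i j)) (\<lambda>i. \<theta> (u i))"
    unfolding base_change_def
    by (intro mod_hom_row_comb[OF left_module_row[OF S] left_module_regular[OF S] row_coordinate_hom[OF S]]
        base_change_row_closed[OF d] ring_hom_closed[OF \<theta>] uR)
  also have "\<dots> = finsum (regular_module S) (\<lambda>i. \<theta> (u i \<otimes>\<^bsub>R\<^esub> ?m i j)) {..<n}"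
    unfolding row_comb_def using uR mj ring_hom_closed[OF \<theta>] ring_hom_mult[OF \<theta>]
    by (intro SS.M.finsum_cong') simp_all
  also have "\<dots> = \<theta> (finsum (regular_module R) (\<lambda>i. u i \<otimes>\<^bsub>R\<^esub> ?m i j) {..<n})"
    using uR mj by (intro add_hom_finsum[OF RR.M.abelian_group_axioms SS.M.abelian_group_axioms \<theta>h, symmetric]) simp_all
  also have "finsum (regular_module R) (\<lambda>i. u i \<otimes>\<^bsub>R\<^esub> ?m i j) {..<n} = row_comb (regular_module R) n (\<lambda>i. ?m i j) u"
    by (simp add: row_comb_def)
  also have "\<dots> = row_comb (row_module R n) n ?m u j"
    by (intro mod_hom_row_comb[OF left_module_row[OF R] left_module_regular[OF R] row_coordinate_hom[OF R],
          symmetric] m uR)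
  also have "row_comb (row_module R n) n ?m u = d u"
    by (rule mod_hom_row_module[OF left_module_row[OF R] d u, symmetric])
  finally show "base_change R S \<theta> n d (\<lambda>i. \<theta> (u i)) j = \<theta> (d u j)" .
qed

lemma base_change_unit:
  assumes "d \<in> mod_hom R (row_module R n) (row_module R n)" "i < n"
  shows "base_change R S \<theta> n d (unit_row S i) = (\<lambda>j. \<theta> (d (unit_row R i) j))"
proof -
  have "unit_row S i = (\<lambda>j. \<theta> (unit_row R i j))"
    using ring_hom_one[OF \<theta>] ring_hom_zero[OF \<theta> R S] by auto
  then show ?thesis using base_change_apply[OF assms(1) unit_row_closed[OF R assms(2)]] by simp
qed

text \<open>It is enough that \<open>d'\<close> inverts \<open>d\<close> after applying
  \<open>\<theta>\<close>, because rows over the target ring are combinations of unit rows, and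
  these are images of unit rows over R.\<close>

lemma base_change_inverse:
  assumes d: "d \<in> mod_hom R (row_module R n) (row_module R n)"
    and d': "d' \<in> mod_hom R (row_module R n) (row_module R n)"
    and inv: "\<And>u j. u \<in> carrier (row_module R n) \<Longrightarrow> \<theta> (d' (d u) j) = \<theta> (u j)"
    and v: "v \<in> carrier (row_module S n)"
  shows "base_change R S \<theta> n d' (base_change R S \<theta> n d v) = v"
proof (rule mod_hom_row_module_eqI[OF left_module_row[OF S]
      mod_hom_comp[OF base_change_hom[OF d] base_change_hom[OF d']] mod_hom_id _ v])
  fix i assume i: "i < n"
  note ui = unit_row_closed[OF R i]
  have "base_change R S \<theta> n d' (base_change R S \<theta> n d (unit_row S i)) = (\<lambda>j. \<theta> (d' (d (unit_row R i)) j))"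
    unfolding base_change_unit[OF d i] by (rule base_change_apply[OF d' mod_homD(1)[OF d ui]])
  also have "\<dots> = unit_row S i"
    using inv[OF ui] ring_hom_one[OF \<theta>] ring_hom_zero[OF \<theta> R S] by auto
  finally show "base_change R S \<theta> n d' (base_change R S \<theta> n d (unit_row S i)) = unit_row S i" .
qed

end

section \<open>Reduction modulo the ideal generated by an idempotent\<close>

context idempotent
begin

abbreviation (input) "I \<equiv> corner_ideal R e"

abbreviation (input) "S \<equiv> R Quot corner_ideal R e"

abbreviation pr :: "'a \<Rightarrow> 'a set" where "pr r \<equiv> corner_ideal R e +>\<^bsub>R\<^esub> r"

lemma left_module_regular_R: "left_module R (regular_module R)"
  by (rule left_module_regular[OF ring_axioms])

text \<open>When R acts on itself, the right factor of a generator
  \<open>r \<otimes> e \<otimes> s\<close> is the module element, so membership in the ideal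
  inherits the lemmas on spans.\<close>

lemma corner_ideal_eq: "I = ideal_span (regular_module R)"
proof (intro equalityI subsetI)
  note RR = left_module_regular_R
  have gen: "r \<otimes> e \<otimes> y \<in> ideal_span (regular_module R)" if "r \<in> carrier R" "y \<in> carrier R" for r y
    using ideal_span_gen[OF RR that(1), of y] that(2) by simp
  fix x assume "x \<in> I"
  then show "x \<in> ideal_span (regular_module R)"
    unfolding corner_ideal_def
  proof (induction rule: generate.induct)
    case one
    then show ?case using ideal_span_zero[OF RR] by simp
  next
    case (incl h)
    then show ?case using gen by blast
  next
    case (inv h)
    then obtain r y where h: "h = r \<otimes> e \<otimes> y" "r \<in> carrier R" "y \<in> carrier R" by blast
    then have "inv\<^bsub>add_monoid R\<^esub> h = \<ominus> r \<otimes> e \<otimes> y" by (simp add: a_inv_def[symmetric] l_minus)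
    then show ?case using gen[of "\<ominus> r" y] h by simp
  next
    case (eng h1 h2)
    then show ?case using ideal_span_add[OF RR] by simp
  qed
next
  fix x assume "x \<in> ideal_span (regular_module R)"
  then show "x \<in> I"
    unfolding corner_ideal_def
  proof (induction rule: ideal_span_induct[OF left_module_regular_R, consumes 1, case_names zero gen add])
    case zero
    show ?case using generate.one[of "add_monoid R"] by simp
  next
    case (gen r y)
    then show ?case by (intro generate.incl) auto
  next
    case (add x y)
    then show ?case using generate.eng[of x "add_monoid R" _ y] by simp
  qed
qed

text \<open>Sending \<open>a\<close> to \<open>a\<close> times \<open>y\<close> is linear on the
  regular module, and linear maps carry spans into spans.\<close>

lemma ideal_smult:
  assumes Y: "left_module R Y" and "a \<in> I" "y \<in> carrier Y"
  shows "a \<odot>\<^bsub>Y\<^esub> y \<in> ideal_span Y"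
proof -
  interpret Y: left_module R Y by fact
  have "(\<lambda>a. a \<odot>\<^bsub>Y\<^esub> y) \<in> mod_hom R (regular_module R) Y"
    using assms(3) by (auto simp: mod_hom_def Y.smult_l_distr Y.smult_assoc)
  then show ?thesis
    using ideal_span_hom[OF left_module_regular_R Y] assms(2) unfolding corner_ideal_eq by blast
qed

lemma ideal_span_smult:
  assumes Y: "left_module R Y" and a: "a \<in> carrier R" and "x \<in> ideal_span Y"
  shows "a \<odot>\<^bsub>Y\<^esub> x \<in> ideal_span Y"
proof -
  interpret Y: left_module R Y by fact
  have "a \<odot>\<^bsub>Y\<^esub> x \<in> ideal_span Y \<and> x \<in> carrier Y"
    using assms(3)
  proof (induction rule: ideal_span_induct[OF Y, consumes 1, case_names zero gen add])
    case zero
    then show ?case using a ideal_span_zero[OF Y] by (simp add: Y.smult_r_null)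
  next
    case (gen r y)
    then show ?case
      using a ideal_span_gen[OF Y, of "a \<otimes> r" y] by (simp add: Y.smult_assoc[symmetric] m_assoc)
  next
    case (add x y)
    then show ?case using a ideal_span_add[OF Y] by (simp add: Y.smult_r_distr)
  qed
  then show ?thesis ..
qed

lemma ideal_corner_ideal: "ideal I R"
proof (rule idealI[OF ring_axioms])
  show "subgroup I (add_monoid R)"
    unfolding corner_ideal_def by (rule group.generate_is_subgroup[OF a_group]) auto
  fix a x assume a: "a \<in> I" and x: "x \<in> carrier R"
  show "x \<otimes> a \<in> I"
    using ideal_span_smult[OF left_module_regular_R x] a unfolding corner_ideal_eq by simp
  show "a \<otimes> x \<in> I"
    using ideal_smult[OF left_module_regular_R a, of x] x unfolding corner_ideal_eq by simp
qed

sublocale I: ideal I R by (rule ideal_corner_ideal)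

lemma ring_S: "ring S" by (rule I.quotient_is_ring)

sublocale S: ring S by (rule ring_S)

lemma pr_hom: "pr \<in> ring_hom R S" by (rule I.rcos_ring_hom)

lemma pr_simps [simp]:
  "r \<in> carrier R \<Longrightarrow> pr r \<in> carrier S"
  "r \<in> carrier R \<Longrightarrow> r' \<in> carrier R \<Longrightarrow> pr (r \<oplus> r') = pr r \<oplus>\<^bsub>S\<^esub> pr r'"
  "r \<in> carrier R \<Longrightarrow> r' \<in> carrier R \<Longrightarrow> pr (r \<otimes> r') = pr r \<otimes>\<^bsub>S\<^esub> pr r'"
  "pr \<one> = \<one>\<^bsub>S\<^esub>" "pr \<zero> = \<zero>\<^bsub>S\<^esub>"
  by (fact ring_hom_closed[OF pr_hom] ring_hom_add[OF pr_hom] ring_hom_mult[OF pr_hom]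
    ring_hom_one[OF pr_hom] ring_hom_zero[OF pr_hom ring_axioms ring_S])+

lemma pr_surj:
  assumes "x \<in> carrier S" shows "\<exists>r\<in>carrier R. x = pr r"
proof -
  have "carrier S = a_rcosets I" by (simp only: FactRing_def partial_object.simps)
  then have "x \<in> (\<Union>a\<in>carrier R. {pr a})" using assms by (simp only: A_RCOSETS_def')
  then show ?thesis by (rule UN_E) (rule bexI, erule singletonD)
qed

lemma pr_zero_iff: "r \<in> carrier R \<Longrightarrow> pr r = \<zero>\<^bsub>S\<^esub> \<longleftrightarrow> r \<in> I"
proof -
  assume r: "r \<in> carrier R"
  have "\<zero>\<^bsub>S\<^esub> = I" by (simp only: FactRing_def ring.simps)
  then show ?thesis
    by (simp only:) (rule iffI[OF a_coset_join1[OF _ r I.a_subgroup] I.a_rcos_const])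
qed

lemma pr_e: "r \<in> carrier R \<Longrightarrow> pr (r \<otimes> e) = \<zero>\<^bsub>S\<^esub>"
  using ideal_span_gen[OF left_module_regular_R, of r \<one>] pr_zero_iff[of "r \<otimes> e"]
  unfolding corner_ideal_eq by simp

section \<open>Reduction of modules modulo the ideal\<close>

abbreviation (input) "Q \<equiv> quotient_bimodule R (corner_ideal R e)"

lemma Q_simps [simp]:
  "carrier Q = carrier S" "\<zero>\<^bsub>Q\<^esub> = \<zero>\<^bsub>S\<^esub>" "x \<oplus>\<^bsub>Q\<^esub> y = x \<oplus>\<^bsub>S\<^esub> y" "s \<odot>\<^bsub>Q\<^esub> x = s \<otimes>\<^bsub>S\<^esub> x"
  "rsmult Q x r = x \<otimes>\<^bsub>S\<^esub> pr r"
  by (simp_all add: quotient_bimodule_def)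

lemma power_Q: "power_module Q n = row_module S n"
  by (simp add: power_module_def)

lemma left_module_Q: "left_module S Q"
proof -
  have "abelian_group Q"
    by (rule abelian_groupI) (auto simp: S.a_ac S.r_neg intro!: bexI[of _ "\<ominus>\<^bsub>S\<^esub> _"])
  then show ?thesis
    by (intro left_module.intro left_module_axioms.intro ring_S)
      (auto simp: S.l_distr S.r_distr S.m_assoc)
qed

sublocale Q: fgp_bimodule "R Quot corner_ideal R e" R "quotient_bimodule R (corner_ideal R e)"
proof (intro fgp_bimodule.intro bimodule.intro fgp_bimodule_axioms.intro left_module_Q ring_axioms)
  show "retract S (power_module Q n) (row_module S n)" for n
    unfolding power_Q by (rule retractI[OF mod_hom_id mod_hom_id refl])
qed (auto simp: S.l_distr S.r_distr S.m_assoc)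

abbreviation red :: "('a, 'm) module \<Rightarrow> ('a set, ('a set \<times> 'm \<Rightarrow>\<^sub>0 int) set) module"
  where "red M \<equiv> tensor R (quotient_bimodule R (corner_ideal R e)) M"

text \<open>It plays the role of the quotient map from \<open>M\<close> to M/(ReR)M: it is onto by
  \<open>cls_surj\<close>, kills the span by \<open>cls_span\<close>, and for finitely generated
  projective \<open>M\<close> kills nothing else by \<open>cls_zero_imp_span\<close>.\<close>

definition cls :: "('a, 'm) module \<Rightarrow> 'm \<Rightarrow> ('a set \<times> 'm \<Rightarrow>\<^sub>0 int) set"
  where "cls M x = tens R (quotient_bimodule R (corner_ideal R e)) M \<one>\<^bsub>R Quot corner_ideal R e\<^esub> x"

lemma left_module_red: "left_module R M \<Longrightarrow> left_module S (red M)"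
  by (rule tensor_product.left_module_tensor[OF Q.tensor_product])

context
  fixes M :: "('a, 'm) module"
  assumes M: "left_module R M"
begin

interpretation M: left_module R M by (fact M)

interpretation T: tensor_product S R Q M by (rule Q.tensor_product[OF M])

lemma tens_eq_cls:
  assumes "r \<in> carrier R" "x \<in> carrier M"
  shows "tens R Q M (pr r) x = cls M (r \<odot>\<^bsub>M\<^esub> x)"
  using T.tens_rsmult[of "\<one>\<^bsub>S\<^esub>" r x] assms by (simp add: cls_def)

lemma cls_closed: "x \<in> carrier M \<Longrightarrow> cls M x \<in> carrier (red M)"
  unfolding cls_def by (rule T.tens_closed) simp_all

lemma cls_add: "x \<in> carrier M \<Longrightarrow> y \<in> carrier M \<Longrightarrow> cls M (x \<oplus>\<^bsub>M\<^esub> y) = cls M x \<oplus>\<^bsub>red M\<^esub> cls M y"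
  unfolding cls_def by (rule T.tens_add_right) simp_all

lemma cls_smult:
  assumes "r \<in> carrier R" "x \<in> carrier M" shows "cls M (r \<odot>\<^bsub>M\<^esub> x) = pr r \<odot>\<^bsub>red M\<^esub> cls M x"
  using T.smult_tens[of "pr r" "\<one>\<^bsub>S\<^esub>" x] assms by (simp add: tens_eq_cls[symmetric]) (simp add: cls_def)

lemma cls_add_hom: "cls M \<in> hom (add_monoid M) (add_monoid (red M))"
  by (auto simp: hom_add_monoid_iff cls_closed cls_add)

lemma cls_surj: "t \<in> carrier (red M) \<Longrightarrow> \<exists>x\<in>carrier M. t = cls M x"
proof (induction rule: T.tensor_induct)
  case zero
  show ?case using add_hom_zero[OF M.M.abelian_group_axioms T.abelian_group_tensor cls_add_hom]
    by (metis M.M.zero_closed)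
next
  case (tens s x)
  then obtain r where "r \<in> carrier R" "s = pr r" using pr_surj by auto
  then show ?case using tens tens_eq_cls[of r x] by (intro bexI[of _ "r \<odot>\<^bsub>M\<^esub> x"]) simp_all
next
  case (minus t u)
  then obtain x y where "x \<in> carrier M" "t = cls M x" "y \<in> carrier M" "u = cls M y" by blast
  then show ?case
    using add_hom_minus[OF M.M.abelian_group_axioms T.abelian_group_tensor cls_add_hom]
    by (intro bexI[of _ "x \<ominus>\<^bsub>M\<^esub> y"]) simp_all
qed

lemma cls_span: "x \<in> ideal_span M \<Longrightarrow> cls M x = \<zero>\<^bsub>red M\<^esub>"
proof -
  assume "x \<in> ideal_span M"
  then have "cls M x = \<zero>\<^bsub>red M\<^esub> \<and> x \<in> carrier M"
  proof (induction rule: ideal_span_induct[OF M, consumes 1, case_names zero gen add])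
    case zero
    show ?case using add_hom_zero[OF M.M.abelian_group_axioms T.abelian_group_tensor cls_add_hom] by simp
  next
    case (gen r y)
    have "cls M ((r \<otimes> e) \<odot>\<^bsub>M\<^esub> y) = \<zero>\<^bsub>S\<^esub> \<odot>\<^bsub>red M\<^esub> cls M y"
      using gen cls_smult[of "r \<otimes> e" y] pr_e[of r] by (simp del: pr_simps)
    then show ?case using gen cls_closed T.T.smult_l_null[of "cls M y"] by simp
  next
    case (add x y)
    then show ?case by (simp add: cls_add)
  qed
  then show ?thesis ..
qed

text \<open>Each coordinate of the section \<open>s\<close> induces an additive map from the
  reduction to the quotient ring, sending \<open>cls M x\<close> to the residue of
  \<open>s x i\<close>. If the class vanishes, all coordinates of \<open>x\<close> lie in the ideal,
  and expanding \<open>x\<close> in generators puts it into the span.\<close>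

lemma cls_zero_imp_span:
  assumes fgp: "fgp_module R M" and x: "x \<in> carrier M" and zero: "cls M x = \<zero>\<^bsub>red M\<^esub>"
  shows "x \<in> ideal_span M"
proof -
  obtain n where "retract R M (row_module R n)" using fgp by (rule fgp_moduleE)
  then obtain s q where s: "s \<in> mod_hom R M (row_module R n)" and q: "q \<in> mod_hom R (row_module R n) M"
    and qs: "\<forall>x\<in>carrier M. q (s x) = x" by (rule retractE)
  have sR: "s y i \<in> carrier R" if "y \<in> carrier M" for y i
    using mod_homD(1)[OF s that] by (simp add: row_module_iff)
  have I: "s x i \<in> I" for i
  proof -
    have bal: "balanced_map R Q M (regular_module S) (\<lambda>b y. b \<otimes>\<^bsub>S\<^esub> pr (s y i))"
      using sR mod_homD(2,3)[OF s] by (auto simp: balanced_map_def S.l_distr S.r_distr S.m_assoc)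
    have ab: "abelian_group (regular_module S)"
      using left_module_regular[OF ring_S] by (simp add: left_module_def)
    obtain h where h: "h \<in> hom (add_monoid (red M)) (add_monoid (regular_module S))"
      "\<forall>b\<in>carrier Q. \<forall>y\<in>carrier M. h (tens R Q M b y) = b \<otimes>\<^bsub>S\<^esub> pr (s y i)"
      using T.tensor_lift_add[OF ab bal] by (elim bexE)
    have "h (cls M x) = pr (s x i)"
      using h(2)[rule_format, of "\<one>\<^bsub>S\<^esub>" x] x sR[OF x] unfolding cls_def by simp
    moreover have "h \<zero>\<^bsub>red M\<^esub> = \<zero>\<^bsub>S\<^esub>"
      using add_hom_zero[OF T.abelian_group_tensor ab h(1)] by simp
    ultimately have "pr (s x i) = \<zero>\<^bsub>S\<^esub>" using zero by simp
    then show ?thesis by (rule pr_zero_iff[OF sR[OF x], THEN iffD1])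
  qed
  have "row_comb M n (\<lambda>i. q (unit_row R i)) (s x) \<in> ideal_span M"
    unfolding row_comb_def
  proof (rule finsum_mem_subset[OF M.M.abelian_group_axioms])
    show "ideal_span M \<subseteq> carrier M" using ideal_span_closed[OF M] by blast
    show "s x i \<odot>\<^bsub>M\<^esub> q (unit_row R i) \<in> ideal_span M" if "i \<in> {..<n}" for i
      using I that by (intro ideal_smult[OF M] mod_homD(1)[OF q] unit_row_closed[OF ring_axioms]) simp_all
  qed (auto intro: ideal_span_zero[OF M] ideal_span_add[OF M])
  then show ?thesis
    using mod_hom_row_module[OF M q mod_homD(1)[OF s x]] qs x by simp
qed

text \<open>The retraction from a power of \<open>Re\<close> covers \<open>M\<close> and takes
  values in the span only.\<close>

lemma red_trivial:
  assumes "retract R M (Z n)" shows "carrier (red M) = {\<zero>\<^bsub>red M\<^esub>}"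
proof -
  obtain s q where s: "s \<in> mod_hom R M (Z n)" "q \<in> mod_hom R (Z n) M" "\<forall>x\<in>carrier M. q (s x) = x"
    using assms by (rule retractE)
  have "cls M x = \<zero>\<^bsub>red M\<^esub>" if "x \<in> carrier M" for x
    using cls_span[OF Z_hom_ideal_span[OF M s(2) mod_homD(1)[OF s(1) that]]] s(3) that by simp
  then have "t = \<zero>\<^bsub>red M\<^esub>" if "t \<in> carrier (red M)" for t using cls_surj[OF that] by auto
  then show ?thesis using T.T.zero_closed by blast
qed

end

text \<open>The values of \<open>\<theta>\<close> on the classes of finitely many generators are
  lifted one at a time along the surjection \<open>cls N\<close>. Relations among the generators
  cause no conflict, since the lift is defined on the free module and composed with the section of
  \<open>M\<close>.\<close>

lemma lift_red_hom:
  assumes M: "fgp_module R M" and N: "left_module R N" and \<theta>: "\<theta> \<in> mod_hom S (red M) (red N)"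
  shows "\<exists>f\<in>mod_hom R M N. \<forall>x\<in>carrier M. cls N (f x) = \<theta> (cls M x)"
proof -
  have M': "left_module R M" using M by (rule fgp_left_module)
  interpret M: left_module R M by (fact M')
  interpret N: left_module R N by (fact N)
  interpret TM: left_module S "red M" by (rule left_module_red[OF M'])
  interpret TN: left_module S "red N" by (rule left_module_red[OF N])
  obtain n where "retract R M (row_module R n)" using M by (rule fgp_moduleE)
  then obtain s q where s: "s \<in> mod_hom R M (row_module R n)" and q: "q \<in> mod_hom R (row_module R n) M"
    and qs: "\<forall>x\<in>carrier M. q (s x) = x" by (rule retractE)
  let ?x = "\<lambda>i. q (unit_row R i)"
  have x: "?x i \<in> carrier M" if "i < n" for i
    by (rule mod_homD(1)[OF q unit_row_closed[OF ring_axioms that]])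
  have "\<forall>i<n. \<exists>y\<in>carrier N. \<theta> (cls M (?x i)) = cls N y"
    using cls_surj[OF N mod_homD(1)[OF \<theta> cls_closed[OF M' x]]] by simp
  then obtain y where y: "\<And>i. i < n \<Longrightarrow> y i \<in> carrier N" "\<And>i. i < n \<Longrightarrow> \<theta> (cls M (?x i)) = cls N (y i)"
    by metis
  have f: "(\<lambda>x. row_comb N n y (s x)) \<in> mod_hom R M N"
    by (rule mod_hom_comp[OF s row_comb_hom[OF N y(1)]])
  have "cls N (row_comb N n y (s z)) = \<theta> (cls M z)" if z: "z \<in> carrier M" for z
  proof -
    have sR: "s z i \<in> carrier R" for i using mod_homD(1)[OF s z] by (simp add: row_module_iff)
    have "cls N (row_comb N n y (s z)) = finsum (red N) (\<lambda>i. cls N (s z i \<odot>\<^bsub>N\<^esub> y i)) {..<n}"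
      unfolding row_comb_def using sR y(1)
      by (intro add_hom_finsum[OF N.M.abelian_group_axioms TN.M.abelian_group_axioms cls_add_hom[OF N]]) simp_all
    also have "\<dots> = finsum (red N) (\<lambda>i. \<theta> (cls M (s z i \<odot>\<^bsub>M\<^esub> ?x i))) {..<n}"
    proof (rule TN.M.finsum_cong')
      show "(\<lambda>i. \<theta> (cls M (s z i \<odot>\<^bsub>M\<^esub> ?x i))) \<in> {..<n} \<rightarrow> carrier (red N)"
        using sR x by (intro Pi_I mod_homD(1)[OF \<theta>] cls_closed[OF M']) simp
      show "cls N (s z i \<odot>\<^bsub>N\<^esub> y i) = \<theta> (cls M (s z i \<odot>\<^bsub>M\<^esub> ?x i))" if "i \<in> {..<n}" for i
        using sR y x that
        by (simp add: cls_smult[OF N] cls_smult[OF M'] mod_homD(3)[OF \<theta>] cls_closed[OF M'])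
    qed simp
    also have "\<dots> = \<theta> (finsum (red M) (\<lambda>i. cls M (s z i \<odot>\<^bsub>M\<^esub> ?x i)) {..<n})"
      using sR x by (intro mod_hom_finsum[OF left_module_red[OF M'] left_module_red[OF N] \<theta>, symmetric])
        (simp_all add: cls_closed[OF M'])
    also have "finsum (red M) (\<lambda>i. cls M (s z i \<odot>\<^bsub>M\<^esub> ?x i)) {..<n} = cls M (row_comb M n ?x (s z))"
      unfolding row_comb_def using sR x
      by (intro add_hom_finsum[OF M.M.abelian_group_axioms TM.M.abelian_group_axioms cls_add_hom[OF M'],
            symmetric]) simp_all
    also have "row_comb M n ?x (s z) = z"
      using mod_hom_row_module[OF M' q mod_homD(1)[OF s z]] qs z by simp
    finally show ?thesis .
  qed
  then show ?thesis by (intro bexI[OF _ f] ballI)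
qed

text \<open>Lifting an isomorphism and its inverse to \<open>f\<close> and \<open>g\<close>, the defect \<open>1 - f g\<close> factors as
  \<open>u w\<close> through a power of \<open>Re\<close>; then \<open>(f, u)\<close> is a split surjection with section \<open>(g, w)\<close>.\<close>

lemma red_isomorphic_imp:
  assumes M: "fgp_module R M" and N: "fgp_module R N"
    and iso: "isomorphic_modules S (red M) (red N)"
  shows "\<exists>n m. \<exists>K :: ('a, 'm \<times> (nat \<Rightarrow> 'a)) module. left_module R K \<and> retract R K (Z m) \<and>
    isomorphic_modules R (direct_sum N K) (direct_sum (M :: ('a, 'm) module) (Z n))"
proof -
  have M': "left_module R M" and N': "left_module R N" using M N by (auto intro: fgp_left_module)
  interpret M: left_module R M by (fact M')
  interpret N: left_module R N by (fact N')
  interpret TN: left_module S "red N" by (rule left_module_red[OF N'])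
  obtain \<theta> \<theta>' where \<theta>: "\<theta> \<in> mod_hom S (red M) (red N)" "\<theta>' \<in> mod_hom S (red N) (red M)"
    "\<forall>x\<in>carrier (red M). \<theta>' (\<theta> x) = x" "\<forall>y\<in>carrier (red N). \<theta> (\<theta>' y) = y"
    using isomorphic_modulesE[OF iso left_module_red[OF M'] left_module_red[OF N']] .
  obtain f where f: "f \<in> mod_hom R M N" "\<forall>x\<in>carrier M. cls N (f x) = \<theta> (cls M x)"
    using lift_red_hom[OF M N' \<theta>(1)] by blast
  obtain g where g: "g \<in> mod_hom R N M" "\<forall>x\<in>carrier N. cls M (g x) = \<theta>' (cls N x)"
    using lift_red_hom[OF N M' \<theta>(2)] by blast
  note fgc = mod_homD(1)[OF f(1)] mod_homD(1)[OF g(1)]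
  have d: "(\<lambda>y. y \<ominus>\<^bsub>N\<^esub> f (g y)) \<in> mod_hom R N N"
    by (rule mod_hom_diff[OF N' N' mod_hom_id mod_hom_comp[OF g(1) f(1)]])
  have "y \<ominus>\<^bsub>N\<^esub> f (g y) \<in> ideal_span N" if y: "y \<in> carrier N" for y
  proof (rule cls_zero_imp_span[OF N' N])
    have "cls N (f (g y)) = cls N y" using f(2) g(2) y fgc \<theta>(4) cls_closed[OF N' y] by simp
    then show "cls N (y \<ominus>\<^bsub>N\<^esub> f (g y)) = \<zero>\<^bsub>red N\<^esub>"
      using add_hom_minus[OF N.M.abelian_group_axioms TN.M.abelian_group_axioms cls_add_hom[OF N'] y, of "f (g y)"]
        fgc y cls_closed[OF N' y] by (simp add: TN.M.minus_eq_zero_iff)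
  qed (use y fgc in simp)
  then obtain n u w where u: "u \<in> mod_hom R (Z n) N" and w: "w \<in> mod_hom R N (Z n)"
    and uw: "\<forall>y\<in>carrier N. y \<ominus>\<^bsub>N\<^esub> f (g y) = u (w y)"
    using factor_through_Z[OF N N' d] by blast
  let ?W = "direct_sum M (Z n)"
  let ?h = "\<lambda>(x, z). f x \<oplus>\<^bsub>N\<^esub> u z" and ?t = "\<lambda>y. (g y, w y)"
  note uwc = mod_homD(1)[OF u] mod_homD(1)[OF w]
  have W: "fgp_module R ?W" "left_module R ?W"
    by (intro fgp_direct_sum M fgp_Z fgp_left_module)+
  interpret W: left_module R ?W by (fact W)
  have h: "?h \<in> mod_hom R ?W N"
    unfolding mod_hom_def
    using fgc uwc mod_homD(2,3)[OF f(1)] mod_homD(2,3)[OF u]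
    by (auto simp: N.smult_r_distr N.M.a_ac simp del: power_module_simps)
  have t: "?t \<in> mod_hom R N ?W"
    unfolding mod_hom_def using fgc uwc mod_homD(2,3)[OF g(1)] mod_homD(2,3)[OF w]
    by (auto simp del: power_module_simps)
  have ht: "?h (?t y) = y" if "y \<in> carrier N" for y
    using uw[rule_format, OF that, symmetric] that fgc by (simp add: N.M.add_minus_cancel)
  let ?K = "kernel_module ?W N ?h"
  have K: "left_module R ?K" by (rule left_module_kernel[OF W(2) N' h])
  have fgpK: "fgp_module R ?K" by (rule fgp_kernel_module[OF W(1) N' h t ht])
  \<comment> \<open>The projection onto the kernel along the section \<open>?t\<close>. Lying in the
    span of \<open>?W\<close> does not by itself place an element of the kernel in the span of
    \<open>?K\<close>; the projection, a linear map fixing the kernel, carries it there.\<close>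
  let ?r = "\<lambda>x. x \<ominus>\<^bsub>?W\<^esub> ?t (?h x)"
  have r: "?r \<in> mod_hom R ?W ?W"
    by (rule mod_hom_diff[OF W(2) W(2) mod_hom_id mod_hom_comp[OF h t]])
  have hr: "?h (?r x) = \<zero>\<^bsub>N\<^esub>" if "x \<in> carrier ?W" for x
    using mod_hom_minus[OF W(2) N' h that mod_homD(1)[OF t mod_homD(1)[OF h that]]]
      ht[OF mod_homD(1)[OF h that]] mod_homD(1)[OF h that] by (simp add: N.M.minus_eq_zero_iff)
  have rK: "?r \<in> mod_hom R ?W ?K"
    using hr mod_homD[OF r] by (auto simp: mod_hom_def simp del: direct_sum_simps)
  have span: "k \<in> ideal_span ?K" if k: "k \<in> carrier ?K" for k
  proof -
    obtain x z where xz: "k = (x, z)" "x \<in> carrier M" "z \<in> carrier (Z n)" "f x \<oplus>\<^bsub>N\<^esub> u z = \<zero>\<^bsub>N\<^esub>"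
      using k by auto
    \<comment> \<open>Modulo the ideal the map \<open>u\<close> vanishes and \<open>f\<close> is the
      isomorphism \<open>\<theta>\<close>, so the first component of an element of the kernel has
      class zero.\<close>
    have "cls N (f x) \<oplus>\<^bsub>red N\<^esub> cls N (u z) = \<zero>\<^bsub>red N\<^esub>"
      using cls_add[OF N', of "f x" "u z"] xz fgc uwc
        add_hom_zero[OF N.M.abelian_group_axioms TN.M.abelian_group_axioms cls_add_hom[OF N']] by simp
    moreover have "cls N (u z) = \<zero>\<^bsub>red N\<^esub>" by (rule cls_span[OF N' Z_hom_ideal_span[OF N' u xz(3)]])
    ultimately have "\<theta> (cls M x) = \<zero>\<^bsub>red N\<^esub>"
      using f(2) xz(2) cls_closed[OF N' fgc(1)[OF xz(2)]] by simp
    then have "cls M x = \<zero>\<^bsub>red M\<^esub>"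
      using \<theta>(3) cls_closed[OF M' xz(2)] mod_hom_zero[OF left_module_red[OF N'] left_module_red[OF M'] \<theta>(2)]
      by metis
    then have "x \<in> ideal_span M" by (rule cls_zero_imp_span[OF M' M xz(2)])
    moreover have "(\<lambda>x. (x, \<zero>\<^bsub>Z n\<^esub>)) \<in> mod_hom R M ?W" by (auto simp: mod_hom_def Z_iff)
    ultimately have 1: "(x, \<zero>\<^bsub>Z n\<^esub>) \<in> ideal_span ?W" using ideal_span_hom[OF M' W(2)] by blast
    have "(\<lambda>z. (\<zero>\<^bsub>M\<^esub>, z)) \<in> mod_hom R (Z n) ?W" by (auto simp: mod_hom_def M.smult_r_null)
    from Z_hom_ideal_span[OF W(2) this xz(3)] have 2: "(\<zero>\<^bsub>M\<^esub>, z) \<in> ideal_span ?W" .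
    have "k \<in> ideal_span ?W"
      using ideal_span_add[OF W(2) 1 2] xz by (simp add: Z_iff)
    from ideal_span_hom[OF W(2) K rK this] have "?r k \<in> ideal_span ?K" .
    moreover have "?r k = k"
    proof -
      have "?h k = \<zero>\<^bsub>N\<^esub>" using xz by simp
      then have "?r k = k \<ominus>\<^bsub>?W\<^esub> \<zero>\<^bsub>?W\<^esub>" using mod_hom_zero[OF N' W(2) t] by simp
      moreover have kW: "k \<in> carrier ?W" using k by auto
      then have "\<zero>\<^bsub>?W\<^esub> \<oplus>\<^bsub>?W\<^esub> (k \<ominus>\<^bsub>?W\<^esub> \<zero>\<^bsub>?W\<^esub>) = k"
        by (intro W.M.add_minus_cancel W.M.zero_closed)
      moreover have "\<zero>\<^bsub>?W\<^esub> \<oplus>\<^bsub>?W\<^esub> (k \<ominus>\<^bsub>?W\<^esub> \<zero>\<^bsub>?W\<^esub>) = k \<ominus>\<^bsub>?W\<^esub> \<zero>\<^bsub>?W\<^esub>"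
        by (intro W.M.l_zero W.M.minus_closed kW W.M.zero_closed)
      ultimately show ?thesis by (simp only:)
    qed
    ultimately show ?thesis by simp
  qed
  \<comment> \<open>The kernel equals its own span, so its identity map factors through a power of
    \<open>Re\<close>; such a factorization exhibits it as a summand.\<close>
  obtain m u' w' where u': "u' \<in> mod_hom R (Z m) ?K" and w': "w' \<in> mod_hom R ?K (Z m)"
    and id: "\<forall>k\<in>carrier ?K. k = u' (w' k)"
    using factor_through_Z[OF fgpK K mod_hom_id span] by blast
  have "retract R ?K (Z m)"
    by (rule retractI[OF w' u']) (rule bspec[OF id, symmetric])
  moreover have "isomorphic_modules R (direct_sum N ?K) ?W"
    by (rule retract_direct_sum[OF W(2) N' h t ht])
  ultimately show ?thesis using K by (intro exI conjI)
qed

end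

lemma (in abelian_group) add_minus_eq:
  "x \<in> carrier G \<Longrightarrow> y \<in> carrier G \<Longrightarrow> (x \<oplus> y) \<ominus> y = x"
  by (simp add: a_minus_def a_assoc r_neg)

lemma (in abelian_group) minus_add_cancel:
  "x \<in> carrier G \<Longrightarrow> y \<in> carrier G \<Longrightarrow> (x \<ominus> y) \<oplus> y = x"
  by (simp add: a_minus_def a_assoc l_neg)

section \<open>Injectivity\<close>

text \<open>If \<open>f (x, y) = (m (x, y), y + u (w (x, y)))\<close> is bijective, then so is
  \<open>(x, z) \<mapsto> (m (x, u z), z + w (x, u z))\<close>, just as \<open>1 + u w\<close> and \<open>1 + w u\<close> are invertible together.\<close>

lemma direct_sum_exchange:
  assumes A: "left_module R A" and B: "left_module R B" and Y: "left_module R Y" and Z: "left_module R Z"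
    and f: "f \<in> mod_hom R (direct_sum A Y) (direct_sum B Y)"
    and g: "\<And>p. p \<in> carrier (direct_sum B Y) \<Longrightarrow> g p \<in> carrier (direct_sum A Y)"
    and gf: "\<And>p. p \<in> carrier (direct_sum A Y) \<Longrightarrow> g (f p) = p"
    and fg: "\<And>p. p \<in> carrier (direct_sum B Y) \<Longrightarrow> f (g p) = p"
    and u: "u \<in> mod_hom R Z Y" and w: "w \<in> mod_hom R (direct_sum A Y) Z"
    and snd_f: "\<And>x y. x \<in> carrier A \<Longrightarrow> y \<in> carrier Y \<Longrightarrow> snd (f (x, y)) = y \<oplus>\<^bsub>Y\<^esub> u (w (x, y))"
  shows "isomorphic_modules R (direct_sum A Z) (direct_sum B Z)"
proof -
  interpret A: left_module R A by fact
  interpret B: left_module R B by fact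
  interpret Y: left_module R Y by fact
  interpret Z: left_module R Z by fact
  note uc = mod_homD[OF u]
  have wc: "w (x, y) \<in> carrier Z" if "x \<in> carrier A" "y \<in> carrier Y" for x y
    using mod_homD(1)[OF w, of "(x, y)"] that by simp
  have fc: "fst (f (x, y)) \<in> carrier B" if "x \<in> carrier A" "y \<in> carrier Y" for x y
    using mod_homD(1)[OF f, of "(x, y)"] that by auto
  have f_eq: "f (x, y) = (fst (f (x, y)), y \<oplus>\<^bsub>Y\<^esub> u (w (x, y)))" if "x \<in> carrier A" "y \<in> carrier Y" for x y
    using snd_f[OF that] by (metis prod.collapse)
  have ui: "(\<lambda>(x, z). (x, u z)) \<in> mod_hom R (direct_sum A Z) (direct_sum A Y)"
    using uc by (auto simp: mod_hom_def)
  have 1: "(\<lambda>p. fst (f (case p of (x, z) \<Rightarrow> (x, u z)))) \<in> mod_hom R (direct_sum A Z) B"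
    by (rule mod_hom_comp[OF mod_hom_comp[OF ui f]]) (auto simp: mod_hom_def)
  have 2: "(\<lambda>p. w (case p of (x, z) \<Rightarrow> (x, u z))) \<in> mod_hom R (direct_sum A Z) Z"
    by (rule mod_hom_comp[OF ui w])
  let ?\<beta> = "\<lambda>(x, z). (fst (f (x, u z)), z \<oplus>\<^bsub>Z\<^esub> w (x, u z))"
  \<comment> \<open>If \<open>f (x, y)\<close> has second component \<open>u z'\<close>, then
    \<open>y\<close> is \<open>u\<close> of the difference of \<open>z'\<close> and
    \<open>w (x, y)\<close>. This difference is therefore the second component of the inverse
    image.\<close>
  let ?\<gamma> = "\<lambda>(x', z'). let x = fst (g (x', u z')); y = snd (g (x', u z')) in (x, z' \<ominus>\<^bsub>Z\<^esub> w (x, y))"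
  show ?thesis
  proof (rule isomorphic_modulesI[of ?\<beta> _ _ _ ?\<gamma>])
    show "?\<beta> \<in> mod_hom R (direct_sum A Z) (direct_sum B Z)"
      unfolding mod_hom_def
    proof (intro CollectI conjI ballI Pi_I)
      fix p assume p: "p \<in> carrier (direct_sum A Z)"
      obtain x z where xz: "p = (x, z)" "x \<in> carrier A" "z \<in> carrier Z" using p by auto
      show "?\<beta> p \<in> carrier (direct_sum B Z)"
        using mod_homD(1)[OF 1 p] mod_homD(1)[OF 2 p] xz by simp
      show "?\<beta> (a \<odot>\<^bsub>direct_sum A Z\<^esub> p) = a \<odot>\<^bsub>direct_sum B Z\<^esub> ?\<beta> p" if a: "a \<in> carrier R" for a
        using mod_homD(3)[OF 1 a p] mod_homD(3)[OF 2 a p] mod_homD(1)[OF 2 p] xz a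
        by (simp add: Z.smult_r_distr)
      fix p' assume p': "p' \<in> carrier (direct_sum A Z)"
      obtain x' z' where xz': "p' = (x', z')" "x' \<in> carrier A" "z' \<in> carrier Z" using p' by auto
      show "?\<beta> (p \<oplus>\<^bsub>direct_sum A Z\<^esub> p') = ?\<beta> p \<oplus>\<^bsub>direct_sum B Z\<^esub> ?\<beta> p'"
        using mod_homD(2)[OF 1 p p'] mod_homD(2)[OF 2 p p'] mod_homD(1)[OF 2 p] mod_homD(1)[OF 2 p'] xz xz'
        by (simp add: Z.M.a_ac)
    qed
    fix p assume p: "p \<in> carrier (direct_sum B Z)"
    obtain x' z' where xz': "p = (x', z')" "x' \<in> carrier B" "z' \<in> carrier Z" using p by auto
    obtain x y where xy: "g (x', u z') = (x, y)" "x \<in> carrier A" "y \<in> carrier Y"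
      using g[of "(x', u z')"] xz' uc(1) by auto
    have fxy: "f (x, y) = (x', u z')" using fg[of "(x', u z')"] xz' uc(1) xy by simp
    have \<gamma>: "?\<gamma> p = (x, z' \<ominus>\<^bsub>Z\<^esub> w (x, y))" using xy xz' by simp
    then show "?\<gamma> p \<in> carrier (direct_sum A Z)" using xy wc xz' by simp
    have "y \<oplus>\<^bsub>Y\<^esub> u (w (x, y)) = u z'" using f_eq[OF xy(2,3)] fxy by simp
    moreover have "u (z' \<ominus>\<^bsub>Z\<^esub> w (x, y)) = u z' \<ominus>\<^bsub>Y\<^esub> u (w (x, y))"
      by (rule mod_hom_minus[OF Z Y u xz'(3) wc[OF xy(2,3)]])
    ultimately have uz: "u (z' \<ominus>\<^bsub>Z\<^esub> w (x, y)) = y"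
      using Y.M.add_minus_eq[OF xy(3) uc(1)[OF wc[OF xy(2,3)]]] by simp
    show "?\<beta> (?\<gamma> p) = p"
      unfolding \<gamma> using xz' uz fxy wc[OF xy(2,3)] by (simp add: Z.M.minus_add_cancel)
  next
    fix p assume p: "p \<in> carrier (direct_sum A Z)"
    obtain x z where xz: "p = (x, z)" "x \<in> carrier A" "z \<in> carrier Z" using p by auto
    note uz = uc(1)[OF xz(3)]
    note c = wc[OF xz(2) uz]
    have "u (z \<oplus>\<^bsub>Z\<^esub> w (x, u z)) = u z \<oplus>\<^bsub>Y\<^esub> u (w (x, u z))" by (rule uc(2)[OF xz(3) c])
    then have "f (x, u z) = (fst (f (x, u z)), u (z \<oplus>\<^bsub>Z\<^esub> w (x, u z)))"
      using f_eq[OF xz(2) uz] by simp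
    then have "g (fst (f (x, u z)), u (z \<oplus>\<^bsub>Z\<^esub> w (x, u z))) = (x, u z)"
      using gf[of "(x, u z)"] xz(2) uz by simp
    then show "?\<gamma> (?\<beta> p) = p" using xz c by (simp add: Z.M.add_minus_eq)
  qed
qed

context idempotent
begin

lemma retract_Z_span:
  assumes "left_module R M" "left_module R N" "retract R M (Z n)" "h \<in> mod_hom R M N" "x \<in> carrier M"
  shows "h x \<in> ideal_span N"
proof -
  obtain s q where s: "s \<in> mod_hom R M (Z n)" "q \<in> mod_hom R (Z n) M" "\<forall>x\<in>carrier M. q (s x) = x"
    using assms(3) by (rule retractE)
  show ?thesis
    using Z_hom_ideal_span[OF assms(2) mod_hom_comp[OF s(2) assms(4)] mod_homD(1)[OF s(1) assms(5)]]
      s(3) assms(5) by simp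
qed

lemma span_row_iff:
  assumes v: "v \<in> carrier (row_module R n)"
  shows "v \<in> ideal_span (row_module R n) \<longleftrightarrow> (\<forall>i. v i \<in> I)"
proof
  note X = left_module_row[OF ring_axioms, of n]
  interpret X: left_module R "row_module R n" by (rule X)
  show "\<forall>i. v i \<in> I" if "v \<in> ideal_span (row_module R n)"
    using ideal_span_hom[OF X left_module_regular_R row_coordinate_hom[OF ring_axioms] that]
    unfolding corner_ideal_eq by blast
  assume I: "\<forall>i. v i \<in> I"
  have "row_comb (row_module R n) n (unit_row R) v \<in> ideal_span (row_module R n)"
    unfolding row_comb_def
  proof (rule finsum_mem_subset[OF X.M.abelian_group_axioms])
    show "ideal_span (row_module R n) \<subseteq> carrier (row_module R n)" using ideal_span_closed[OF X] by blast
    show "v i \<odot>\<^bsub>row_module R n\<^esub> unit_row R i \<in> ideal_span (row_module R n)" if "i \<in> {..<n}" for i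
      using I that by (intro ideal_smult[OF X] unit_row_closed[OF ring_axioms]) simp_all
  qed (fact ideal_span_zero[OF X] ideal_span_add[OF X] finite_lessThan)+
  then show "v \<in> ideal_span (row_module R n)" using row_module_expand[OF ring_axioms v] by simp
qed

lemma pr_add_span:
  assumes "v \<in> ideal_span (row_module R n)" "u \<in> carrier (row_module R n)"
  shows "pr ((v \<oplus>\<^bsub>row_module R n\<^esub> u) i) = pr (u i)"
proof -
  have v: "v \<in> carrier (row_module R n)"
    by (rule ideal_span_closed[OF left_module_row[OF ring_axioms] assms(1)])
  then have "v i \<in> carrier R" "u i \<in> carrier R" using assms(2) by (simp_all add: row_module_iff)
  moreover have "pr (v i) = \<zero>\<^bsub>S\<^esub>"
    using span_row_iff[OF v] assms(1) pr_zero_iff[OF \<open>v i \<in> carrier R\<close>] by simp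
  ultimately show ?thesis by simp
qed

lemma diff_span:
  assumes c: "c \<in> carrier (row_module R n)" and u: "u \<in> carrier (row_module R n)"
    and pr: "\<And>i. pr (c i) = pr (u i)"
  shows "c \<ominus>\<^bsub>row_module R n\<^esub> u \<in> ideal_span (row_module R n)"
proof -
  let ?Y = "row_module R n"
  interpret Y: left_module R ?Y by (rule left_module_row[OF ring_axioms])
  let ?k = "c \<ominus>\<^bsub>?Y\<^esub> u"
  have k: "?k \<in> carrier ?Y" using c u by simp
  have "?k i \<in> I" for i
  proof -
    have R: "c i \<in> carrier R" "u i \<in> carrier R" "?k i \<in> carrier R"
      using c u k by (simp_all add: row_module_iff)
    have "c = ?k \<oplus>\<^bsub>?Y\<^esub> u" by (rule Y.M.minus_add_cancel[OF c u, symmetric])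
    then have e: "c i = ?k i \<oplus> u i" by (metis power_module_simps(2) regular_module_simps(3))
    have "pr (u i) = pr (?k i) \<oplus>\<^bsub>S\<^esub> pr (u i)" using pr[of i] unfolding e using R by simp
    then have "pr (?k i) = \<zero>\<^bsub>S\<^esub>" using S.add.r_cancel_one'[of "pr (u i)" "pr (?k i)"] R by simp
    then show ?thesis using pr_zero_iff[OF R(3)] by simp
  qed
  then show ?thesis using span_row_iff[OF k] by simp
qed

text \<open>In block form the lower right entry of \<open>g f = 1\<close> is g22 f22 + g21 f12. The
  second product passes through \<open>B\<close>, a summand of a power of \<open>Re\<close>, so it
  vanishes modulo the ideal.\<close>

lemma block_inverse:
  assumes A: "left_module R A" and B: "left_module R B" "retract R B (Z b)"
    and f: "f \<in> mod_hom R (direct_sum A (row_module R n)) (direct_sum B (row_module R n))"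
    and g: "g \<in> mod_hom R (direct_sum B (row_module R n)) (direct_sum A (row_module R n))"
    and gf: "\<forall>p\<in>carrier (direct_sum A (row_module R n)). g (f p) = p"
    and u: "u \<in> carrier (row_module R n)"
  shows "pr (snd (g (\<zero>\<^bsub>B\<^esub>, snd (f (\<zero>\<^bsub>A\<^esub>, u)))) i) = pr (u i)"
proof -
  interpret A: left_module R A by (fact A)
  interpret B: left_module R B by (fact B)
  let ?Y = "row_module R n"
  note Y = left_module_row[OF ring_axioms, of n]
  interpret Y: left_module R ?Y by (rule Y)
  obtain y v where yv: "f (\<zero>\<^bsub>A\<^esub>, u) = (y, v)" "y \<in> carrier B" "v \<in> carrier ?Y"
    using mod_homD(1)[OF f, of "(\<zero>\<^bsub>A\<^esub>, u)"] u by auto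
  have i: "(\<lambda>y. snd (g (y, \<zero>\<^bsub>?Y\<^esub>))) \<in> mod_hom R B ?Y"
    by (rule mod_hom_comp[OF mod_hom_comp[OF _ g]])
      (auto simp: mod_hom_def power_module_iff)
  have "g (y, v) = g (y, \<zero>\<^bsub>?Y\<^esub>) \<oplus>\<^bsub>direct_sum A ?Y\<^esub> g (\<zero>\<^bsub>B\<^esub>, v)"
    using mod_homD(2)[OF g, of "(y, \<zero>\<^bsub>?Y\<^esub>)" "(\<zero>\<^bsub>B\<^esub>, v)"] yv Y.M.zero_closed Y.M.r_zero[OF yv(3)] Y.M.l_zero[OF yv(3)]
    by (simp del: power_module_simps)
  moreover have "g (y, v) = (\<zero>\<^bsub>A\<^esub>, u)" using gf u yv(1) by force
  moreover have "g (y, \<zero>\<^bsub>?Y\<^esub>) \<in> carrier (direct_sum A ?Y)" "g (\<zero>\<^bsub>B\<^esub>, v) \<in> carrier (direct_sum A ?Y)"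
    using mod_homD(1)[OF g] yv Y.M.zero_closed by (simp_all del: power_module_simps)
  ultimately have "u = snd (g (y, \<zero>\<^bsub>?Y\<^esub>)) \<oplus>\<^bsub>?Y\<^esub> snd (g (\<zero>\<^bsub>B\<^esub>, v))" "snd (g (\<zero>\<^bsub>B\<^esub>, v)) \<in> carrier ?Y"
    by (auto simp del: power_module_simps)
  then show ?thesis
    using pr_add_span[OF retract_Z_span[OF B(1) Y B(2) i yv(2)], of "snd (g (\<zero>\<^bsub>B\<^esub>, v))" i] yv(1) by simp
qed

end

section \<open>Lifting endomorphisms of R^n along the section\<close>

locale split_idempotent = idempotent +
  fixes \<sigma> :: "'a set \<Rightarrow> 'a"
  assumes \<sigma>_hom: "\<sigma> \<in> ring_hom (R Quot corner_ideal R e) R"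
    and pr_\<sigma>: "x \<in> carrier (R Quot corner_ideal R e) \<Longrightarrow> corner_ideal R e +>\<^bsub>R\<^esub> \<sigma> x = x"
begin

text \<open>The endomorphism of R that reduces and lifts back. Its kernel is the ideal, and with it
  the lifting of reduced matrices becomes a base change from R to R.\<close>

definition ret :: "'a \<Rightarrow> 'a" where "ret r = \<sigma> (pr r)"

lemma ret_hom: "ret \<in> ring_hom R R"
  using ring_hom_trans[OF pr_hom \<sigma>_hom] by (simp add: ret_def[abs_def] comp_def)

lemma pr_ret: "r \<in> carrier R \<Longrightarrow> pr (ret r) = pr r"
  by (simp add: ret_def pr_\<sigma>)



abbreviation lift :: "nat \<Rightarrow> ((nat \<Rightarrow> 'a) \<Rightarrow> nat \<Rightarrow> 'a) \<Rightarrow> (nat \<Rightarrow> 'a) \<Rightarrow> nat \<Rightarrow> 'a"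
  where "lift n d \<equiv> base_change R R ret n d"

lemmas lift_hom = base_change_hom[OF ring_axioms ring_axioms ret_hom]

text \<open>Congruent entries have equal images under \<open>ret\<close>, so maps that are inverse
  to each other only modulo the ideal acquire lifts that compose exactly to the identity.\<close>

lemma lift_inverse:
  assumes "d \<in> mod_hom R (row_module R n) (row_module R n)" "d' \<in> mod_hom R (row_module R n) (row_module R n)"
    "\<And>u j. u \<in> carrier (row_module R n) \<Longrightarrow> pr (d' (d u) j) = pr (u j)" "v \<in> carrier (row_module R n)"
  shows "lift n d' (lift n d v) = v"
proof (rule base_change_inverse[OF ring_axioms ring_axioms ret_hom assms(1,2) _ assms(4)])
  show "ret (d' (d u) j) = ret (u j)" if "u \<in> carrier (row_module R n)" for u j
    using assms(3)[OF that, of j] by (simp only: ret_def)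
qed

text \<open>A row \<open>v\<close> differs from the row of the \<open>ret (v j)\<close> by an
  element of the span, which \<open>lift n d\<close> keeps in the span; on the second row
  \<open>lift n d\<close> is computed by applying \<open>ret\<close> to \<open>d v\<close>, and
  \<open>ret\<close> does not change residues.\<close>

lemma pr_lift:
  assumes d: "d \<in> mod_hom R (row_module R n) (row_module R n)" and v: "v \<in> carrier (row_module R n)"
  shows "pr (lift n d v i) = pr (d v i)"
proof -
  let ?Y = "row_module R n"
  note Y = left_module_row[OF ring_axioms, of n]
  interpret Y: left_module R ?Y by (rule Y)
  have vR: "v j \<in> carrier R" for j using v by (simp add: row_module_iff)
  let ?rv = "\<lambda>j. ret (v j)"
  have rv: "?rv \<in> carrier ?Y" by (rule row_module_hom_closed[OF ring_axioms ring_axioms ret_hom v])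
  have w: "v \<ominus>\<^bsub>?Y\<^esub> ?rv \<in> carrier ?Y" using v rv by simp
  have "v \<ominus>\<^bsub>?Y\<^esub> ?rv \<in> ideal_span ?Y" by (rule diff_span[OF v rv]) (simp add: pr_ret[OF vR])
  then have span: "lift n d (v \<ominus>\<^bsub>?Y\<^esub> ?rv) \<in> ideal_span ?Y" by (rule ideal_span_hom[OF Y Y lift_hom[OF d]])
  have "v = (v \<ominus>\<^bsub>?Y\<^esub> ?rv) \<oplus>\<^bsub>?Y\<^esub> ?rv"
    using Y.M.add_minus_cancel[OF v rv] Y.M.a_comm[OF w rv] by simp
  then have "lift n d v = lift n d (v \<ominus>\<^bsub>?Y\<^esub> ?rv) \<oplus>\<^bsub>?Y\<^esub> lift n d ?rv"
    using mod_homD(2)[OF lift_hom[OF d] w rv] by metis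
  then have "pr (lift n d v i) = pr (lift n d ?rv i)"
    using pr_add_span[OF span mod_homD(1)[OF lift_hom[OF d] rv]] by metis
  also have "lift n d ?rv = (\<lambda>j. ret (d v j))"
    by (rule base_change_apply[OF ring_axioms ring_axioms ret_hom d v])
  finally show ?thesis using mod_homD(1)[OF d v] by (simp add: pr_ret row_module_iff)
qed

text \<open>The block of the isomorphism on \<open>R\<^sup>n\<close> is invertible modulo the ideal, so composing with the
  automorphism of \<open>R\<^sup>n\<close> lifted along the section makes it the identity modulo the ideal.\<close>

lemma corner_cancel:
  assumes A: "left_module R A" "retract R A (Z a)" and B: "left_module R B" "retract R B (Z b)"
    and iso: "isomorphic_modules R (direct_sum A (row_module R n)) (direct_sum B (row_module R n))"
  shows "\<exists>k. isomorphic_modules R (direct_sum A (Z k)) (direct_sum B (Z k))"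
proof -
  let ?Y = "row_module R n"
  note Y = left_module_row[OF ring_axioms, of n]
  interpret A: left_module R A by (fact A)
  interpret B: left_module R B by (fact B)
  interpret Y: left_module R ?Y by (rule Y)
  note AY = left_module_direct_sum[OF A(1) Y] and BY = left_module_direct_sum[OF B(1) Y]
  obtain f g where f: "f \<in> mod_hom R (direct_sum A ?Y) (direct_sum B ?Y)"
    and g: "g \<in> mod_hom R (direct_sum B ?Y) (direct_sum A ?Y)"
    and gf: "\<forall>p\<in>carrier (direct_sum A ?Y). g (f p) = p" and fg: "\<forall>p\<in>carrier (direct_sum B ?Y). f (g p) = p"
    using isomorphic_modulesE[OF iso AY BY] .
  have snd: "snd \<in> mod_hom R (direct_sum M ?Y) ?Y" for M :: "('a, 'x) module"
    by (auto simp: mod_hom_def)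
  have fst: "fst \<in> mod_hom R (direct_sum M ?Y) M" for M :: "('a, 'x) module"
    by (auto simp: mod_hom_def)
  have inA: "(\<lambda>u. (\<zero>\<^bsub>A\<^esub>, u)) \<in> mod_hom R ?Y (direct_sum A ?Y)" by (auto simp: mod_hom_def A.smult_r_null)
  have inB: "(\<lambda>u. (\<zero>\<^bsub>B\<^esub>, u)) \<in> mod_hom R ?Y (direct_sum B ?Y)" by (auto simp: mod_hom_def B.smult_r_null)
  \<comment> \<open>The blocks of \<open>f\<close> and \<open>g\<close> on R^n. They are inverse to
    each other only modulo the ideal, hence the passage to \<open>?\<tau>\<close> and
    \<open>?\<delta>\<close>, which are genuine inverses.\<close>
  define d where "d = (\<lambda>u. snd (f (\<zero>\<^bsub>A\<^esub>, u)))"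
  define d' where "d' = (\<lambda>u. snd (g (\<zero>\<^bsub>B\<^esub>, u)))"
  have d: "d \<in> mod_hom R ?Y ?Y" unfolding d_def by (rule mod_hom_comp[OF mod_hom_comp[OF inA f] snd])
  have d': "d' \<in> mod_hom R ?Y ?Y" unfolding d'_def by (rule mod_hom_comp[OF mod_hom_comp[OF inB g] snd])
  have d'd: "pr (d' (d u) j) = pr (u j)" if "u \<in> carrier ?Y" for u j
    unfolding d_def d'_def by (rule block_inverse[OF A(1) B f g gf that])
  have dd': "pr (d (d' u) j) = pr (u j)" if "u \<in> carrier ?Y" for u j
    unfolding d_def d'_def by (rule block_inverse[OF B(1) A g f fg that])
  let ?\<tau> = "lift n d'" and ?\<delta> = "lift n d"
  note \<tau> = lift_hom[OF d'] and \<delta> = lift_hom[OF d]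
  have \<tau>\<delta>: "?\<tau> (?\<delta> v) = v" if "v \<in> carrier ?Y" for v by (rule lift_inverse[OF d d' d'd that])
  have \<delta>\<tau>: "?\<delta> (?\<tau> v) = v" if "v \<in> carrier ?Y" for v by (rule lift_inverse[OF d' d dd' that])
  let ?f = "\<lambda>p. (fst (f p), ?\<tau> (snd (f p)))" and ?g = "\<lambda>(y, v). g (y, ?\<delta> v)"
  have f1: "(\<lambda>p. fst (f p)) \<in> mod_hom R (direct_sum A ?Y) B" by (rule mod_hom_comp[OF f fst])
  have f2: "(\<lambda>p. ?\<tau> (snd (f p))) \<in> mod_hom R (direct_sum A ?Y) ?Y"
    by (rule mod_hom_comp[OF mod_hom_comp[OF f snd] \<tau>])
  have f': "?f \<in> mod_hom R (direct_sum A ?Y) (direct_sum B ?Y)"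
    using f1 f2 unfolding mod_hom_def by (auto simp del: power_module_simps)
  let ?k = "\<lambda>p. ?\<tau> (snd (f p)) \<ominus>\<^bsub>?Y\<^esub> snd p"
  have k: "?k \<in> mod_hom R (direct_sum A ?Y) ?Y" by (rule mod_hom_diff[OF AY Y f2 snd])
  \<comment> \<open>The component in \<open>A\<close>, a summand of a power of \<open>Re\<close>,
    contributes only to the span. On R^n the correction \<open>?\<tau>\<close> undoes the block
    \<open>d\<close> up to the ideal.\<close>
  have span: "?k p \<in> ideal_span ?Y" if p: "p \<in> carrier (direct_sum A ?Y)" for p
  proof -
    obtain x u where xu: "p = (x, u)" "x \<in> carrier A" "u \<in> carrier ?Y" using p by auto
    have ix: "(\<lambda>x. snd (f (x, \<zero>\<^bsub>?Y\<^esub>))) \<in> mod_hom R A ?Y"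
      by (rule mod_hom_comp[OF mod_hom_comp[OF _ f] snd]) (auto simp: mod_hom_def power_module_iff)
    note cx = mod_homD(1)[OF ix xu(2)] and du = mod_homD(1)[OF d xu(3)]
    have fp: "snd (f p) \<in> carrier ?Y" by (rule mod_homD(1)[OF mod_hom_comp[OF f snd] p])
    have "p = (x, \<zero>\<^bsub>?Y\<^esub>) \<oplus>\<^bsub>direct_sum A ?Y\<^esub> (\<zero>\<^bsub>A\<^esub>, u)"
      using xu Y.M.l_zero[OF xu(3)] by (simp del: power_module_simps)
    then have "snd (f p) = snd (f (x, \<zero>\<^bsub>?Y\<^esub>)) \<oplus>\<^bsub>?Y\<^esub> d u"
      using mod_homD(2)[OF mod_hom_comp[OF f snd], of "(x, \<zero>\<^bsub>?Y\<^esub>)" "(\<zero>\<^bsub>A\<^esub>, u)"] xu Y.M.zero_closed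
      by (simp add: d_def del: power_module_simps)
    then have "d' (snd (f p)) = d' (snd (f (x, \<zero>\<^bsub>?Y\<^esub>))) \<oplus>\<^bsub>?Y\<^esub> d' (d u)"
      using mod_homD(2)[OF d' cx du] by simp
    moreover have "d' (snd (f (x, \<zero>\<^bsub>?Y\<^esub>))) \<in> ideal_span ?Y"
      by (rule retract_Z_span[OF A(1) Y A(2) mod_hom_comp[OF ix d'] xu(2)])
    ultimately have pr: "pr (?\<tau> (snd (f p)) i) = pr (u i)" for i
      using pr_lift[OF d' fp, of i] pr_add_span[OF _ mod_homD(1)[OF d' du], of _ i] d'd[OF xu(3), of i]
      by metis
    show ?thesis
      using diff_span[OF mod_homD(1)[OF f2 p] xu(3) pr] xu(1) by simp
  qed
  have fgp: "fgp_module R (direct_sum A ?Y)"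
    by (rule fgp_direct_sum[OF retract_fgp_module[OF A fgp_Z] fgp_row_module[OF ring_axioms]])
  obtain N u w where u: "u \<in> mod_hom R (Z N) ?Y" and w: "w \<in> mod_hom R (direct_sum A ?Y) (Z N)"
    and uw: "\<forall>p\<in>carrier (direct_sum A ?Y). ?k p = u (w p)"
    using factor_through_Z[OF fgp Y k span] by blast
  have "isomorphic_modules R (direct_sum A (Z N)) (direct_sum B (Z N))"
  proof (rule direct_sum_exchange[OF A(1) B(1) Y left_module_Z f' _ _ _ u w])
    fix p assume p: "p \<in> carrier (direct_sum B ?Y)"
    obtain y v where yv: "p = (y, v)" "y \<in> carrier B" "v \<in> carrier ?Y" using p by auto
    have c: "(y, ?\<delta> v) \<in> carrier (direct_sum B ?Y)" using yv mod_homD(1)[OF \<delta>] by simp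
    show "?g p \<in> carrier (direct_sum A ?Y)" using mod_homD(1)[OF g c] yv by simp
    show "?f (?g p) = p" using fg c yv \<tau>\<delta> by simp
  next
    fix p assume p: "p \<in> carrier (direct_sum A ?Y)"
    have c: "snd (f p) \<in> carrier ?Y" by (rule mod_homD(1)[OF mod_hom_comp[OF f snd] p])
    show "?g (?f p) = p" using bspec[OF gf p] \<delta>\<tau>[OF c] by simp
  next
    fix x y assume x: "x \<in> carrier A" and y: "y \<in> carrier ?Y"
    then have p: "(x, y) \<in> carrier (direct_sum A ?Y)" by simp
    have "y \<oplus>\<^bsub>?Y\<^esub> u (w (x, y)) = y \<oplus>\<^bsub>?Y\<^esub> (?\<tau> (snd (f (x, y))) \<ominus>\<^bsub>?Y\<^esub> y)"
      using uw p by force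
    also have "\<dots> = ?\<tau> (snd (f (x, y)))" by (rule Y.M.add_minus_cancel[OF mod_homD(1)[OF f2 p] y])
    finally show "snd (?f (x, y)) = y \<oplus>\<^bsub>?Y\<^esub> u (w (x, y))" by simp
  qed
  then show ?thesis ..
qed

end

section \<open>Stable finiteness\<close>

text \<open>Endomorphisms of the left module R^n act on rows by right multiplication with matrices.
  Products of matrices therefore follow the order in which the maps are applied, as
  \<open>matrix_of_comp\<close> records.\<close>

definition matrix_of :: "nat \<Rightarrow> ('a, 'c) ring_scheme \<Rightarrow> ((nat \<Rightarrow> 'a) \<Rightarrow> nat \<Rightarrow> 'a) \<Rightarrow> nat \<times> nat \<Rightarrow> 'a"
  where "matrix_of n R a = (\<lambda>(i, j)\<in>{..<n} \<times> {..<n}. a (unit_row R i) j)"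

context
  fixes R :: "('a, 'c) ring_scheme" and n :: nat
  assumes R: "ring R"
begin

interpretation R: ring R by (fact R)

abbreviation (input) "End \<equiv> mod_hom R (row_module R n) (row_module R n)"

lemma matrix_of_closed:
  assumes "a \<in> End" shows "matrix_of n R a \<in> carrier (matrix_monoid R n)"
  using mod_homD(1)[OF assms unit_row_closed[OF R]]
  by (auto simp: matrix_of_def matrix_monoid_def row_module_iff)

lemma matrix_of_id: "matrix_of n R (\<lambda>u. u) = \<one>\<^bsub>matrix_monoid R n\<^esub>"
  by (auto simp: matrix_of_def matrix_monoid_def restrict_def fun_eq_iff)

lemma matrix_of_comp:
  assumes a: "a \<in> End" and b: "b \<in> End"
  shows "matrix_of n R (\<lambda>u. b (a u)) = matrix_of n R a \<otimes>\<^bsub>matrix_monoid R n\<^esub> matrix_of n R b"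
proof -
  have "b (a (unit_row R i)) j = finsum R (\<lambda>k. a (unit_row R i) k \<otimes>\<^bsub>R\<^esub> b (unit_row R k) j) {..<n}"
    if "i < n" for i j
  proof -
    let ?u = "a (unit_row R i)"
    have u: "?u \<in> carrier (row_module R n)" by (rule mod_homD(1)[OF a unit_row_closed[OF R that]])
    have bk: "b (unit_row R k) \<in> carrier (row_module R n)" if "k < n" for k
      by (rule mod_homD(1)[OF b unit_row_closed[OF R that]])
    have id: "(\<lambda>x. x) \<in> hom (add_monoid (regular_module R)) (add_monoid R)"
      by (simp add: hom_def)
    interpret RR: left_module R "regular_module R" by (rule left_module_regular[OF R])
    have "b ?u j = row_comb (row_module R n) n (\<lambda>k. b (unit_row R k)) ?u j"
      by (rule arg_cong[OF mod_hom_row_module[OF left_module_row[OF R] b u]])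
    also have "\<dots> = row_comb (regular_module R) n (\<lambda>k. b (unit_row R k) j) ?u"
      using u by (intro mod_hom_row_comb[OF left_module_row[OF R] left_module_regular[OF R] row_coordinate_hom[OF R]] bk)
        (simp_all add: row_module_iff)
    also have "\<dots> = finsum R (\<lambda>k. ?u k \<otimes>\<^bsub>R\<^esub> b (unit_row R k) j) {..<n}"
      unfolding row_comb_def regular_module_simps
      using u bk by (intro add_hom_finsum[OF RR.M.abelian_group_axioms R.abelian_group_axioms id])
        (simp_all add: row_module_iff)
    finally show ?thesis .
  qed
  moreover have "finsum R (\<lambda>k. a (unit_row R i) k \<otimes>\<^bsub>R\<^esub> b (unit_row R k) j) {..<n}
      = finsum R (\<lambda>k. matrix_of n R a (i, k) \<otimes>\<^bsub>R\<^esub> matrix_of n R b (k, j)) {..<n}"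
    if "i < n" "j < n" for i j
    using that mod_homD(1)[OF a unit_row_closed[OF R]] mod_homD(1)[OF b unit_row_closed[OF R]]
    by (intro R.finsum_cong') (auto simp: matrix_of_def row_module_iff)
  ultimately show ?thesis
    by (auto simp: matrix_of_def[of n R "\<lambda>u. b (a u)"] matrix_monoid_def restrict_def fun_eq_iff)
qed

lemma matrix_of_eqD:
  assumes a: "a \<in> End" and b: "b \<in> End" and eq: "matrix_of n R a = matrix_of n R b"
    and u: "u \<in> carrier (row_module R n)"
  shows "a u = b u"
proof (rule mod_hom_row_module_eqI[OF left_module_row[OF R] a b _ u])
  fix i assume i: "i < n"
  show "a (unit_row R i) = b (unit_row R i)"
  proof
    fix j
    show "a (unit_row R i) j = b (unit_row R i) j"
    proof (cases "j < n")
      case True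
      then show ?thesis using fun_cong[OF eq, of "(i, j)"] i by (simp add: matrix_of_def)
    next
      case False
      then show ?thesis
        using mod_homD(1)[OF a unit_row_closed[OF R i]] mod_homD(1)[OF b unit_row_closed[OF R i]]
        by (simp add: row_module_iff)
    qed
  qed
qed

lemma matrix_of_eq_one_iff:
  assumes c: "c \<in> End"
  shows "matrix_of n R c = \<one>\<^bsub>matrix_monoid R n\<^esub> \<longleftrightarrow> (\<forall>u\<in>carrier (row_module R n). c u = u)"
proof
  assume "matrix_of n R c = \<one>\<^bsub>matrix_monoid R n\<^esub>"
  then show "\<forall>u\<in>carrier (row_module R n). c u = u"
    using matrix_of_eqD[OF c mod_hom_id] matrix_of_id by metis
next
  assume "\<forall>u\<in>carrier (row_module R n). c u = u"
  then have "matrix_of n R c = matrix_of n R (\<lambda>u. u)"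
    using unit_row_closed[OF R] by (auto simp: matrix_of_def restrict_def fun_eq_iff)
  then show "matrix_of n R c = \<one>\<^bsub>matrix_monoid R n\<^esub>" using matrix_of_id by metis
qed

lemma matrix_of_surj:
  assumes "M \<in> carrier (matrix_monoid R n)"
  shows "\<exists>a\<in>End. matrix_of n R a = M"
proof -
  let ?m = "\<lambda>i j. if j < n then M (i, j) else \<zero>\<^bsub>R\<^esub>"
  have MR: "M (i, j) \<in> carrier R" if "i < n" "j < n" for i j
    using assms that by (auto simp: matrix_monoid_def PiE_iff)
  have m: "?m i \<in> carrier (row_module R n)" if "i < n" for i
    using MR[OF that] by (simp add: row_module_iff)
  have "row_comb (row_module R n) n ?m \<in> End" by (rule row_comb_hom[OF left_module_row[OF R] m])
  moreover have "matrix_of n R (row_comb (row_module R n) n ?m) = M"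
  proof
    fix p
    have "row_comb (row_module R n) n ?m (unit_row R i) = ?m i" if "i < n" for i
      by (rule row_comb_unit[OF left_module_row[OF R] m that])
    then show "matrix_of n R (row_comb (row_module R n) n ?m) p = M p"
      using assms by (cases p) (auto simp: matrix_of_def matrix_monoid_def PiE_iff extensional_def)
  qed
  ultimately show ?thesis by blast
qed

end

text \<open>Endomorphisms of R^n correspond to matrices, and \<open>A B = 1\<close> becomes the
  statement that \<open>b\<close> after \<open>a\<close> is the identity. In this form the property
  can be compared across summands and base change.\<close>

lemma stably_finite_iff:
  assumes R: "ring R"
  shows "stably_finite R \<longleftrightarrow> (\<forall>n. \<forall>a\<in>mod_hom R (row_module R n) (row_module R n).
    \<forall>b\<in>mod_hom R (row_module R n) (row_module R n).
      (\<forall>u\<in>carrier (row_module R n). b (a u) = u) \<longrightarrow> (\<forall>u\<in>carrier (row_module R n). a (b u) = u))"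
    (is "_ \<longleftrightarrow> (\<forall>n. ?P n)")
proof
  assume sf: "stably_finite R"
  show "\<forall>n. ?P n"
  proof (intro allI ballI impI)
    fix n a b u
    assume a: "a \<in> mod_hom R (row_module R n) (row_module R n)"
      and b: "b \<in> mod_hom R (row_module R n) (row_module R n)"
      and ba: "\<forall>u\<in>carrier (row_module R n). b (a u) = u" and u: "u \<in> carrier (row_module R n)"
    show "a (b u) = u"
    proof (cases "n = 0")
      \<comment> \<open>Matrices have size at least 1 in \<open>stably_finite\<close>; for size 0
        there is only one row.\<close>
      case True
      then have "v = (\<lambda>i. \<zero>\<^bsub>R\<^esub>)" if "v \<in> carrier (row_module R n)" for v
        using that by (auto simp: power_module_iff)
      then show ?thesis using mod_homD(1)[OF a mod_homD(1)[OF b u]] u by metis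
    next
      case False
      have "matrix_of n R a \<otimes>\<^bsub>matrix_monoid R n\<^esub> matrix_of n R b = \<one>\<^bsub>matrix_monoid R n\<^esub>"
        using matrix_of_eq_one_iff[OF R mod_hom_comp[OF a b]] ba matrix_of_comp[OF R a b] by simp
      then have "matrix_of n R b \<otimes>\<^bsub>matrix_monoid R n\<^esub> matrix_of n R a = \<one>\<^bsub>matrix_monoid R n\<^esub>"
        using sf False matrix_of_closed[OF R a] matrix_of_closed[OF R b] unfolding stably_finite_def by simp
      then show ?thesis using matrix_of_eq_one_iff[OF R mod_hom_comp[OF b a]] u matrix_of_comp[OF R b a] by simp
    qed
  qed
next
  assume P: "\<forall>n. ?P n"
  show "stably_finite R"
    unfolding stably_finite_def
  proof (intro allI impI ballI)
    fix n :: nat and A B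
    assume A: "A \<in> carrier (matrix_monoid R n)" and B: "B \<in> carrier (matrix_monoid R n)"
      and AB: "A \<otimes>\<^bsub>matrix_monoid R n\<^esub> B = \<one>\<^bsub>matrix_monoid R n\<^esub>"
    obtain a where a: "a \<in> mod_hom R (row_module R n) (row_module R n)" "matrix_of n R a = A"
      using matrix_of_surj[OF R A] by (elim bexE)
    obtain b where b: "b \<in> mod_hom R (row_module R n) (row_module R n)" "matrix_of n R b = B"
      using matrix_of_surj[OF R B] by (elim bexE)
    have "\<forall>u\<in>carrier (row_module R n). b (a u) = u"
      using matrix_of_eq_one_iff[OF R mod_hom_comp[OF a(1) b(1)]] AB matrix_of_comp[OF R a(1) b(1)] a(2) b(2) by simp
    then have "\<forall>u\<in>carrier (row_module R n). a (b u) = u" using P a(1) b(1) by blast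
    then show "B \<otimes>\<^bsub>matrix_monoid R n\<^esub> A = \<one>\<^bsub>matrix_monoid R n\<^esub>"
      using matrix_of_eq_one_iff[OF R mod_hom_comp[OF b(1) a(1)]] matrix_of_comp[OF R b(1) a(1)] a(2) b(2) by simp
  qed
qed

lemmas stably_finiteD = stably_finite_iff[THEN iffD1, rule_format]

text \<open>An endomorphism \<open>a\<close> of a direct summand is extended by the identity of a complement.\<close>

lemma stably_finite_retract:
  assumes R: "ring R" and sf: "stably_finite R" and M: "left_module R M" "retract R M (row_module R n)"
    and a: "a \<in> mod_hom R M M" and b: "b \<in> mod_hom R M M"
    and ba: "\<forall>x\<in>carrier M. b (a x) = x" and x: "x \<in> carrier M"
  shows "a (b x) = x"
proof -
  let ?Y = "row_module R n"
  note Y = left_module_row[OF R, of n]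
  interpret Y: left_module R ?Y by (rule Y)
  interpret M: left_module R M by (fact M)
  obtain s q where s: "s \<in> mod_hom R M ?Y" and q: "q \<in> mod_hom R ?Y M" and qs: "\<forall>x\<in>carrier M. q (s x) = x"
    using M(2) by (rule retractE)
  note sc = mod_homD(1)[OF s] and qc = mod_homD(1)[OF q]
  define ext where "ext c u = s (c (q u)) \<oplus>\<^bsub>?Y\<^esub> (u \<ominus>\<^bsub>?Y\<^esub> s (q u))" for c u
  have ext_hom: "ext c \<in> mod_hom R ?Y ?Y" if c: "c \<in> mod_hom R M M" for c
  proof -
    have 1: "(\<lambda>u. s (c (q u))) \<in> mod_hom R ?Y ?Y" by (rule mod_hom_comp[OF mod_hom_comp[OF q c] s])
    have 2: "(\<lambda>u. u \<ominus>\<^bsub>?Y\<^esub> s (q u)) \<in> mod_hom R ?Y ?Y"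
      by (rule mod_hom_diff[OF Y Y mod_hom_id mod_hom_comp[OF q s]])
    note cl = mod_homD(1)[OF 1] mod_homD(1)[OF 2] and ad = mod_homD(2)[OF 1] mod_homD(2)[OF 2]
      and sm = mod_homD(3)[OF 1] mod_homD(3)[OF 2]
    show ?thesis
      unfolding mod_hom_def ext_def[abs_def]
      using cl ad sm by (auto simp: Y.smult_r_distr Y.M.a_ac simp del: power_module_simps)
  qed
  have q_ext: "q (ext c u) = c (q u)" if c: "c \<in> mod_hom R M M" and u: "u \<in> carrier ?Y" for c u
  proof -
    note cu = mod_homD(1)[OF c qc[OF u]]
    have d: "u \<ominus>\<^bsub>?Y\<^esub> s (q u) \<in> carrier ?Y" by (intro Y.M.minus_closed u sc qc)
    have "q (u \<ominus>\<^bsub>?Y\<^esub> s (q u)) = q u \<ominus>\<^bsub>M\<^esub> q (s (q u))"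
      by (rule mod_hom_minus[OF Y M(1) q u sc[OF qc[OF u]]])
    also have "\<dots> = \<zero>\<^bsub>M\<^esub>" using qs qc[OF u] by (simp add: M.M.minus_eq_zero_iff)
    finally show ?thesis
      unfolding ext_def using mod_homD(2)[OF q sc[OF cu] d] qs cu by simp
  qed
  \<comment> \<open>The part of \<open>u\<close> in the complement is left alone by
    \<open>ext c\<close>, so extensions compose like the maps they extend.\<close>
  have ext_rest: "ext c u \<ominus>\<^bsub>?Y\<^esub> s (q (ext c u)) = u \<ominus>\<^bsub>?Y\<^esub> s (q u)"
    if c: "c \<in> mod_hom R M M" and u: "u \<in> carrier ?Y" for c u
  proof -
    note cu = sc[OF mod_homD(1)[OF c qc[OF u]]]
    have d: "u \<ominus>\<^bsub>?Y\<^esub> s (q u) \<in> carrier ?Y" by (intro Y.M.minus_closed u sc qc)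
    show ?thesis
      unfolding q_ext[OF c u] unfolding ext_def
      using Y.M.add_minus_eq[OF d cu] Y.M.a_comm[OF cu d] by simp
  qed
  have "ext b (ext a u) = u" if u: "u \<in> carrier ?Y" for u
  proof -
    note au = mod_homD(1)[OF ext_hom[OF a] u]
    have "ext b (ext a u) = s (b (a (q u))) \<oplus>\<^bsub>?Y\<^esub> (u \<ominus>\<^bsub>?Y\<^esub> s (q u))"
      using ext_rest[OF a u] q_ext[OF a u] by (simp add: ext_def[of b])
    also have "\<dots> = s (q u) \<oplus>\<^bsub>?Y\<^esub> (u \<ominus>\<^bsub>?Y\<^esub> s (q u))" using ba qc[OF u] by simp
    also have "\<dots> = u" by (rule Y.M.add_minus_cancel[OF u sc[OF qc[OF u]]])
    finally show ?thesis .
  qed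
  then have "ext a (ext b (s x)) = s x"
    using stably_finiteD[OF R sf ext_hom[OF a] ext_hom[OF b] _ sc[OF x]] by blast
  then have "q (ext a (ext b (s x))) = x" using qs x by simp
  moreover have "q (ext a (ext b (s x))) = a (b x)"
    using q_ext[OF a mod_homD(1)[OF ext_hom[OF b] sc[OF x]]] q_ext[OF b sc[OF x]] qs x by simp
  ultimately show ?thesis by simp
qed

section \<open>Stable finiteness of R and of the corner ring\<close>

context idempotent
begin

text \<open>The R-linear extension to (Re)^n of an endomorphism of (eRe)^n, that is, the map it
  induces on the tensor product with \<open>Re\<close>, written in coordinates.\<close>

definition extend :: "nat \<Rightarrow> ((nat \<Rightarrow> 'a) \<Rightarrow> nat \<Rightarrow> 'a) \<Rightarrow> (nat \<Rightarrow> 'a) \<Rightarrow> nat \<Rightarrow> 'a"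
  where "extend n a = row_comb (Z n) n (\<lambda>i. a (unit_row C i))"

lemma cut_Z_subset: "u \<in> carrier (row_module C n) \<Longrightarrow> u \<in> carrier (Z n)"
  by (simp add: cut_Z[symmetric])

lemma Z_subset: "u \<in> carrier (Z n) \<Longrightarrow> u \<in> carrier (row_module R n)"
  by (simp add: Z_iff row_module_iff)

lemma unit_C: "i < n \<Longrightarrow> unit_row C i \<in> carrier (row_module C n)"
  by (rule unit_row_closed[OF ring_corner])

context
  fixes a :: "(nat \<Rightarrow> 'a) \<Rightarrow> nat \<Rightarrow> 'a" and n :: nat
  assumes a: "a \<in> mod_hom C (row_module C n) (row_module C n)"
begin

lemma extend_hom: "extend n a \<in> mod_hom R (Z n) (Z n)"
proof -
  have "extend n a \<in> mod_hom R (row_module R n) (Z n)"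
    unfolding extend_def
    by (rule row_comb_hom[OF left_module_Z cut_Z_subset[OF mod_homD(1)[OF a unit_C]]])
  then show ?thesis
    using Z_subset unfolding mod_hom_def by auto
qed

lemma extend_apply:
  assumes u: "u \<in> carrier (row_module C n)" shows "extend n a u = a u"
proof -
  note CR = left_module_row[OF ring_corner, of n]
  interpret CR: left_module C "row_module C n" by (rule CR)
  interpret Z: left_module R "Z n" by (rule left_module_Z)
  have id: "(\<lambda>x. x) \<in> hom (add_monoid (row_module C n)) (add_monoid (Z n))"
    unfolding hom_add_monoid_iff using cut_Z_subset by auto
  have au: "a (unit_row C i) \<in> carrier (row_module C n)" if "i < n" for i
    by (rule mod_homD(1)[OF a unit_C[OF that]])
  have uC: "u i \<in> carrier C" for i using u by (simp add: row_module_iff)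
  have sm: "u i \<odot>\<^bsub>Z n\<^esub> v = u i \<odot>\<^bsub>row_module C n\<^esub> v" for i v by simp
  have "a u = row_comb (row_module C n) n (\<lambda>i. a (unit_row C i)) u"
    by (rule mod_hom_row_module[OF CR a u])
  also have "\<dots> = extend n a u"
    unfolding row_comb_def extend_def sm
    by (rule add_hom_finsum[OF CR.M.abelian_group_axioms Z.M.abelian_group_axioms id])
      (use uC au in \<open>auto simp del: power_module_simps\<close>)
  finally show ?thesis by simp
qed

end

text \<open>As an R-module (Re)^n is generated by rows of (eRe)^n, namely by the rows
  \<open>unit_row C i\<close>.\<close>

lemma Z_hom_eqI:
  assumes M: "left_module R M" and "f \<in> mod_hom R (Z n) M" "g \<in> mod_hom R (Z n) M"
    "\<And>u. u \<in> carrier (row_module C n) \<Longrightarrow> f u = g u" "z \<in> carrier (Z n)"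
  shows "f z = g z"
proof -
  have "row_comb M n (\<lambda>i. f (unit_row C i)) z = row_comb M n (\<lambda>i. g (unit_row C i)) z"
    using assms(5) by (intro row_comb_cong[OF M] mod_homD(1)[OF assms(2)] cut_Z_subset[OF unit_C]
        assms(4)[OF unit_C]) (simp_all add: Z_iff)
  then show ?thesis
    using Z_hom_expand[OF M assms(2,5)] Z_hom_expand[OF M assms(3,5)] by simp
qed

text \<open>A left inverse over the corner ring extends to (Re)^n. This is a summand of R^n, where
  left inverses are two-sided, and restricting to (eRe)^n returns to the given maps.\<close>

lemma stably_finite_corner:
  assumes sf: "stably_finite R" shows "stably_finite C"
  unfolding stably_finite_iff[OF ring_corner]
proof (intro allI ballI impI)
  fix n a b u
  assume a: "a \<in> mod_hom C (row_module C n) (row_module C n)"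
    and b: "b \<in> mod_hom C (row_module C n) (row_module C n)"
    and ba: "\<forall>u\<in>carrier (row_module C n). b (a u) = u" and u: "u \<in> carrier (row_module C n)"
  have "extend n b (extend n a z) = z" if z: "z \<in> carrier (Z n)" for z
  proof (rule Z_hom_eqI[OF left_module_Z mod_hom_comp[OF extend_hom[OF a] extend_hom[OF b]] mod_hom_id _ z])
    fix v assume v: "v \<in> carrier (row_module C n)"
    show "extend n b (extend n a v) = v"
      using extend_apply[OF a v] extend_apply[OF b mod_homD(1)[OF a v]] ba v by simp
  qed
  then have "extend n a (extend n b u) = u"
    by (intro stably_finite_retract[OF ring_axioms sf left_module_Z retract_Z extend_hom[OF a] extend_hom[OF b]]
        ballI cut_Z_subset u)
  then show "a (b u) = u"
    using extend_apply[OF b u] extend_apply[OF a mod_homD(1)[OF b u]] by simp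
qed

text \<open>The endomorphisms restrict to (eRe)^n, where stable finiteness of the corner ring
  applies, and two maps agreeing there agree on all of (Re)^n.\<close>

lemma stably_finite_Z:
  assumes sf: "stably_finite C" and a: "a \<in> mod_hom R (Z n) (Z n)" and b: "b \<in> mod_hom R (Z n) (Z n)"
    and ba: "\<forall>z\<in>carrier (Z n). b (a z) = z" and z: "z \<in> carrier (Z n)"
  shows "a (b z) = z"
proof (rule Z_hom_eqI[OF left_module_Z mod_hom_comp[OF b a] mod_hom_id _ z])
  fix u assume u: "u \<in> carrier (row_module C n)"
  show "a (b u) = u"
    using stably_finiteD[OF ring_corner sf cut_hom[OF a, unfolded cut_Z] cut_hom[OF b, unfolded cut_Z] _ u]
      ba cut_Z_subset by blast
qed

end

section \<open>Stable finiteness of R and of the quotient\<close>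

context split_idempotent
begin

text \<open>Quotients of stably finite rings need not be stably finite. Here matrices over the
  quotient embed into matrices over R through \<open>\<sigma>\<close>, one-sided inverses are
  preserved, and the resulting identity is brought back by the quotient map.\<close>

lemma stably_finite_quotient:
  assumes sf: "stably_finite R" shows "stably_finite S"
  unfolding stably_finite_iff[OF ring_S]
proof (intro allI ballI impI)
  fix n a b u
  assume a: "a \<in> mod_hom S (row_module S n) (row_module S n)"
    and b: "b \<in> mod_hom S (row_module S n) (row_module S n)"
    and ba: "\<forall>u\<in>carrier (row_module S n). b (a u) = u" and u: "u \<in> carrier (row_module S n)"
  let ?L = "base_change S R \<sigma> n"
  note hom = base_change_hom[OF ring_S ring_axioms \<sigma>_hom]
  note app = base_change_apply[OF ring_S ring_axioms \<sigma>_hom]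
  have "?L b (?L a v) = v" if "v \<in> carrier (row_module R n)" for v
    by (rule base_change_inverse[OF ring_S ring_axioms \<sigma>_hom a b _ that]) (simp add: ba)
  then have "?L a (?L b (\<lambda>i. \<sigma> (u i))) = (\<lambda>i. \<sigma> (u i))"
    using stably_finiteD[OF ring_axioms sf hom[OF a] hom[OF b] _ row_module_hom_closed[OF ring_S ring_axioms \<sigma>_hom u]]
    by blast
  then have "(\<lambda>i. \<sigma> (a (b u) i)) = (\<lambda>i. \<sigma> (u i))"
    unfolding app[OF b u] app[OF a mod_homD(1)[OF b u]] .
  then have "pr (\<sigma> (a (b u) i)) = pr (\<sigma> (u i))" for i by metis
  moreover have "a (b u) i \<in> carrier S" "u i \<in> carrier S" for i
    using mod_homD(1)[OF a mod_homD(1)[OF b u]] u by (simp_all add: row_module_iff)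
  ultimately show "a (b u) = u" by (simp add: pr_\<sigma> fun_eq_iff)
qed

text \<open>After multiplying with lifts of the reductions of \<open>a\<close> and \<open>b\<close> we may assume that \<open>a\<close> is the
  identity modulo the ideal, so that \<open>a = 1 + u w\<close> with \<open>u w\<close> factoring through a power of \<open>Re\<close>, where
  \<open>1 + w u\<close> is left invertible, hence invertible.\<close>

lemma stably_finite_extension:
  assumes sfC: "stably_finite C" and sfS: "stably_finite S"
  shows "stably_finite R"
  unfolding stably_finite_iff[OF ring_axioms]
proof (intro allI ballI impI)
  fix n a b y0
  let ?Y = "row_module R n"
  note Y = left_module_row[OF ring_axioms, of n]
  interpret Y: left_module R ?Y by (rule Y)
  assume a: "a \<in> mod_hom R ?Y ?Y" and b: "b \<in> mod_hom R ?Y ?Y"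
    and ba: "\<forall>u\<in>carrier ?Y. b (a u) = u" and y0: "y0 \<in> carrier ?Y"
  let ?P = "base_change R S pr n"
  note homP = base_change_hom[OF ring_axioms ring_S pr_hom]
  note appP = base_change_apply[OF ring_axioms ring_S pr_hom]
  have "?P b (?P a v) = v" if "v \<in> carrier (row_module S n)" for v
    by (rule base_change_inverse[OF ring_axioms ring_S pr_hom a b _ that]) (simp add: ba)
  then have PabP: "?P a (?P b v) = v" if "v \<in> carrier (row_module S n)" for v
    using stably_finiteD[OF ring_S sfS homP[OF a] homP[OF b] _ that] by blast
  have ab: "pr (a (b u) i) = pr (u i)" if u: "u \<in> carrier ?Y" for u i
  proof -
    have "(\<lambda>i. pr (a (b u) i)) = ?P a (?P b (\<lambda>i. pr (u i)))"
      unfolding appP[OF b u] appP[OF a mod_homD(1)[OF b u]] ..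
    also have "\<dots> = (\<lambda>i. pr (u i))" by (rule PabP[OF row_module_hom_closed[OF ring_axioms ring_S pr_hom u]])
    finally show ?thesis by metis
  qed
  let ?a = "lift n a" and ?b = "lift n b"
  note la = lift_hom[OF a] and lb = lift_hom[OF b]
  have ba': "?b (?a v) = v" if "v \<in> carrier ?Y" for v by (rule lift_inverse[OF a b _ that]) (simp add: ba)
  have ab': "?a (?b v) = v" if "v \<in> carrier ?Y" for v by (rule lift_inverse[OF b a ab that])
  \<comment> \<open>The lifts \<open>?a\<close> and \<open>?b\<close> invert each other and have the
    residues of \<open>a\<close> and \<open>b\<close>. So \<open>\<alpha>\<close> is the identity
    modulo the ideal, while \<open>\<beta>\<close> remains a left inverse of it because the lifts
    cancel in the middle and leave \<open>b\<close> after \<open>a\<close>.\<close>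
  define \<alpha> where "\<alpha> = (\<lambda>u. ?b (a u))"
  define \<beta> where "\<beta> = (\<lambda>u. b (?a u))"
  have \<alpha>: "\<alpha> \<in> mod_hom R ?Y ?Y" unfolding \<alpha>_def by (rule mod_hom_comp[OF a lb])
  have \<beta>: "\<beta> \<in> mod_hom R ?Y ?Y" unfolding \<beta>_def by (rule mod_hom_comp[OF la b])
  note \<alpha>c = mod_homD(1)[OF \<alpha>] and \<beta>c = mod_homD(1)[OF \<beta>]
  have \<beta>\<alpha>: "\<beta> (\<alpha> u) = u" if u: "u \<in> carrier ?Y" for u
    unfolding \<alpha>_def \<beta>_def using ab'[OF mod_homD(1)[OF a u]] ba u by simp
  let ?k = "\<lambda>u. \<alpha> u \<ominus>\<^bsub>?Y\<^esub> u"
  have k: "?k \<in> mod_hom R ?Y ?Y" by (rule mod_hom_diff[OF Y Y \<alpha> mod_hom_id])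
  have span: "?k u \<in> ideal_span ?Y" if u: "u \<in> carrier ?Y" for u
  proof -
    have pr: "pr (\<alpha> u i) = pr (u i)" for i
      using pr_lift[OF b mod_homD(1)[OF a u], of i] ba u by (simp add: \<alpha>_def)
    show ?thesis by (rule diff_span[OF \<alpha>c[OF u] u pr])
  qed
  obtain N u w where u: "u \<in> mod_hom R (Z N) ?Y" and w: "w \<in> mod_hom R ?Y (Z N)"
    and uw: "\<forall>y\<in>carrier ?Y. ?k y = u (w y)"
    using factor_through_Z[OF fgp_row_module[OF ring_axioms] Y k span] by blast
  interpret Z: left_module R "Z N" by (rule left_module_Z)
  note uc = mod_homD(1)[OF u] and wc = mod_homD(1)[OF w]
  have \<alpha>_eq: "\<alpha> y = y \<oplus>\<^bsub>?Y\<^esub> u (w y)" if y: "y \<in> carrier ?Y" for y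
    using uw[rule_format, OF y, symmetric] Y.M.add_minus_cancel[OF \<alpha>c[OF y] y] by simp
  \<comment> \<open>If \<open>\<beta>\<close> is a left inverse of 1 + u w, then 1 - w
    \<open>\<beta>\<close> u is a left inverse of 1 + w u; this is
    \<open>?\<gamma>'\<close>.\<close>
  let ?\<gamma> = "\<lambda>z. z \<oplus>\<^bsub>Z N\<^esub> w (u z)" and ?\<gamma>' = "\<lambda>z. z \<ominus>\<^bsub>Z N\<^esub> w (\<beta> (u z))"
  have wu: "(\<lambda>z. w (u z)) \<in> mod_hom R (Z N) (Z N)" by (rule mod_hom_comp[OF u w])
  have \<gamma>: "?\<gamma> \<in> mod_hom R (Z N) (Z N)"
    unfolding mod_hom_def
    using mod_homD[OF wu] by (auto simp: Z.smult_r_distr Z.M.a_ac simp del: power_module_simps)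
  have \<gamma>': "?\<gamma>' \<in> mod_hom R (Z N) (Z N)"
    by (rule mod_hom_diff[OF left_module_Z left_module_Z mod_hom_id mod_hom_comp[OF mod_hom_comp[OF u \<beta>] w]])
  have "?\<gamma>' (?\<gamma> z) = z" if z: "z \<in> carrier (Z N)" for z
  proof -
    have "u (?\<gamma> z) = \<alpha> (u z)"
      using \<alpha>_eq[OF uc[OF z]] mod_homD(2)[OF u z wc[OF uc[OF z]]] by simp
    then have "w (\<beta> (u (?\<gamma> z))) = w (u z)" using \<beta>\<alpha>[OF uc[OF z]] by simp
    then show ?thesis using Z.M.add_minus_eq[OF z wc[OF uc[OF z]]] by simp
  qed
  then have \<gamma>\<gamma>': "?\<gamma> (?\<gamma>' z) = z" if "z \<in> carrier (Z N)" for z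
    by (intro stably_finite_Z[OF sfC \<gamma> \<gamma>' _ that] ballI)
  have surj: "\<exists>x\<in>carrier ?Y. \<alpha> x = y" if y: "y \<in> carrier ?Y" for y
  proof -
    \<comment> \<open>A solution of (1 + w u) z = w y. Then \<open>w\<close> sends y - u z to
      \<open>z\<close>, so y - u z is a preimage of \<open>y\<close> under 1 + u w.\<close>
    define z where "z = ?\<gamma>' (w y)"
    have z: "z \<in> carrier (Z N)" unfolding z_def by (rule mod_homD(1)[OF \<gamma>' wc[OF y]])
    have zw: "z \<oplus>\<^bsub>Z N\<^esub> w (u z) = w y" unfolding z_def by (rule \<gamma>\<gamma>'[OF wc[OF y]])
    have yu: "y \<ominus>\<^bsub>?Y\<^esub> u z \<in> carrier ?Y" by (rule Y.M.minus_closed[OF y uc[OF z]])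
    have "w (y \<ominus>\<^bsub>?Y\<^esub> u z) = w y \<ominus>\<^bsub>Z N\<^esub> w (u z)" by (rule mod_hom_minus[OF Y left_module_Z w y uc[OF z]])
    also have "\<dots> = z" unfolding zw[symmetric] by (rule Z.M.add_minus_eq[OF z wc[OF uc[OF z]]])
    finally have "\<alpha> (y \<ominus>\<^bsub>?Y\<^esub> u z) = (y \<ominus>\<^bsub>?Y\<^esub> u z) \<oplus>\<^bsub>?Y\<^esub> u z" using \<alpha>_eq[OF yu] by simp
    also have "\<dots> = y" by (rule Y.M.minus_add_cancel[OF y uc[OF z]])
    finally show ?thesis using yu by blast
  qed
  have \<alpha>\<beta>: "\<alpha> (\<beta> y) = y" if "y \<in> carrier ?Y" for y
    using surj[OF that] \<beta>\<alpha> by (elim bexE) auto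
  \<comment> \<open>The identity for \<open>\<alpha>\<close> and \<open>\<beta>\<close> is evaluated
    at \<open>?b y0\<close> and multiplied by \<open>?a\<close>, which cancels the lifts on both
    sides.\<close>
  let ?v = "?b y0"
  have v: "?v \<in> carrier ?Y" by (rule mod_homD(1)[OF lb y0])
  have c: "a (b (?a ?v)) \<in> carrier ?Y"
    by (intro mod_homD(1)[OF a] mod_homD(1)[OF b] mod_homD(1)[OF la] v)
  have "?a (?b (a (b (?a ?v)))) = ?a ?v" using \<alpha>\<beta>[OF v] by (simp add: \<alpha>_def \<beta>_def)
  then show "a (b y0) = y0" using ab'[OF c] ab'[OF y0] by simp
qed

end

section \<open>The split exact sequence\<close>

text \<open>Tensoring with this bimodule is extension of scalars along \<open>\<sigma>\<close>; it
  induces the splitting of the exact sequence.\<close>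

definition section_bimodule :: "('a, 'c) ring_scheme \<Rightarrow> ('s \<Rightarrow> 'a) \<Rightarrow> ('a, 's, 'a) bimodule"
  where "section_bimodule R \<sigma> =
    \<lparr>carrier = carrier R, monoid.mult = undefined, one = undefined,
     ring.zero = \<zero>\<^bsub>R\<^esub>, add = add R, smult = monoid.mult R, rsmult = (\<lambda>x s. x \<otimes>\<^bsub>R\<^esub> \<sigma> s)\<rparr>"

context split_idempotent
begin

abbreviation (input) "H \<equiv> section_bimodule R \<sigma>"

lemma H_simps [simp]:
  "carrier H = carrier R" "\<zero>\<^bsub>H\<^esub> = \<zero>" "x \<oplus>\<^bsub>H\<^esub> y = x \<oplus> y" "r \<odot>\<^bsub>H\<^esub> x = r \<otimes> x" "rsmult H x s = x \<otimes> \<sigma> s"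
  by (simp_all add: section_bimodule_def)

lemma \<sigma>_simps [simp]:
  "s \<in> carrier S \<Longrightarrow> \<sigma> s \<in> carrier R"
  "s \<in> carrier S \<Longrightarrow> t \<in> carrier S \<Longrightarrow> \<sigma> (s \<oplus>\<^bsub>S\<^esub> t) = \<sigma> s \<oplus> \<sigma> t"
  "s \<in> carrier S \<Longrightarrow> t \<in> carrier S \<Longrightarrow> \<sigma> (s \<otimes>\<^bsub>S\<^esub> t) = \<sigma> s \<otimes> \<sigma> t"
  by (fact ring_hom_closed[OF \<sigma>_hom] ring_hom_add[OF \<sigma>_hom] ring_hom_mult[OF \<sigma>_hom])+

lemma left_module_H: "left_module R H"
proof -
  have "abelian_group H"
    by (rule abelian_groupI) (auto simp: a_ac r_neg intro!: bexI[of _ "\<ominus> _"])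
  then show ?thesis
    by (intro left_module.intro left_module_axioms.intro ring_axioms)
      (auto simp: l_distr r_distr m_assoc)
qed

sublocale H: fgp_bimodule R "R Quot corner_ideal R e" "section_bimodule R \<sigma>"
proof (intro fgp_bimodule.intro bimodule.intro fgp_bimodule_axioms.intro left_module_H ring_S)
  have "power_module H n = row_module R n" for n by (simp add: power_module_def)
  then show "retract R (power_module H n) (row_module R n)" for n
    using retractI[OF mod_hom_id mod_hom_id refl] by metis
qed (auto simp: l_distr r_distr m_assoc)

text \<open>Extending scalars along \<open>\<sigma>\<close> and then along the quotient map is
  extension along their composite, the identity. Concretely the residue of \<open>r\<close> acts on
  \<open>y\<close>, and the inverse tensors \<open>y\<close> twice with the identity.\<close>

lemma red_induced:
  assumes Y: "left_module S Y"
  shows "isomorphic_modules S (red (tensor S H Y)) Y"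
proof -
  interpret T: tensor_product R S H Y by (rule H.tensor_product[OF Y])
  let ?M = "tensor S H Y"
  note M = T.left_module_tensor
  interpret U: tensor_product S R Q ?M by (rule Q.tensor_product[OF M])
  let ?t = "tens S H Y"
  have "balanced_map S H Y Y (\<lambda>r y. pr r \<odot>\<^bsub>Y\<^esub> y)"
    by (auto simp: balanced_map_def T.M.smult_l_distr T.M.smult_r_distr T.M.smult_assoc pr_\<sigma>)
  then obtain f where f: "f \<in> hom (add_monoid ?M) (add_monoid Y)"
    "\<forall>r\<in>carrier H. \<forall>y\<in>carrier Y. f (?t r y) = pr r \<odot>\<^bsub>Y\<^esub> y"
    using T.tensor_lift_add[OF T.M.M.abelian_group_axioms] by blast
  have fc: "f m \<in> carrier Y" if "m \<in> carrier ?M" for m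
    using f(1) that by (auto simp: hom_add_monoid_iff)
  have fa: "f (m \<oplus>\<^bsub>?M\<^esub> m') = f m \<oplus>\<^bsub>Y\<^esub> f m'" if "m \<in> carrier ?M" "m' \<in> carrier ?M" for m m'
    using f(1) that by (simp add: hom_add_monoid_iff)
  have fs: "f (r \<odot>\<^bsub>?M\<^esub> m) = pr r \<odot>\<^bsub>Y\<^esub> f m" if r: "r \<in> carrier R" and m: "m \<in> carrier ?M" for r m
  proof (rule T.tensor_add_hom_eqI[where f = "\<lambda>m. f (r \<odot>\<^bsub>?M\<^esub> m)" and g = "\<lambda>m. pr r \<odot>\<^bsub>Y\<^esub> f m",
        OF T.M.M.abelian_group_axioms _ _ _ m])
    show "(\<lambda>m. f (r \<odot>\<^bsub>?M\<^esub> m)) \<in> hom (add_monoid ?M) (add_monoid Y)"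
      unfolding hom_add_monoid_iff using r fc fa T.T.smult_r_distr[OF r] T.T.smult_closed[OF r] by simp
    show "(\<lambda>m. pr r \<odot>\<^bsub>Y\<^esub> f m) \<in> hom (add_monoid ?M) (add_monoid Y)"
      unfolding hom_add_monoid_iff using r fc fa T.M.smult_r_distr[of "pr r"] by simp
    show "f (r \<odot>\<^bsub>?M\<^esub> ?t b y) = pr r \<odot>\<^bsub>Y\<^esub> f (?t b y)" if "b \<in> carrier H" "y \<in> carrier Y" for b y
      using f(2) that r T.smult_tens[OF r that] T.M.smult_assoc[of "pr r" "pr b" y] by simp
  qed
  let ?j = "\<lambda>y. cls ?M (?t \<one> y)"
  have tc: "?t \<one> y \<in> carrier ?M" if "y \<in> carrier Y" for y by (rule T.tens_closed) (use that in simp_all)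
  have j: "?j \<in> hom (add_monoid Y) (add_monoid (red ?M))"
    unfolding hom_add_monoid_iff
    using tc cls_closed[OF M] cls_add[OF M] T.tens_add_right[of \<one>] by simp
  have jf: "?j (f m) = cls ?M m" if m: "m \<in> carrier ?M" for m
  proof (rule T.tensor_add_hom_eqI[where f = "\<lambda>m. ?j (f m)" and g = "cls ?M",
        OF U.abelian_group_tensor _ _ _ m])
    show "(\<lambda>m. ?j (f m)) \<in> hom (add_monoid ?M) (add_monoid (red ?M))"
      using j f(1) unfolding hom_add_monoid_iff by (simp add: Pi_iff)
    show "cls ?M \<in> hom (add_monoid ?M) (add_monoid (red ?M))" by (rule cls_add_hom[OF M])
    fix b y assume b: "b \<in> carrier H" and y: "y \<in> carrier Y"
    then have bR: "b \<in> carrier R" by simp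
    \<comment> \<open>Moving the residue of \<open>b\<close> across the tensor sign yields
      \<open>\<sigma> (pr b)\<close> in place of \<open>b\<close>. The two scalars agree only after
      reduction, which is why \<open>cls\<close> is applied next.\<close>
    have "?t \<one> (pr b \<odot>\<^bsub>Y\<^esub> y) = \<sigma> (pr b) \<odot>\<^bsub>?M\<^esub> ?t \<one> y"
      using T.tens_rsmult[of \<one> "pr b" y] T.smult_tens[of "\<sigma> (pr b)" \<one> y] bR y by simp
    then have "?j (pr b \<odot>\<^bsub>Y\<^esub> y) = cls ?M (\<sigma> (pr b) \<odot>\<^bsub>?M\<^esub> ?t \<one> y)" by (simp only:)
    also have "\<dots> = pr (\<sigma> (pr b)) \<odot>\<^bsub>red ?M\<^esub> ?j y"
      by (rule cls_smult[OF M _ tc[OF y]]) (simp add: bR)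
    also have "\<dots> = pr b \<odot>\<^bsub>red ?M\<^esub> ?j y" using bR by (simp add: pr_\<sigma>)
    also have "\<dots> = cls ?M (b \<odot>\<^bsub>?M\<^esub> ?t \<one> y)" by (rule cls_smult[OF M bR tc[OF y], symmetric])
    also have "b \<odot>\<^bsub>?M\<^esub> ?t \<one> y = ?t b y" using T.smult_tens[of b \<one> y] bR y by simp
    finally show "?j (f (?t b y)) = cls ?M (?t b y)" using f(2) b y by simp
  qed
  show ?thesis
  proof (rule U.tensor_isomorphic[OF Y _ _ j, of "\<lambda>s m. s \<odot>\<^bsub>Y\<^esub> f m"])
    show "balanced_map R Q ?M Y (\<lambda>s m. s \<odot>\<^bsub>Y\<^esub> f m)"
      using fc fa fs by (auto simp: balanced_map_def T.M.smult_l_distr T.M.smult_r_distr T.M.smult_assoc)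
    show "(a \<odot>\<^bsub>Q\<^esub> b) \<odot>\<^bsub>Y\<^esub> f m = a \<odot>\<^bsub>Y\<^esub> (b \<odot>\<^bsub>Y\<^esub> f m)"
      if "a \<in> carrier S" "b \<in> carrier Q" "m \<in> carrier ?M" for a b m
      using that fc by (simp add: T.M.smult_assoc)
    fix s m assume s: "s \<in> carrier Q" and m: "m \<in> carrier ?M"
    obtain r where r: "r \<in> carrier R" "s = pr r" using pr_surj s by auto
    have "?j (s \<odot>\<^bsub>Y\<^esub> f m) = cls ?M (r \<odot>\<^bsub>?M\<^esub> m)"
      using jf[OF T.T.smult_closed[OF r(1) m]] fs[OF r(1) m] r(2) by simp
    then show "?j (s \<odot>\<^bsub>Y\<^esub> f m) = tens R Q ?M s m" using tens_eq_cls[OF M r(1) m] r(2) by simp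
  next
    fix h y assume h: "\<forall>s\<in>carrier Q. \<forall>m\<in>carrier ?M. h (tens R Q ?M s m) = s \<odot>\<^bsub>Y\<^esub> f m" and y: "y \<in> carrier Y"
    have "h (?j y) = \<one>\<^bsub>S\<^esub> \<odot>\<^bsub>Y\<^esub> f (?t \<one> y)" using h tc[OF y] by (simp add: cls_def)
    also have "f (?t \<one> y) = y" using f(2)[rule_format, of \<one> y] y T.M.smult_one[OF y] by simp
    finally show "h (?j y) = y" using T.M.smult_one[OF y] by simp
  qed
qed

text \<open>The homomorphisms are pinned down by their values on classes of modules, so each
  identity is checked on such classes and carried to differences of them by \<open>K0_elim\<close>.
  Exactness in the middle is read off from \<open>decomp\<close>.\<close>

lemma K0_split_short_exact:
  assumes \<phi>: "\<phi> \<in> hom (K0 C) (K0 R)" "\<forall>P :: ('a, nat \<Rightarrow> 'a) module. fgp_module C P \<longrightarrow>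
      \<phi> (K0_class C P) = K0_class R (tensor C Be P)"
    and \<psi>: "\<psi> \<in> hom (K0 R) (K0 S)" "\<forall>P :: ('a, nat \<Rightarrow> 'a) module. fgp_module R P \<longrightarrow>
      \<psi> (K0_class R P) = K0_class S (red P)"
  shows "split_short_exact (K0 C) (K0 R) (K0 S) \<phi> \<psi>"
proof -
  interpret KC: comm_group "K0 C" by (rule comm_group_K0[OF ring_corner])
  interpret KR: comm_group "K0 R" by (rule comm_group_K0[OF ring_axioms])
  interpret KS: comm_group "K0 S" by (rule comm_group_K0[OF ring_S])
  obtain s where s: "s \<in> hom (K0 S) (K0 R)" "\<forall>P :: ('a set, nat \<Rightarrow> 'a set) module. fgp_module S P \<longrightarrow>
      s (K0_class S P) = K0_class R (tensor S H P)"
    using H.K0_tensor_hom by (elim bexE)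
  interpret \<phi>: group_hom "K0 C" "K0 R" \<phi> using \<phi>(1) by unfold_locales
  interpret \<psi>: group_hom "K0 R" "K0 S" \<psi> using \<psi>(1) by unfold_locales
  interpret s: group_hom "K0 S" "K0 R" s using s(1) by unfold_locales
  note \<phi>_class = Be.K0_tensor_hom_class[OF \<phi>(2)]
  note \<psi>_class = Q.K0_tensor_hom_class[OF \<psi>(2)]
  note s_class = H.K0_tensor_hom_class[OF s(2)]
  note clC = K0_class_closed[OF ring_corner]
  note clR = K0_class_closed[OF ring_axioms]
  note clS = K0_class_closed[OF ring_S]
  have \<psi>s: "\<psi> (s x) = x" if x: "x \<in> carrier (K0 S)" for x
  proof -
    have 1: "\<psi> (s (K0_class S P)) = K0_class S P" if P: "fgp_module S P" for P :: "('a set, nat \<Rightarrow> 'a set) module"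
      unfolding s_class[OF P] \<psi>_class[OF H.fgp_tensor[OF P]]
      by (intro K0_class_cong[OF ring_S] red_induced fgp_left_module P Q.fgp_tensor H.fgp_tensor)
    obtain P P' :: "('a set, nat \<Rightarrow> 'a set) module" where P: "fgp_module S P" "fgp_module S P'"
      "x = K0_class S P \<otimes>\<^bsub>K0 S\<^esub> inv\<^bsub>K0 S\<^esub> K0_class S P'" using K0_elim[OF ring_S x] .
    then show ?thesis using 1[OF P(1)] 1[OF P(2)] clS[OF P(1)] clS[OF P(2)] by simp
  qed
  have \<psi>\<phi>: "\<psi> (\<phi> a) = \<one>\<^bsub>K0 S\<^esub>" if a: "a \<in> carrier (K0 C)" for a
  proof -
    have 1: "\<psi> (\<phi> (K0_class C P)) = \<one>\<^bsub>K0 S\<^esub>" if P: "fgp_module C P" for P :: "('a, nat \<Rightarrow> 'a) module"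
    proof -
      note FP = Be.fgp_tensor[OF P]
      obtain n where "retract R (tensor C Be P) (Z n)" using tensor_retract_Z[OF P] ..
      then have "carrier (red (tensor C Be P)) = {\<zero>\<^bsub>red (tensor C Be P)\<^esub>}"
        by (rule red_trivial[OF fgp_left_module[OF FP]])
      then show ?thesis
        unfolding \<phi>_class[OF P] \<psi>_class[OF FP]
        by (intro K0_class_trivial(2)[OF ring_S] left_module_red fgp_left_module FP)
    qed
    obtain P P' :: "('a, nat \<Rightarrow> 'a) module" where P: "fgp_module C P" "fgp_module C P'"
      "a = K0_class C P \<otimes>\<^bsub>K0 C\<^esub> inv\<^bsub>K0 C\<^esub> K0_class C P'" using K0_elim[OF ring_corner a] .
    then show ?thesis using 1[OF P(1)] 1[OF P(2)] clC[OF P(1)] clC[OF P(2)] by simp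
  qed
  \<comment> \<open>Summands of powers of \<open>Re\<close> come from the corner ring, so the
    correction terms produced by \<open>red_isomorphic_imp\<close> lie in the image of
    \<open>\<phi>\<close>.\<close>
  have \<phi>_cut: "K0_class R M = \<phi> (K0_class C (cut M))" "K0_class C (cut M) \<in> carrier (K0 C)"
    if M: "left_module R M" "retract R M (Z n)" for M :: "('a, 'x) module" and n
  proof -
    note cM = fgp_cut[OF M]
    show "K0_class C (cut M) \<in> carrier (K0 C)" by (rule clC[OF cM])
    have "fgp_module R M" by (rule retract_fgp_module[OF M fgp_Z])
    then show "K0_class R M = \<phi> (K0_class C (cut M))"
      unfolding \<phi>_class[OF cM]
      by (intro K0_class_cong[OF ring_axioms tensor_cut[OF M], symmetric] Be.fgp_tensor cM)
  qed
  have decomp: "\<exists>a\<in>carrier (K0 C). x = \<phi> a \<otimes>\<^bsub>K0 R\<^esub> s (\<psi> x)" if x: "x \<in> carrier (K0 R)" for x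
  proof -
    have 1: "\<exists>a\<in>carrier (K0 C). K0_class R M = \<phi> a \<otimes>\<^bsub>K0 R\<^esub> s (\<psi> (K0_class R M))"
      if M: "fgp_module R M" for M :: "('a, nat \<Rightarrow> 'a) module"
    proof -
      let ?N = "tensor S H (red M)"
      have redM: "fgp_module S (red M)" by (rule Q.fgp_tensor[OF M])
      note N = H.fgp_tensor[OF redM]
      have "isomorphic_modules S (red M) (red ?N)"
        by (rule isomorphic_modules_sym[OF red_induced[OF fgp_left_module[OF redM]]])
          (intro left_module_red fgp_left_module N redM)+
      from red_isomorphic_imp[OF M N this]
      obtain n m and K :: "('a, (nat \<Rightarrow> 'a) \<times> (nat \<Rightarrow> 'a)) module" where K: "left_module R K" "retract R K (Z m)"
        and iso: "isomorphic_modules R (direct_sum ?N K) (direct_sum M (Z n))" by (elim exE conjE)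
      have fK: "fgp_module R K" by (rule retract_fgp_module[OF K fgp_Z])
      have Zn: "retract R (Z n) (Z n)" by (rule retractI[OF mod_hom_id mod_hom_id refl])
      have "K0_class R (direct_sum ?N K) = K0_class R (direct_sum M (Z n))"
        by (intro K0_class_cong[OF ring_axioms iso] fgp_direct_sum N fK M fgp_Z)
      then have eq: "s (\<psi> (K0_class R M)) \<otimes>\<^bsub>K0 R\<^esub> \<phi> (K0_class C (cut K))
          = K0_class R M \<otimes>\<^bsub>K0 R\<^esub> \<phi> (K0_class C (cut (Z n)))"
        unfolding K0_class_direct_sum[OF ring_axioms N fK] K0_class_direct_sum[OF ring_axioms M fgp_Z]
          \<phi>_cut(1)[OF K] \<phi>_cut(1)[OF left_module_Z Zn] \<psi>_class[OF M] s_class[OF redM] .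
      \<comment> \<open>Obtained by solving \<open>eq\<close> for the class of \<open>M\<close>: the
        correction terms on the two sides are collected into one element of the group of the corner
        ring.\<close>
      let ?a = "K0_class C (cut K) \<otimes>\<^bsub>K0 C\<^esub> inv\<^bsub>K0 C\<^esub> K0_class C (cut (Z n))"
      note c = \<phi>_cut(2)[OF K] \<phi>_cut(2)[OF left_module_Z Zn]
      have cM: "K0_class R M \<in> carrier (K0 R)" "s (\<psi> (K0_class R M)) \<in> carrier (K0 R)"
        using clR[OF M] by auto
      have "\<phi> ?a \<otimes>\<^bsub>K0 R\<^esub> s (\<psi> (K0_class R M))
          = (s (\<psi> (K0_class R M)) \<otimes>\<^bsub>K0 R\<^esub> \<phi> (K0_class C (cut K))) \<otimes>\<^bsub>K0 R\<^esub> inv\<^bsub>K0 R\<^esub> \<phi> (K0_class C (cut (Z n)))"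
        using c cM by (simp add: KR.m_ac)
      also have "\<dots> = K0_class R M"
        unfolding eq using c cM by (simp add: KR.m_assoc)
      finally show ?thesis using c by (intro bexI[of _ ?a]) simp_all
    qed
    obtain P P' :: "('a, nat \<Rightarrow> 'a) module" where P: "fgp_module R P" "fgp_module R P'"
      and xP: "x = K0_class R P \<otimes>\<^bsub>K0 R\<^esub> inv\<^bsub>K0 R\<^esub> K0_class R P'" using K0_elim[OF ring_axioms x] .
    obtain a where a: "a \<in> carrier (K0 C)" "K0_class R P = \<phi> a \<otimes>\<^bsub>K0 R\<^esub> s (\<psi> (K0_class R P))"
      using 1[OF P(1)] by (elim bexE)
    obtain a' where a': "a' \<in> carrier (K0 C)" "K0_class R P' = \<phi> a' \<otimes>\<^bsub>K0 R\<^esub> s (\<psi> (K0_class R P'))"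
      using 1[OF P(2)] by (elim bexE)
    note cl = clR[OF P(1)] clR[OF P(2)]
    let ?sP = "s (\<psi> (K0_class R P))" and ?sP' = "s (\<psi> (K0_class R P'))"
    have sc: "?sP \<in> carrier (K0 R)" "?sP' \<in> carrier (K0 R)" "\<phi> a \<in> carrier (K0 R)" "\<phi> a' \<in> carrier (K0 R)"
      using cl a a' by auto
    have "x = (\<phi> a \<otimes>\<^bsub>K0 R\<^esub> ?sP) \<otimes>\<^bsub>K0 R\<^esub> inv\<^bsub>K0 R\<^esub> (\<phi> a' \<otimes>\<^bsub>K0 R\<^esub> ?sP')"
      using xP a(2) a'(2) by simp
    also have "\<dots> = (\<phi> a \<otimes>\<^bsub>K0 R\<^esub> inv\<^bsub>K0 R\<^esub> \<phi> a') \<otimes>\<^bsub>K0 R\<^esub> (?sP \<otimes>\<^bsub>K0 R\<^esub> inv\<^bsub>K0 R\<^esub> ?sP')"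
      using sc by (simp add: KR.inv_mult KR.m_ac)
    also have "?sP \<otimes>\<^bsub>K0 R\<^esub> inv\<^bsub>K0 R\<^esub> ?sP' = s (\<psi> x)" unfolding xP using cl by simp
    also have "\<phi> a \<otimes>\<^bsub>K0 R\<^esub> inv\<^bsub>K0 R\<^esub> \<phi> a' = \<phi> (a \<otimes>\<^bsub>K0 C\<^esub> inv\<^bsub>K0 C\<^esub> a')" using a a' by simp
    finally show ?thesis using a a' by (intro bexI[of _ "a \<otimes>\<^bsub>K0 C\<^esub> inv\<^bsub>K0 C\<^esub> a'"]) simp_all
  qed
  have inj: "a = \<one>\<^bsub>K0 C\<^esub>" if a: "a \<in> carrier (K0 C)" and zero: "\<phi> a = \<one>\<^bsub>K0 R\<^esub>" for a
  proof -
    obtain P P' :: "('a, nat \<Rightarrow> 'a) module" where P: "fgp_module C P" "fgp_module C P'"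
      and aP: "a = K0_class C P \<otimes>\<^bsub>K0 C\<^esub> inv\<^bsub>K0 C\<^esub> K0_class C P'" using K0_elim[OF ring_corner a] .
    let ?A = "tensor C Be P" and ?B = "tensor C Be P'"
    note A = Be.fgp_tensor[OF P(1)] and B = Be.fgp_tensor[OF P(2)]
    note A' = fgp_left_module[OF A] and B' = fgp_left_module[OF B]
    note cl = clC[OF P(1)] clC[OF P(2)]
    have "\<phi> (K0_class C P) \<otimes>\<^bsub>K0 R\<^esub> inv\<^bsub>K0 R\<^esub> \<phi> (K0_class C P') = \<one>\<^bsub>K0 R\<^esub>"
      using zero cl unfolding aP by simp
    then have "\<phi> (K0_class C P) = \<phi> (K0_class C P')"
      using cl by (metis KR.inv_closed KR.inv_equality KR.inv_inv \<phi>.hom_closed)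
    then have eq: "K0_class R ?A = K0_class R ?B" unfolding \<phi>_class[OF P(1)] \<phi>_class[OF P(2)] .
    obtain M :: "('a, nat \<Rightarrow> 'a) module" where M: "fgp_module R M"
      and iso: "isomorphic_modules R (direct_sum ?A M) (direct_sum ?B M)"
      using K0_class_eqD[OF ring_axioms A B eq] .
    note M' = fgp_left_module[OF M]
    obtain n where "retract R M (row_module R n)" using M by (rule fgp_moduleE)
    then obtain i q where i: "i \<in> mod_hom R M (row_module R n)" and q: "q \<in> mod_hom R (row_module R n) M"
      and qi: "\<forall>x\<in>carrier M. q (i x) = x" by (rule retractE)
    let ?Y = "row_module R n"
    note Y = left_module_row[OF ring_axioms, of n]
    \<comment> \<open>A complement of \<open>M\<close> in R^n. Adding it replaces the stabilizing
      module, about which nothing is known, by R^n as in \<open>corner_cancel\<close>.\<close>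
    let ?K = "kernel_module ?Y M q"
    have K: "left_module R ?K" by (rule left_module_kernel[OF Y M' q])
    have MK: "isomorphic_modules R (direct_sum M ?K) ?Y"
      by (rule retract_direct_sum[OF Y M' q i]) (rule bspec[OF qi])
    have YMK: "isomorphic_modules R ?Y (direct_sum M ?K)"
      by (rule isomorphic_modules_sym[OF MK left_module_direct_sum[OF M' K] Y])
    have assoc: "isomorphic_modules R (direct_sum N (direct_sum M ?K)) (direct_sum (direct_sum N M) ?K)"
      if N: "left_module R N" for N :: "('a, ('a \<times> (nat \<Rightarrow> 'a) \<Rightarrow>\<^sub>0 int) set) module"
      by (rule isomorphic_modules_sym[OF isomorphic_direct_sum_assoc]) (intro left_module_direct_sum N M' K)+
    have "isomorphic_modules R (direct_sum ?A ?Y) (direct_sum (direct_sum ?A M) ?K)"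
      by (rule isomorphic_modules_trans[OF isomorphic_direct_sum_cong[OF isomorphic_modules_refl YMK] assoc[OF A']])
    from isomorphic_modules_trans[OF isomorphic_modules_trans[OF this
          isomorphic_direct_sum_cong[OF iso isomorphic_modules_refl]] isomorphic_direct_sum_assoc]
    have "isomorphic_modules R (direct_sum ?A ?Y) (direct_sum ?B (direct_sum M ?K))" .
    from isomorphic_modules_trans[OF this isomorphic_direct_sum_cong[OF isomorphic_modules_refl MK]]
    have "isomorphic_modules R (direct_sum ?A ?Y) (direct_sum ?B ?Y)" .
    moreover obtain r where "retract R ?A (Z r)" using tensor_retract_Z[OF P(1)] ..
    moreover obtain r' where "retract R ?B (Z r')" using tensor_retract_Z[OF P(2)] ..
    ultimately obtain k where k: "isomorphic_modules R (direct_sum ?A (Z k)) (direct_sum ?B (Z k))"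
      using corner_cancel[OF A' _ B'] by blast
    \<comment> \<open>Back over the corner ring, both sides are \<open>P\<close> and
      \<open>P'\<close> plus the same module \<open>?cZ\<close>. Its class cancels in the group,
      although modules themselves need not cancel.\<close>
    have cut_k: "isomorphic_modules C (cut (direct_sum ?A (Z k))) (cut (direct_sum ?B (Z k)))"
      by (rule cut_isomorphic[OF k]) (intro left_module_direct_sum A' B' left_module_Z)+
    let ?cZ = "cut (Z k)"
    have fgp_cZ: "fgp_module C ?cZ"
      by (rule fgp_cut[OF left_module_Z retractI[OF mod_hom_id mod_hom_id refl]])
    have cut_sum: "isomorphic_modules C (direct_sum N ?cZ) (cut (direct_sum (tensor C Be N) (Z k)))"
      if N: "fgp_module C N" for N :: "('a, nat \<Rightarrow> 'a) module"
    proof -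
      note N' = fgp_left_module[OF N] and FN = fgp_left_module[OF Be.fgp_tensor[OF N]]
      have "isomorphic_modules C (direct_sum (cut (tensor C Be N)) ?cZ) (cut (direct_sum (tensor C Be N) (Z k)))"
        by (rule isomorphic_modules_sym[OF cut_direct_sum])
          (intro left_module_cut left_module_direct_sum FN left_module_Z)+
      then show ?thesis
        by (rule isomorphic_modules_trans[OF
              isomorphic_direct_sum_cong[OF cut_tensor[OF N'] isomorphic_modules_refl]])
    qed
    have "isomorphic_modules C (cut (direct_sum ?B (Z k))) (direct_sum P' ?cZ)"
      by (rule isomorphic_modules_sym[OF cut_sum[OF P(2)]])
        (intro left_module_cut left_module_direct_sum fgp_left_module P B' left_module_Z fgp_cZ)+
    from isomorphic_modules_trans[OF isomorphic_modules_trans[OF cut_sum[OF P(1)] cut_k] this]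
    have "K0_class C (direct_sum P ?cZ) = K0_class C (direct_sum P' ?cZ)"
      by (rule K0_class_cong[OF ring_corner]) (intro fgp_direct_sum P fgp_cZ)+
    then have "K0_class C P = K0_class C P'"
      unfolding K0_class_direct_sum[OF ring_corner P(1) fgp_cZ] K0_class_direct_sum[OF ring_corner P(2) fgp_cZ]
      by (rule KC.right_cancel[OF clC[OF fgp_cZ] cl, THEN iffD1])
    then show ?thesis unfolding aP using cl by simp
  qed
  have "\<phi> ` carrier (K0 C) = kernel (K0 R) (K0 S) \<psi>"
  proof (intro equalityI subsetI)
    show "x \<in> kernel (K0 R) (K0 S) \<psi>" if "x \<in> \<phi> ` carrier (K0 C)" for x
      using that \<psi>\<phi> by (auto simp: kernel_def)
    fix x assume "x \<in> kernel (K0 R) (K0 S) \<psi>"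
    then have x: "x \<in> carrier (K0 R)" "\<psi> x = \<one>\<^bsub>K0 S\<^esub>" by (simp_all add: kernel_def)
    obtain a where a: "a \<in> carrier (K0 C)" "x = \<phi> a \<otimes>\<^bsub>K0 R\<^esub> s (\<psi> x)" using decomp[OF x(1)] by (elim bexE)
    \<comment> \<open>With trivial image under \<open>\<psi>\<close>, the summand coming from the
      splitting disappears from the decomposition.\<close>
    then have "x = \<phi> a" using x(2) by simp
    then show "x \<in> \<phi> ` carrier (K0 C)" using a(1) by (rule image_eqI)
  qed
  moreover have "\<psi> ` carrier (K0 R) = carrier (K0 S)"
  proof (intro equalityI subsetI)
    show "x \<in> carrier (K0 S)" if "x \<in> \<psi> ` carrier (K0 R)" for x using that by auto
    show "x \<in> \<psi> ` carrier (K0 R)" if "x \<in> carrier (K0 S)" for x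
      using \<psi>s[OF that] s.hom_closed[OF that] by (metis imageI)
  qed
  moreover have "inj_on \<phi> (carrier (K0 C))" using inj by (simp add: \<phi>.inj_on_one_iff)
  moreover have "\<exists>t\<in>hom (K0 S) (K0 R). \<forall>x\<in>carrier (K0 S). \<psi> (t x) = x"
    by (intro bexI[OF _ s(1)] ballI \<psi>s)
  ultimately show ?thesis
    unfolding split_short_exact_def
    using KC.comm_group_axioms KR.comm_group_axioms KS.comm_group_axioms \<phi>(1) \<psi>(1) by (intro conjI)
qed

end

theorem theorem2p2:
  fixes R :: "('a, 'c) ring_scheme" and e :: 'a
  defines "S \<equiv> R Quot (corner_ideal R e)"
    and "\<pi> \<equiv> (\<lambda>r. corner_ideal R e +>\<^bsub>R\<^esub> r)"
  assumes "ring R"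
    and "e \<in> carrier R" and "e \<otimes>\<^bsub>R\<^esub> e = e"
    and "\<exists>\<sigma>\<in>ring_hom S R. \<forall>x\<in>carrier S. \<pi> (\<sigma> x) = x"
  shows "(\<exists>\<phi> \<psi>.
      (\<forall>P :: ('a, nat \<Rightarrow> 'a) module. fgp_module (corner_ring R e) P \<longrightarrow>
        \<phi> (K0_class (corner_ring R e) P)
          = K0_class R (tensor (corner_ring R e) (corner_bimodule R e) P)) \<and>
      (\<forall>Q :: ('a, nat \<Rightarrow> 'a) module. fgp_module R Q \<longrightarrow>
        \<psi> (K0_class R Q)
          = K0_class S (tensor R (quotient_bimodule R (corner_ideal R e)) Q)) \<and>
      split_short_exact (K0 (corner_ring R e)) (K0 R) (K0 S) \<phi> \<psi>)
    \<and> (stably_finite R \<longleftrightarrow> stably_finite (corner_ring R e) \<and> stably_finite S)"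
proof -
  obtain \<sigma> where \<sigma>: "\<sigma> \<in> ring_hom S R" "\<forall>x\<in>carrier S. \<pi> (\<sigma> x) = x"
    using assms(6) by (elim bexE)
  interpret R: split_idempotent R e \<sigma>
  proof (intro split_idempotent.intro split_idempotent_axioms.intro idempotent.intro idempotent_axioms.intro)
    show "\<sigma> \<in> ring_hom (R Quot corner_ideal R e) R" using \<sigma>(1) by (simp add: S_def)
    show "corner_ideal R e +>\<^bsub>R\<^esub> \<sigma> x = x" if "x \<in> carrier (R Quot corner_ideal R e)" for x
      using \<sigma>(2) that by (simp add: S_def \<pi>_def)
  qed (fact assms)+
  obtain \<phi> where \<phi>: "\<phi> \<in> hom (K0 (corner_ring R e)) (K0 R)"
    "\<forall>P :: ('a, nat \<Rightarrow> 'a) module. fgp_module (corner_ring R e) P \<longrightarrow> \<phi> (K0_class (corner_ring R e) P)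
      = K0_class R (tensor (corner_ring R e) (corner_bimodule R e) P)"
    using R.Be.K0_tensor_hom by (elim bexE)
  obtain \<psi> where \<psi>: "\<psi> \<in> hom (K0 R) (K0 S)"
    "\<forall>P :: ('a, nat \<Rightarrow> 'a) module. fgp_module R P \<longrightarrow> \<psi> (K0_class R P)
      = K0_class S (tensor R (quotient_bimodule R (corner_ideal R e)) P)"
    using R.Q.K0_tensor_hom unfolding S_def by (elim bexE)
  have "split_short_exact (K0 (corner_ring R e)) (K0 R) (K0 S) \<phi> \<psi>"
    unfolding S_def by (rule R.K0_split_short_exact[OF \<phi> \<psi>[unfolded S_def]])
  moreover have "stably_finite R \<longleftrightarrow> stably_finite (corner_ring R e) \<and> stably_finite S"
    unfolding S_def
    using R.stably_finite_corner R.stably_finite_quotient R.stably_finite_extension by (intro iffI conjI) simp_all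
  ultimately show ?thesis using \<phi>(2) \<psi>(2) by (intro conjI exI)
qed

end
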